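(* Let $(X,d)$ be a proper hyperbolic metric space with basepoint $o$ and $\Gamma$ a geometrically finite group of isometries of $X$ with parabolic elements. Assume $\Gamma$ has $\delta$-tempered parabolic subgroups, and $\mu$ is a measure on $\Lambda_\Gamma$ that satisfies the horoball shadow lemma with dimension $\delta$. For $\lambda\in(0,1)$ define $$\mathcal P_n(\lambda)=\{p\in\mathcal P:\lambda^{n+1}\le r_p\le\lambda^n\}.$$ Then there exist $\lambda\in(0,1)$ and a constant $k\ge1$ such that $$k^{-1}\lambda^{-n\delta}\le\#\mathcal P_n(\lambda)\le k\,\lambda^{-n\delta}$$ for all $n\in\mathbb N$.
   Context: Hyperbolic spaces. $(X,d)$ is a geodesic Gromov hyperbolic space with Gromov boundary $\partial X$. Busemann function: $\beta_\xi(x,y)=\liminf_{z\to\xi}(d(x,z)-d(y,z))$. Horoball of center $\xi\in\partial X$ and radius $r>0$: $H_\xi(r)=\{x\in X:\beta_\xi(x,o)\le\log r\}$. Its shadow $\mathcal H_\xi(r)\subset\partial X$ is the set of endpoints of geodesic rays starting at $o$ which intersect $H_\xi(r)$. Groups. $\Gamma$ acts properly discontinuously by isometries on $X$. The limit set $\Lambda_\Gamma\subset\partial X$ is the set of accumulation points of $\Gamma o$; $C_\Gamma$ is the union of all biinfinite geodesics with both endpoints in $\Lambda_\Gamma$. A subgroup of $\Gamma$ is parabolic if it is infinite, fixes a single point of $\partial X$ and contains no loxodromic element. $\xi\in\Lambda_\Gamma$ is a parabolic point if its stabilizer in $\Gamma$ is a parabolic subgroup, bounded parabolic if moreover $(\Lambda_\Gamma\setminus\{\xi\})/\mathrm{stab}_\Gamma(\xi)$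 is compact, and conical if there are $\gamma_n\in\Gamma$ and distinct $a,b\in\Lambda_\Gamma$ with $\gamma_n\xi\to a$ and $\gamma_n\eta\to b$ for all $\eta\in\Lambda_\Gamma\setminus\{\xi\}$. $\Gamma$ is geometrically finite if $|\Lambda_\Gamma|\ge3$ and every point of $\Lambda_\Gamma$ is conical or bounded parabolic. The set $\mathcal P$ of parabolic points then consists of finitely many $\Gamma$-orbits $\mathcal P^1,\dots,\mathcal P^a$; choose $p_i\in\mathcal P^i$ with stabilizer $\Pi_i$ and put $B_i(t)=\#\{g\in\Pi_i:d(o,go)\le t\}$. Horoball decomposition. Fix a family of pairwise disjoint horoballs $\{H_p\}_{p\in\mathcal P}$, $H_p=H_p(r_p)$ centered at $p$ with radius $r_p$, which is quasi-invariant (the Hausdorff distance between $H_{\gamma p}$ and $\gamma H_p$ is bounded uniformly in $\gamma\in\Gamma$, $p\in\mathcal P$) and such that $C_\Gamma\setminus\bigcup_pH_p$ has relatively compact image in $C_\Gamma/\Gamma$; such a family exists. Tempered growth. For a parabolic subgroup $\Pi$ put $B_\Pi(t)=\#\{g\in\Pi:d(o,go)\le t\}$, $A_{\Pi,r}(t)=\frac1r\log\frac{B_\Pi(t+r)}{B_\Pi(t)}$, $\delta_\Pi^-=\lim_{r\to\infty}\inf_{t>0}A_{\Pi,r}(t)$, $\delta_\Pi^+=\lim_{r\to\infty}\sup_{t>0}A_{\Pi,r}(t)$. $\Pi$ has $\delta$-tempered growth if $0<\delta_\Pi^-\le\delta_\Pi^+<\delta$. $\Gamma$ has $\delta$-tempered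 parabolic subgroups if every maximal parabolic subgroup has $\delta$-tempered growth. Horoball shadow lemma. A measure $\mu$ on $\partial X$ satisfies the horoball shadow lemma with dimension $\delta$ if for all $0<c_1<c_2$ there is a constant $k'\ge1$ such that $$k'^{-1}B_i(-2\log\theta)\theta^{2\delta}r_p^\delta\le\mu(\mathcal H_p(c\theta r_p))\le k'B_i(-2\log\theta)\theta^{2\delta}r_p^\delta$$ for all $0<\theta\le1$, all $c\in[c_1,c_2]$, all $p\in\mathcal P^i$ and all $i=1,\dots,a$. *)

theory Defs
  imports "HOL-Analysis.Analysis" "HOL-Algebra.Bij" "HOL-Algebra.Generated_Groups"
begin

section \<open>Hyperbolic spaces and the Gromov boundary\<close>

text \<open>
  The space \<open>X\<close> is a whole type of class \<^class>\<open>heine_borel\<close>, i.e. a proper metric space;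
  \<open>x\<^sub>0\<close> is the basepoint.
\<close>

definition geodesic_on :: "real set \<Rightarrow> (real \<Rightarrow> 'a::metric_space) \<Rightarrow> bool" where
  "geodesic_on I \<gamma> \<longleftrightarrow> (\<forall>s\<in>I. \<forall>t\<in>I. dist (\<gamma> s) (\<gamma> t) = \<bar>s - t\<bar>)"

definition geodesic_space :: "'a::metric_space set \<Rightarrow> bool" where
  "geodesic_space A \<longleftrightarrow> (\<forall>x\<in>A. \<forall>y\<in>A. \<exists>\<gamma>. geodesic_on {0..dist x y} \<gamma> \<and>
     \<gamma> 0 = x \<and> \<gamma> (dist x y) = y \<and> \<gamma> ` {0..dist x y} \<subseteq> A)"

definition gromov_product :: "'a::metric_space \<Rightarrow> 'a \<Rightarrow> 'a \<Rightarrow> real" where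
  "gromov_product w x y = (dist x w + dist y w - dist x y) / 2"

definition gromov_hyperbolic :: "'a::metric_space set \<Rightarrow> bool" where
  "gromov_hyperbolic A \<longleftrightarrow> (\<exists>D\<ge>0. \<forall>w\<in>A. \<forall>x\<in>A. \<forall>y\<in>A. \<forall>z\<in>A.
     gromov_product w x z \<ge> min (gromov_product w x y) (gromov_product w y z) - D)"

definition gromov_sequences :: "'a::metric_space \<Rightarrow> (nat \<Rightarrow> 'a) set" where
  "gromov_sequences x\<^sub>0 =
     {u. filterlim (\<lambda>(m, n). gromov_product x\<^sub>0 (u m) (u n)) at_top (sequentially \<times>\<^sub>F sequentially)}"

definition gromov_boundary :: "'a::metric_space \<Rightarrow> (nat \<Rightarrow> 'a) set set" where
  "gromov_boundary x\<^sub>0 = gromov_sequences x\<^sub>0 //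
     {(u, v). u \<in> gromov_sequences x\<^sub>0 \<and> v \<in> gromov_sequences x\<^sub>0 \<and>
        filterlim (\<lambda>n. gromov_product x\<^sub>0 (u n) (v n)) at_top sequentially}"

text \<open>
  The bordification \<open>X \<union> \<partial>X\<close> is a subset of the sum type: \<^term>\<open>Inl x\<close> is a point of \<open>X\<close>,
  \<^term>\<open>Inr \<xi>\<close> a boundary point. Points of \<open>X\<close> are represented by constant sequences, so that
  \<open>extended_product\<close> restricts to \<^const>\<open>gromov_product\<close> on \<open>X\<close>.
\<close>

definition bordification :: "'a::metric_space \<Rightarrow> ('a + (nat \<Rightarrow> 'a) set) set" where
  "bordification x\<^sub>0 = range Inl \<union> Inr ` gromov_boundary x\<^sub>0"

definition representatives :: "'a + (nat \<Rightarrow> 'a) set \<Rightarrow> (nat \<Rightarrow> 'a) set" where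
  "representatives p = (case p of Inl x \<Rightarrow> {\<lambda>_. x} | Inr \<xi> \<Rightarrow> \<xi>)"

definition extended_product ::
  "'a::metric_space \<Rightarrow> 'a + (nat \<Rightarrow> 'a) set \<Rightarrow> 'a + (nat \<Rightarrow> 'a) set \<Rightarrow> ereal" where
  "extended_product x\<^sub>0 p q = (SUP u\<in>representatives p. SUP v\<in>representatives q.
     Liminf (sequentially \<times>\<^sub>F sequentially) (\<lambda>(m, n). ereal (gromov_product x\<^sub>0 (u m) (v n))))"

text \<open>
  The usual topology on \<open>X \<union> \<partial>X\<close>: the sets of points \<open>p\<close> with \<open>(p|\<xi>) \<ge> R\<close> form a neighbourhood
  base at the boundary point \<open>\<xi>\<close>.
\<close>

definition bordification_topology :: "'a::metric_space \<Rightarrow> ('a + (nat \<Rightarrow> 'a) set) topology" where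
  "bordification_topology x\<^sub>0 = topology (\<lambda>U. U \<subseteq> bordification x\<^sub>0 \<and> open (Inl -` U) \<and>
     (\<forall>\<xi>. Inr \<xi> \<in> U \<longrightarrow>
        (\<exists>R::real. \<forall>p\<in>bordification x\<^sub>0. extended_product x\<^sub>0 p (Inr \<xi>) \<ge> ereal R \<longrightarrow> p \<in> U)))"

lemma openin_bordification_topology:
  "openin (bordification_topology x\<^sub>0) U \<longleftrightarrow> U \<subseteq> bordification x\<^sub>0 \<and> open (Inl -` U) \<and>
     (\<forall>\<xi>. Inr \<xi> \<in> U \<longrightarrow>
        (\<exists>R::real. \<forall>p\<in>bordification x\<^sub>0. extended_product x\<^sub>0 p (Inr \<xi>) \<ge> ereal R \<longrightarrow> p \<in> U))"
  (is "_ \<longleftrightarrow> ?L U")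
proof -
  have "istopology ?L"
    unfolding istopology_def
  proof (rule conjI; intro allI impI; intro conjI allI impI)
    fix S T assume S: "?L S" and T: "?L T"
    show "S \<inter> T \<subseteq> bordification x\<^sub>0"
      using conjunct1[OF S] by (rule le_infI1)
    show "open (Inl -` (S \<inter> T))"
      unfolding vimage_Int by (rule open_Int[OF conjunct1[OF conjunct2[OF S]] conjunct1[OF conjunct2[OF T]]])
    fix \<xi> assume \<xi>: "Inr \<xi> \<in> S \<inter> T"
    obtain R :: real where
      R: "\<forall>p\<in>bordification x\<^sub>0. extended_product x\<^sub>0 p (Inr \<xi>) \<ge> ereal R \<longrightarrow> p \<in> S"
      using conjunct2[OF conjunct2[OF S], rule_format, OF IntD1[OF \<xi>]] by (elim exE)
    obtain R' :: real where
      R': "\<forall>p\<in>bordification x\<^sub>0. extended_product x\<^sub>0 p (Inr \<xi>) \<ge> ereal R' \<longrightarrow> p \<in> T"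
      using conjunct2[OF conjunct2[OF T], rule_format, OF IntD2[OF \<xi>]] by (elim exE)
    have le: "ereal R \<le> e" "ereal R' \<le> e" if "ereal (max R R') \<le> e" for e
      by (rule order_trans[OF _ that], simp only: ereal_less_eq max.cobounded1 max.cobounded2)+
    show "\<exists>R::real. \<forall>p\<in>bordification x\<^sub>0.
        extended_product x\<^sub>0 p (Inr \<xi>) \<ge> ereal R \<longrightarrow> p \<in> S \<inter> T"
    proof (intro exI[of _ "max R R'"] ballI impI IntI)
      fix p assume p: "p \<in> bordification x\<^sub>0"
        and "ereal (max R R') \<le> extended_product x\<^sub>0 p (Inr \<xi>)"
      note le = le[OF this(2)]
      show "p \<in> S" by (rule R[rule_format, OF p le(1)])
      show "p \<in> T" by (rule R'[rule_format, OF p le(2)])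
    qed
  next
    fix \<K> assume K: "\<forall>K\<in>\<K>. ?L K"
    show "\<Union>\<K> \<subseteq> bordification x\<^sub>0"
      by (rule Union_least) (rule conjunct1[OF K[rule_format]])
    show "open (Inl -` \<Union>\<K>)"
      unfolding vimage_Union
      by (rule open_UN, rule ballI, rule conjunct1[OF conjunct2[OF K[rule_format]]])
    fix \<xi> assume "Inr \<xi> \<in> \<Union>\<K>"
    then obtain K where K': "K \<in> \<K>" "Inr \<xi> \<in> K" by (elim UnionE)
    obtain R :: real where
      R: "\<forall>p\<in>bordification x\<^sub>0. extended_product x\<^sub>0 p (Inr \<xi>) \<ge> ereal R \<longrightarrow> p \<in> K"
      using conjunct2[OF conjunct2[OF bspec[OF K K'(1)]], rule_format, OF K'(2)] by (elim exE)
    show "\<exists>R::real. \<forall>p\<in>bordification x\<^sub>0.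
        extended_product x\<^sub>0 p (Inr \<xi>) \<ge> ereal R \<longrightarrow> p \<in> \<Union>\<K>"
      by (intro exI[of _ R] ballI impI UnionI[OF K'(1)]) (rule R[rule_format])
  qed
  then show ?thesis
    unfolding bordification_topology_def by (rule topology_inverse'[THEN fun_cong])
qed

lemma topspace_bordification_topology [simp]:
  "topspace (bordification_topology x\<^sub>0) = bordification x\<^sub>0"
proof -
  have "openin (bordification_topology x\<^sub>0) (bordification x\<^sub>0)"
  proof -
    have "Inl -` bordification x\<^sub>0 = UNIV" by (auto simp: bordification_def)
    then show ?thesis unfolding openin_bordification_topology by simp
  qed
  then show ?thesis
    using openin_bordification_topology[of x\<^sub>0 "topspace (bordification_topology x\<^sub>0)"]
    by (intro subset_antisym) (simp_all add: openin_subset)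
qed

definition boundary_topology :: "'a::metric_space \<Rightarrow> (nat \<Rightarrow> 'a) set topology" where
  "boundary_topology x\<^sub>0 =
     pullback_topology (gromov_boundary x\<^sub>0) Inr (bordification_topology x\<^sub>0)"

definition converges_to_boundary ::
  "'a::metric_space \<Rightarrow> ('b \<Rightarrow> 'a) \<Rightarrow> (nat \<Rightarrow> 'a) set \<Rightarrow> 'b filter \<Rightarrow> bool" where
  "converges_to_boundary x\<^sub>0 f \<xi> F \<longleftrightarrow> limitin (bordification_topology x\<^sub>0) (\<lambda>t. Inl (f t)) (Inr \<xi>) F"

text \<open>The Busemann function is bounded by \<^term>\<open>dist x y\<close>; it is kept in \<^typ>\<open>ereal\<close> only because
  \<^const>\<open>Liminf\<close> needs a complete lattice.\<close>

definition busemann :: "'a::metric_space \<Rightarrow> (nat \<Rightarrow> 'a) set \<Rightarrow> 'a \<Rightarrow> 'a \<Rightarrow> ereal" where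
  "busemann x\<^sub>0 \<xi> x y = Liminf (filtercomap Inl (nhdsin (bordification_topology x\<^sub>0) (Inr \<xi>)))
     (\<lambda>z. ereal (dist x z - dist y z))"

definition horoball :: "'a::metric_space \<Rightarrow> (nat \<Rightarrow> 'a) set \<Rightarrow> real \<Rightarrow> 'a set" where
  "horoball x\<^sub>0 \<xi> r = {x. busemann x\<^sub>0 \<xi> x x\<^sub>0 \<le> ereal (ln r)}"

definition horoball_shadow ::
  "'a::metric_space \<Rightarrow> (nat \<Rightarrow> 'a) set \<Rightarrow> real \<Rightarrow> (nat \<Rightarrow> 'a) set set" where
  "horoball_shadow x\<^sub>0 \<xi> r = {\<eta> \<in> gromov_boundary x\<^sub>0. \<exists>\<gamma>. geodesic_on {0..} \<gamma> \<and> \<gamma> 0 = x\<^sub>0 \<and>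
     converges_to_boundary x\<^sub>0 \<gamma> \<eta> at_top \<and> (\<exists>t\<ge>0. \<gamma> t \<in> horoball x\<^sub>0 \<xi> r)}"


section \<open>Geometrically finite groups of isometries\<close>

definition isometry_group :: "('a::metric_space \<Rightarrow> 'a) set \<Rightarrow> bool" where
  "isometry_group \<Gamma> \<longleftrightarrow> subgroup \<Gamma> (BijGroup UNIV) \<and> (\<forall>g\<in>\<Gamma>. \<forall>x y. dist (g x) (g y) = dist x y)"

definition properly_discontinuous :: "('a::metric_space \<Rightarrow> 'a) set \<Rightarrow> bool" where
  "properly_discontinuous \<Gamma> \<longleftrightarrow> (\<forall>K. compact K \<longrightarrow> finite {g \<in> \<Gamma>. g ` K \<inter> K \<noteq> {}})"

definition boundary_action :: "('a \<Rightarrow> 'a) \<Rightarrow> (nat \<Rightarrow> 'a) set \<Rightarrow> (nat \<Rightarrow> 'a) set" where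
  "boundary_action g \<xi> = (\<lambda>u. g \<circ> u) ` \<xi>"

definition limit_set :: "'a::metric_space \<Rightarrow> ('a \<Rightarrow> 'a) set \<Rightarrow> (nat \<Rightarrow> 'a) set set" where
  "limit_set x\<^sub>0 \<Gamma> = {\<xi> \<in> gromov_boundary x\<^sub>0.
     Inr \<xi> \<in> bordification_topology x\<^sub>0 derived_set_of ((\<lambda>g. Inl (g x\<^sub>0)) ` \<Gamma>)}"

definition limit_hull :: "'a::metric_space \<Rightarrow> ('a \<Rightarrow> 'a) set \<Rightarrow> 'a set" where
  "limit_hull x\<^sub>0 \<Gamma> = \<Union> {range \<gamma> | \<gamma>. geodesic_on UNIV \<gamma> \<and>
     (\<exists>\<xi>\<in>limit_set x\<^sub>0 \<Gamma>. converges_to_boundary x\<^sub>0 \<gamma> \<xi> at_top) \<and>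
     (\<exists>\<eta>\<in>limit_set x\<^sub>0 \<Gamma>. converges_to_boundary x\<^sub>0 \<gamma> \<eta> at_bot)}"

text \<open>Loxodromic means positive stable translation length; the limit exists for every isometry
  and does not depend on the point \<open>x\<close>.\<close>

definition loxodromic :: "('a::metric_space \<Rightarrow> 'a) \<Rightarrow> bool" where
  "loxodromic g \<longleftrightarrow> (\<exists>\<tau>>0. \<forall>x. (\<lambda>n. dist x ((g ^^ n) x) / real n) \<longlonglongrightarrow> \<tau>)"

definition stabilizer :: "('a \<Rightarrow> 'a) set \<Rightarrow> (nat \<Rightarrow> 'a) set \<Rightarrow> ('a \<Rightarrow> 'a) set" where
  "stabilizer \<Gamma> \<xi> = {g \<in> \<Gamma>. boundary_action g \<xi> = \<xi>}"

definition parabolic_subgroup ::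
  "'a::metric_space \<Rightarrow> ('a \<Rightarrow> 'a) set \<Rightarrow> ('a \<Rightarrow> 'a) set \<Rightarrow> bool" where
  "parabolic_subgroup x\<^sub>0 \<Gamma> H \<longleftrightarrow> subgroup H (BijGroup UNIV) \<and> H \<subseteq> \<Gamma> \<and> infinite H \<and>
     (\<exists>!\<xi>. \<xi> \<in> gromov_boundary x\<^sub>0 \<and> (\<forall>g\<in>H. boundary_action g \<xi> = \<xi>)) \<and>
     \<not> (\<exists>g\<in>H. loxodromic g)"

definition maximal_parabolic_subgroup ::
  "'a::metric_space \<Rightarrow> ('a \<Rightarrow> 'a) set \<Rightarrow> ('a \<Rightarrow> 'a) set \<Rightarrow> bool" where
  "maximal_parabolic_subgroup x\<^sub>0 \<Gamma> H \<longleftrightarrow> parabolic_subgroup x\<^sub>0 \<Gamma> H \<and>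
     (\<forall>K. parabolic_subgroup x\<^sub>0 \<Gamma> K \<and> H \<subseteq> K \<longrightarrow> K = H)"

definition parabolic_element :: "'a::metric_space \<Rightarrow> ('a \<Rightarrow> 'a) set \<Rightarrow> ('a \<Rightarrow> 'a) \<Rightarrow> bool" where
  "parabolic_element x\<^sub>0 \<Gamma> g \<longleftrightarrow>
     g \<in> \<Gamma> \<and> parabolic_subgroup x\<^sub>0 \<Gamma> (generate (BijGroup UNIV) {g})"

definition parabolic_points :: "'a::metric_space \<Rightarrow> ('a \<Rightarrow> 'a) set \<Rightarrow> (nat \<Rightarrow> 'a) set set" where
  "parabolic_points x\<^sub>0 \<Gamma> =
     {\<xi> \<in> limit_set x\<^sub>0 \<Gamma>. parabolic_subgroup x\<^sub>0 \<Gamma> (stabilizer \<Gamma> \<xi>)}"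

definition boundary_orbit :: "('a \<Rightarrow> 'a) set \<Rightarrow> (nat \<Rightarrow> 'a) set \<Rightarrow> (nat \<Rightarrow> 'a) set set" where
  "boundary_orbit \<Gamma> \<xi> = (\<lambda>g. boundary_action g \<xi>) ` \<Gamma>"

definition quotient_topology :: "'a topology \<Rightarrow> ('a \<Rightarrow> 'b) \<Rightarrow> 'b topology" where
  "quotient_topology T q =
     topology (\<lambda>U. U \<subseteq> q ` topspace T \<and> openin T {x \<in> topspace T. q x \<in> U})"

lemma quotient_map_quotient_topology: "quotient_map T (quotient_topology T q) q"
proof -
  let ?L = "\<lambda>U. U \<subseteq> q ` topspace T \<and> openin T {x \<in> topspace T. q x \<in> U}"
  have "istopology ?L"
    unfolding istopology_def
  proof (intro conjI allI impI)
    fix S U assume S: "?L S" and U: "?L U"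
    show "S \<inter> U \<subseteq> q ` topspace T" using S by blast
    have "{x \<in> topspace T. q x \<in> S \<inter> U} = {x \<in> topspace T. q x \<in> S} \<inter> {x \<in> topspace T. q x \<in> U}"
      by blast
    then show "openin T {x \<in> topspace T. q x \<in> S \<inter> U}" using S U by auto
  next
    fix \<K> assume K: "\<forall>K\<in>\<K>. ?L K"
    show "\<Union>\<K> \<subseteq> q ` topspace T" using K by blast
    have "{x \<in> topspace T. q x \<in> \<Union>\<K>} = \<Union> ((\<lambda>K. {x \<in> topspace T. q x \<in> K}) ` \<K>)"
      by blast
    then show "openin T {x \<in> topspace T. q x \<in> \<Union>\<K>}" using K by auto
  qed
  then have op: "openin (quotient_topology T q) U \<longleftrightarrow> ?L U" for U
    unfolding quotient_topology_def by (simp add: topology_inverse')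
  have "openin (quotient_topology T q) (q ` topspace T)"
  proof -
    have "{x \<in> topspace T. q x \<in> q ` topspace T} = topspace T" by blast
    then show ?thesis unfolding op by simp
  qed
  then have "topspace (quotient_topology T q) = q ` topspace T"
    using op[of "topspace (quotient_topology T q)"]
    by (intro subset_antisym) (simp_all add: openin_subset)
  then show ?thesis
    unfolding quotient_map_def by (simp add: op)
qed

definition bounded_parabolic_point ::
  "'a::metric_space \<Rightarrow> ('a \<Rightarrow> 'a) set \<Rightarrow> (nat \<Rightarrow> 'a) set \<Rightarrow> bool" where
  "bounded_parabolic_point x\<^sub>0 \<Gamma> \<xi> \<longleftrightarrow> \<xi> \<in> parabolic_points x\<^sub>0 \<Gamma> \<and>
     compact_space (quotient_topology (subtopology (boundary_topology x\<^sub>0) (limit_set x\<^sub>0 \<Gamma> - {\<xi>}))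
       (boundary_orbit (stabilizer \<Gamma> \<xi>)))"

definition conical_point ::
  "'a::metric_space \<Rightarrow> ('a \<Rightarrow> 'a) set \<Rightarrow> (nat \<Rightarrow> 'a) set \<Rightarrow> bool" where
  "conical_point x\<^sub>0 \<Gamma> \<xi> \<longleftrightarrow> \<xi> \<in> limit_set x\<^sub>0 \<Gamma> \<and>
     (\<exists>(g :: nat \<Rightarrow> 'a \<Rightarrow> 'a) a b. range g \<subseteq> \<Gamma> \<and> a \<in> limit_set x\<^sub>0 \<Gamma> \<and> b \<in> limit_set x\<^sub>0 \<Gamma> \<and> a \<noteq> b \<and>
        limitin (boundary_topology x\<^sub>0) (\<lambda>n. boundary_action (g n) \<xi>) a sequentially \<and>
        (\<forall>\<eta>\<in>limit_set x\<^sub>0 \<Gamma> - {\<xi>}.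
           limitin (boundary_topology x\<^sub>0) (\<lambda>n. boundary_action (g n) \<eta>) b sequentially))"

definition geometrically_finite :: "'a::metric_space \<Rightarrow> ('a \<Rightarrow> 'a) set \<Rightarrow> bool" where
  "geometrically_finite x\<^sub>0 \<Gamma> \<longleftrightarrow> isometry_group \<Gamma> \<and> properly_discontinuous \<Gamma> \<and>
     (\<exists>S \<subseteq> limit_set x\<^sub>0 \<Gamma>. card S = 3) \<and>
     (\<forall>\<xi>\<in>limit_set x\<^sub>0 \<Gamma>. conical_point x\<^sub>0 \<Gamma> \<xi> \<or> bounded_parabolic_point x\<^sub>0 \<Gamma> \<xi>)"

text \<open>\<open>p 1, \<dots>, p a\<close> are representatives of the orbits of parabolic points, one for each orbit.\<close>

definition parabolic_representatives ::
  "'a::metric_space \<Rightarrow> ('a \<Rightarrow> 'a) set \<Rightarrow> nat \<Rightarrow> (nat \<Rightarrow> (nat \<Rightarrow> 'a) set) \<Rightarrow> bool" where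
  "parabolic_representatives x\<^sub>0 \<Gamma> a p \<longleftrightarrow> p ` {1..a} \<subseteq> parabolic_points x\<^sub>0 \<Gamma> \<and>
     (\<forall>q\<in>parabolic_points x\<^sub>0 \<Gamma>. \<exists>!i. i \<in> {1..a} \<and> q \<in> boundary_orbit \<Gamma> (p i))"


section \<open>Growth of parabolic subgroups\<close>

definition orbit_count :: "'a::metric_space \<Rightarrow> ('a \<Rightarrow> 'a) set \<Rightarrow> real \<Rightarrow> nat" where
  "orbit_count x\<^sub>0 H t = card {g \<in> H. dist x\<^sub>0 (g x\<^sub>0) \<le> t}"

definition growth_rate :: "'a::metric_space \<Rightarrow> ('a \<Rightarrow> 'a) set \<Rightarrow> real \<Rightarrow> real \<Rightarrow> real" where
  "growth_rate x\<^sub>0 H r t =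
     1 / r * ln (real (orbit_count x\<^sub>0 H (t + r)) / real (orbit_count x\<^sub>0 H t))"

definition lower_growth :: "'a::metric_space \<Rightarrow> ('a \<Rightarrow> 'a) set \<Rightarrow> ereal" where
  "lower_growth x\<^sub>0 H = Lim at_top (\<lambda>r. INF t\<in>{0<..}. ereal (growth_rate x\<^sub>0 H r t))"

definition upper_growth :: "'a::metric_space \<Rightarrow> ('a \<Rightarrow> 'a) set \<Rightarrow> ereal" where
  "upper_growth x\<^sub>0 H = Lim at_top (\<lambda>r. SUP t\<in>{0<..}. ereal (growth_rate x\<^sub>0 H r t))"

definition tempered_growth :: "'a::metric_space \<Rightarrow> real \<Rightarrow> ('a \<Rightarrow> 'a) set \<Rightarrow> bool" where
  "tempered_growth x\<^sub>0 \<delta> H \<longleftrightarrow> 0 < lower_growth x\<^sub>0 H \<and> lower_growth x\<^sub>0 H \<le> upper_growth x\<^sub>0 H \<and>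
     upper_growth x\<^sub>0 H < ereal \<delta>"

definition tempered_parabolic_subgroups ::
  "'a::metric_space \<Rightarrow> real \<Rightarrow> ('a \<Rightarrow> 'a) set \<Rightarrow> bool" where
  "tempered_parabolic_subgroups x\<^sub>0 \<delta> \<Gamma> \<longleftrightarrow>
     (\<forall>H. maximal_parabolic_subgroup x\<^sub>0 \<Gamma> H \<longrightarrow> tempered_growth x\<^sub>0 \<delta> H)"


section \<open>Horoball decomposition and horoball shadow lemma\<close>

definition hausdorff_distance :: "'a::metric_space set \<Rightarrow> 'a set \<Rightarrow> ennreal" where
  "hausdorff_distance A B = max (SUP x\<in>A. INF y\<in>B. ennreal (dist x y))
                                (SUP y\<in>B. INF x\<in>A. ennreal (dist x y))"

text \<open>The family is given by its radii: the horoball at a parabolic point \<open>p\<close> is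
  \<^term>\<open>horoball x\<^sub>0 p (r p)\<close>.\<close>

definition horoball_decomposition ::
  "'a::metric_space \<Rightarrow> ('a \<Rightarrow> 'a) set \<Rightarrow> ((nat \<Rightarrow> 'a) set \<Rightarrow> real) \<Rightarrow> bool" where
  "horoball_decomposition x\<^sub>0 \<Gamma> r \<longleftrightarrow>
     (\<forall>p\<in>parabolic_points x\<^sub>0 \<Gamma>. r p > 0) \<and>
     (\<forall>p\<in>parabolic_points x\<^sub>0 \<Gamma>. \<forall>q\<in>parabolic_points x\<^sub>0 \<Gamma>. p \<noteq> q \<longrightarrow>
        horoball x\<^sub>0 p (r p) \<inter> horoball x\<^sub>0 q (r q) = {}) \<and>
     (\<exists>D::real. \<forall>g\<in>\<Gamma>. \<forall>p\<in>parabolic_points x\<^sub>0 \<Gamma>.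
        hausdorff_distance (horoball x\<^sub>0 (boundary_action g p) (r (boundary_action g p)))
          (g ` horoball x\<^sub>0 p (r p)) \<le> ennreal D) \<and>
     (let Q = quotient_topology (top_of_set (limit_hull x\<^sub>0 \<Gamma>)) (\<lambda>x. (\<lambda>g. g x) ` \<Gamma>)
      in compactin Q (Q closure_of ((\<lambda>x. (\<lambda>g. g x) ` \<Gamma>) `
           (limit_hull x\<^sub>0 \<Gamma> - (\<Union>p\<in>parabolic_points x\<^sub>0 \<Gamma>. horoball x\<^sub>0 p (r p))))))"

text \<open>A measure on the limit set is a Borel measure on \<open>\<partial>X\<close> giving no mass to the complement of
  the limit set.\<close>

definition measure_on_limit_set ::
  "'a::metric_space \<Rightarrow> ('a \<Rightarrow> 'a) set \<Rightarrow> (nat \<Rightarrow> 'a) set measure \<Rightarrow> bool" where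
  "measure_on_limit_set x\<^sub>0 \<Gamma> \<mu> \<longleftrightarrow>
     sets \<mu> = sets (sigma (gromov_boundary x\<^sub>0) {U. openin (boundary_topology x\<^sub>0) U}) \<and>
     gromov_boundary x\<^sub>0 - limit_set x\<^sub>0 \<Gamma> \<in> null_sets \<mu>"

definition horoball_shadow_lemma ::
  "'a::metric_space \<Rightarrow> ('a \<Rightarrow> 'a) set \<Rightarrow> nat \<Rightarrow> (nat \<Rightarrow> (nat \<Rightarrow> 'a) set) \<Rightarrow>
   ((nat \<Rightarrow> 'a) set \<Rightarrow> real) \<Rightarrow> (nat \<Rightarrow> 'a) set measure \<Rightarrow> real \<Rightarrow> bool" where
  "horoball_shadow_lemma x\<^sub>0 \<Gamma> a p r \<mu> \<delta> \<longleftrightarrow> (\<forall>c\<^sub>1 c\<^sub>2. 0 < c\<^sub>1 \<and> c\<^sub>1 < c\<^sub>2 \<longrightarrow> (\<exists>k\<ge>1.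
     \<forall>\<theta>. 0 < \<theta> \<and> \<theta> \<le> 1 \<longrightarrow> (\<forall>c\<in>{c\<^sub>1..c\<^sub>2}. \<forall>i\<in>{1..a}. \<forall>q\<in>boundary_orbit \<Gamma> (p i).
       (let B = real (orbit_count x\<^sub>0 (stabilizer \<Gamma> (p i)) (- 2 * ln \<theta>))
        in ennreal (inverse k * B * \<theta> powr (2 * \<delta>) * r q powr \<delta>)
             \<le> emeasure \<mu> (horoball_shadow x\<^sub>0 q (c * \<theta> * r q)) \<and>
           emeasure \<mu> (horoball_shadow x\<^sub>0 q (c * \<theta> * r q))
             \<le> ennreal (k * B * \<theta> powr (2 * \<delta>) * r q powr \<delta>)))))"

definition parabolic_points_level ::
  "'a::metric_space \<Rightarrow> ('a \<Rightarrow> 'a) set \<Rightarrow> ((nat \<Rightarrow> 'a) set \<Rightarrow> real) \<Rightarrow> real \<Rightarrow> nat \<Rightarrow> (nat \<Rightarrow> 'a) set set"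
  where "parabolic_points_level x\<^sub>0 \<Gamma> r lam n =
     {p \<in> parabolic_points x\<^sub>0 \<Gamma>. lam ^ (n + 1) \<le> r p \<and> r p \<le> lam ^ n}"

end

theory Submission
  imports Defs
begin

text \<open>
  Upper bound: if the radii of two horoballs lie in \<open>[s, A s]\<close> and a ray from the basepoint enters both
  horoballs shrunk by a small factor \<open>c(A)\<close>, then a point of that ray lies in both original horoballs,
  which are disjoint. So the shadows of the shrunk horoballs are disjoint; each has mass comparable to
  \<open>s\<^sup>\<delta>\<close>, and the total mass is finite, because a large enough horoball contains the basepoint.

  Lower bound: a ray towards a limit point stays close to the hull of the limit set, hence, by
  cocompactness outside the horoballs and since there is at least one parabolic point, uniformly close
  to the union of the horoballs. Reading this off at time \<open>- ln s\<close> gives a Dirichlet theorem: the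
  shadows of radius \<open>\<kappa> (s r\<^sub>p)\<^sup>1\<^sup>/\<^sup>2\<close> with \<open>r\<^sub>p \<ge> s\<close> cover the limit set. By the shadow lemma and tempered
  growth such a shadow has mass at most a constant times \<open>(r\<^sub>p / s)\<^sup>c s\<^sup>\<delta>\<close> with \<open>c < \<delta>\<close>, so by the upper bound the
  horoballs with \<open>r\<^sub>p \<ge> A s\<close> carry less than half of the mass once \<open>A\<close> is large, and at least of order
  \<open>s\<^sup>-\<^sup>\<delta>\<close> horoballs have radius in \<open>[s, A s]\<close>.

  Without parabolic points the action on the hull of the limit set would be cocompact, which is
  incompatible with a parabolic element: along a ray to a limit point that it fixes, all its powers
  eventually have displacement bounded by one constant.
\<close>

section \<open>Gromov products and the boundary\<close>

text \<open>Up to constants, x lies in the horoball of radius \<rho> at \<xi> iff the Gromov product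
  (x|\<xi>) is at least (d(x,o) - ln \<rho>)/2, so horoballs are handled through products based at
  o. This explains the square root in the covering: a ray inside the horoball of radius r_p at time
  t = - ln s follows a ray to p until about (t - ln r_p)/2, which puts its endpoint in the shadow of
  radius about sqrt(s r_p). In the shadow lemma this is \<theta> = sqrt(s/r_p): the growth function
  is evaluated at ln(r_p/s), and \<theta>^(2\<delta>) r_p^\<delta> = s^\<delta>. At most about (2^j
  s)^(-\<delta>) horoballs have radius near 2^j s, each covering mass at most about 2^(jc)
  s^\<delta>, and c < \<delta> makes the sum over j geometric. A parabolic element does not by
  itself exhibit a parabolic point: the full stabilizer of its fixed point is not known to be
  parabolic. What is available is a limit point fixed by all its powers, because they commute, and
  at this point a coarse Busemann function is a quasimorphism that stays within its defect on
  non-loxodromic elements. That is the source of the common displacement bound.\<close>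

locale gromov_hyperbolic_space =
  fixes x\<^sub>0 :: "'a::heine_borel" and D :: real
  assumes D_nonneg: "0 \<le> D"
    and hyperbolic: "\<And>w x y z :: 'a. min (gromov_product w x y) (gromov_product w y z) - D \<le> gromov_product w x z"
    and geodesic: "geodesic_space (UNIV :: 'a set)"
begin

abbreviation gp :: "'a \<Rightarrow> 'a \<Rightarrow> real" where "gp \<equiv> gromov_product x\<^sub>0"
abbreviation ep where "ep \<equiv> extended_product x\<^sub>0"
abbreviation nrm :: "'a \<Rightarrow> real" where "nrm x \<equiv> dist x x\<^sub>0"

text \<open>The loss in each estimate for the extended product: two changes of representing sequences, one
  use of hyperbolicity, and \<open>1\<close> because the suprema need not be attained.\<close>
definition K :: real where "K = 3 * D + 1"

lemma K_ge: "1 \<le> K" "D \<le> K" "0 \<le> K"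
  using D_nonneg by (auto simp: K_def)

lemma gp_commute: "gp x y = gp y x"
  by (simp add: gromov_product_def dist_commute)

lemma gp_nonneg: "0 \<le> gp x y"
  using dist_triangle[of x y x\<^sub>0] by (simp add: gromov_product_def dist_commute)

lemma gp_le_left: "gp x y \<le> nrm x"
  using dist_triangle[of y x\<^sub>0 x] by (simp add: gromov_product_def dist_commute)

lemma gp_lipschitz: "gp x y - dist x x' \<le> gp x' y"
  using dist_triangle[of x x\<^sub>0 x'] dist_triangle[of x' y x]
  by (simp add: gromov_product_def dist_commute field_simps)

lemma gromov_product_base_change: "gromov_product w x y - dist w w' \<le> gromov_product w' x y"
  using dist_triangle[of x w w'] dist_triangle[of y w w']
  by (simp add: gromov_product_def dist_commute field_simps)

lemma dist_gp: "dist x y = nrm x + nrm y - 2 * gp x y"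
  by (simp add: gromov_product_def field_simps)

lemma hyperbolic_ge:
  assumes "R \<le> gp x y" "R \<le> gp y z"
  shows "R - D \<le> gp x z"
  using hyperbolic[of x\<^sub>0 x y z] assms by linarith

text \<open>Tails in two independent indices: the common core of the product filter in
  \<open>gromov_sequences\<close> and of the \<open>Liminf\<close> in
  \<open>extended_product\<close>, which turns statements about either into estimates between
  points.\<close>

definition joint_ge :: "real \<Rightarrow> (nat \<Rightarrow> 'a) \<Rightarrow> (nat \<Rightarrow> 'a) \<Rightarrow> bool" where
  "joint_ge R u v \<longleftrightarrow> (\<exists>N. \<forall>m\<ge>N. \<forall>n\<ge>N. R \<le> gp (u m) (v n))"

lemma joint_ge_eventually:
  "joint_ge R u v \<longleftrightarrow> eventually (\<lambda>(m, n). R \<le> gp (u m) (v n)) (sequentially \<times>\<^sub>F sequentially)"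
  unfolding joint_ge_def eventually_prod_sequentially by auto

lemma joint_ge_commute: "joint_ge R u v \<longleftrightarrow> joint_ge R v u"
  unfolding joint_ge_def by (auto simp: gp_commute)

lemma joint_ge_mono: "joint_ge R u v \<Longrightarrow> S \<le> R \<Longrightarrow> joint_ge S u v"
  unfolding joint_ge_def by (meson order_trans)

lemma joint_ge_trans:
  assumes "joint_ge R u v" "joint_ge R v w"
  shows "joint_ge (R - D) u w"
proof -
  obtain N where N: "R \<le> gp (u m) (v n)" if "m \<ge> N" "n \<ge> N" for m n
    using assms(1) unfolding joint_ge_def by blast
  obtain M where M: "R \<le> gp (v m) (w n)" if "m \<ge> M" "n \<ge> M" for m n
    using assms(2) unfolding joint_ge_def by blast
  have "R - D \<le> gp (u m) (w n)" if "m \<ge> max N M" "n \<ge> max N M" for m n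
    using hyperbolic_ge[OF N M, of m "max N M" n] that by auto
  then show ?thesis unfolding joint_ge_def by blast
qed

lemma joint_ge_const [simp]: "joint_ge R (\<lambda>_. x) (\<lambda>_. y) \<longleftrightarrow> R \<le> gp x y"
  unfolding joint_ge_def by auto

lemma gromov_sequences_iff: "u \<in> gromov_sequences x\<^sub>0 \<longleftrightarrow> (\<forall>R. joint_ge R u u)"
proof -
  show ?thesis
    unfolding gromov_sequences_def joint_ge_eventually filterlim_at_top mem_Collect_eq
    by (simp add: case_prod_beta')
qed

definition asymptotic :: "((nat \<Rightarrow> 'a) \<times> (nat \<Rightarrow> 'a)) set" where
  "asymptotic = {(u, v). u \<in> gromov_sequences x\<^sub>0 \<and> v \<in> gromov_sequences x\<^sub>0 \<and>
     filterlim (\<lambda>n. gp (u n) (v n)) at_top sequentially}"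

text \<open>Equivalence is defined along the diagonal, but the estimates need independent indices.
  Since u is a Gromov sequence, hyperbolicity through \<open>u n\<close> carries the diagonal bound
  to all pairs \<open>u m\<close>, \<open>v n\<close>.\<close>

lemma asymptotic_iff:
  "(u, v) \<in> asymptotic \<longleftrightarrow>
     u \<in> gromov_sequences x\<^sub>0 \<and> v \<in> gromov_sequences x\<^sub>0 \<and> (\<forall>R. joint_ge R u v)"
proof -
  have "joint_ge R u v"
    if u: "u \<in> gromov_sequences x\<^sub>0" and l: "filterlim (\<lambda>n. gp (u n) (v n)) at_top sequentially"
    for R
  proof -
    have "joint_ge (R + D) u u" using u by (simp add: gromov_sequences_iff)
    then obtain N where N: "R + D \<le> gp (u m) (u n)" if "m \<ge> N" "n \<ge> N" for m n
      unfolding joint_ge_def by blast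
    from l obtain M where M: "R + D \<le> gp (u n) (v n)" if "n \<ge> M" for n
      unfolding filterlim_at_top eventually_sequentially by meson
    have "R \<le> gp (u m) (v n)" if "m \<ge> max N M" "n \<ge> max N M" for m n
      using hyperbolic_ge[OF N M, of m n] that by auto
    then show ?thesis unfolding joint_ge_def by blast
  qed
  moreover have "filterlim (\<lambda>n. gp (u n) (v n)) at_top sequentially" if "\<forall>R. joint_ge R u v"
    using that unfolding filterlim_at_top eventually_sequentially joint_ge_def by meson
  ultimately show ?thesis unfolding asymptotic_def by auto
qed

lemma equiv_asymptotic: "equiv (gromov_sequences x\<^sub>0) asymptotic"
proof (rule equivI)
  show "asymptotic \<subseteq> gromov_sequences x\<^sub>0 \<times> gromov_sequences x\<^sub>0"
    by (auto simp: asymptotic_def)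
  show "refl_on (gromov_sequences x\<^sub>0) asymptotic"
    by (auto simp: refl_on_def asymptotic_iff gromov_sequences_iff)
  show "sym asymptotic"
    by (auto simp: sym_def asymptotic_iff joint_ge_commute)
  show "trans asymptotic"
  proof (rule transI)
    fix u v w assume "(u, v) \<in> asymptotic" "(v, w) \<in> asymptotic"
    moreover from this have "joint_ge R u w" for R
      using joint_ge_trans[of "R + D" u v w] by (auto simp: asymptotic_iff)
    ultimately show "(u, w) \<in> asymptotic" by (auto simp: asymptotic_iff)
  qed
qed

section \<open>Boundary points as equivalence classes of Gromov sequences\<close>

lemma gromov_boundary_eq: "gromov_boundary x\<^sub>0 = gromov_sequences x\<^sub>0 // asymptotic"
  by (simp add: gromov_boundary_def asymptotic_def)

lemma boundary_nonempty: "\<xi> \<in> gromov_boundary x\<^sub>0 \<Longrightarrow> \<exists>u. u \<in> \<xi>"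
  using in_quotient_imp_non_empty[OF equiv_asymptotic] by (auto simp: gromov_boundary_eq)

lemma boundary_mem_sequence: "\<xi> \<in> gromov_boundary x\<^sub>0 \<Longrightarrow> u \<in> \<xi> \<Longrightarrow> u \<in> gromov_sequences x\<^sub>0"
  using in_quotient_imp_subset[OF equiv_asymptotic] by (auto simp: gromov_boundary_eq)

lemma boundary_joint_ge: "\<xi> \<in> gromov_boundary x\<^sub>0 \<Longrightarrow> u \<in> \<xi> \<Longrightarrow> v \<in> \<xi> \<Longrightarrow> joint_ge R u v"
  using in_quotient_imp_in_rel[OF equiv_asymptotic, of \<xi> u v]
  by (auto simp: gromov_boundary_eq asymptotic_iff)

lemma boundary_mem_iff:
  "\<xi> \<in> gromov_boundary x\<^sub>0 \<Longrightarrow> u \<in> \<xi> \<Longrightarrow> v \<in> \<xi> \<longleftrightarrow> (u, v) \<in> asymptotic"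
  using in_quotient_imp_closed[OF equiv_asymptotic, of \<xi> u v]
    in_quotient_imp_in_rel[OF equiv_asymptotic, of \<xi> u v]
  by (auto simp: gromov_boundary_eq)

lemma boundary_class:
  "u \<in> gromov_sequences x\<^sub>0 \<Longrightarrow> \<exists>\<xi>\<in>gromov_boundary x\<^sub>0. u \<in> \<xi>"
  using quotientI[of u _ asymptotic] equiv_class_self[OF equiv_asymptotic]
  unfolding gromov_boundary_eq by blast

lemma boundary_eqI:
  assumes "\<xi> \<in> gromov_boundary x\<^sub>0" "\<eta> \<in> gromov_boundary x\<^sub>0" "u \<in> \<xi>" "u \<in> \<eta>"
  shows "\<xi> = \<eta>"
  using assms quotient_disj[OF equiv_asymptotic, of \<xi> \<eta>] by (auto simp: gromov_boundary_eq)

lemma boundary_eq_if_joint_ge: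
  assumes "\<xi> \<in> gromov_boundary x\<^sub>0" "\<eta> \<in> gromov_boundary x\<^sub>0" "u \<in> \<xi>" "v \<in> \<eta>"
    and "\<And>R. joint_ge R u v"
  shows "\<xi> = \<eta>"
  using assms boundary_mem_iff[of \<xi> u v] boundary_mem_sequence[of \<xi> u] boundary_mem_sequence[of \<eta> v]
  by (intro boundary_eqI[of _ _ v]) (auto simp: asymptotic_iff)

section \<open>The extended Gromov product\<close>

lemma Inl_in_bordification [simp]: "Inl x \<in> bordification x\<^sub>0"
  by (simp add: bordification_def)

lemma Inr_in_bordification [simp]: "Inr \<xi> \<in> bordification x\<^sub>0 \<longleftrightarrow> \<xi> \<in> gromov_boundary x\<^sub>0"
  by (auto simp: bordification_def)

lemma representatives_simps [simp]:
  "representatives (Inl x) = {\<lambda>_. x}" "representatives (Inr \<xi>) = \<xi>"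
  by (simp_all add: representatives_def)

lemma representatives_nonempty: "q \<in> bordification x\<^sub>0 \<Longrightarrow> \<exists>u. u \<in> representatives q"
  by (cases q) (auto simp: boundary_nonempty)

lemma ep_geI:
  assumes "u \<in> representatives q" "v \<in> representatives s" "joint_ge R u v"
  shows "ereal R \<le> ep q s"
proof -
  have "ereal R \<le> Liminf (sequentially \<times>\<^sub>F sequentially) (\<lambda>(m, n). ereal (gp (u m) (v n)))"
    using assms(3) unfolding joint_ge_eventually
    by (intro Liminf_bounded) (auto elim!: eventually_mono)
  also have "\<dots> \<le> ep q s"
    unfolding extended_product_def
    by (rule SUP_upper2[OF assms(1)], rule SUP_upper[OF assms(2)])
  finally show ?thesis .
qed

lemma joint_ge_representatives:
  assumes "q \<in> bordification x\<^sub>0" "u \<in> representatives q" "u' \<in> representatives q"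
    and "joint_ge R u' w"
  shows "joint_ge (R - D) u w"
proof (cases q)
  case (Inl x)
  then show ?thesis using assms D_nonneg by (auto intro: joint_ge_mono)
next
  case (Inr \<xi>)
  then show ?thesis
    using assms boundary_joint_ge[of \<xi> u u' R] by (intro joint_ge_trans[of R u u' w]) auto
qed

text \<open>Coarse converse of \<open>ep_geI\<close> for prescribed sequences: 1 pays for the
  supremum not being attained, and D for replacing each of the two sequences.\<close>

lemma ep_geD:
  assumes "ereal R \<le> ep q s" "q \<in> bordification x\<^sub>0" "s \<in> bordification x\<^sub>0"
    and u: "u \<in> representatives q" and v: "v \<in> representatives s"
  shows "joint_ge (R - 1 - 2 * D) u v"
proof -
  have "ereal (R - 1) < ep q s" using assms(1) by (rule less_le_trans[rotated]) simp
  then obtain u' v' where u': "u' \<in> representatives q" "v' \<in> representatives s"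
    and "ereal (R - 1) < Liminf (sequentially \<times>\<^sub>F sequentially) (\<lambda>(m, n). ereal (gp (u' m) (v' n)))"
    unfolding extended_product_def less_SUP_iff by blast
  from less_LiminfD[OF this(3)] have "joint_ge (R - 1) u' v'"
    unfolding joint_ge_eventually by (auto elim!: eventually_mono)
  then have "joint_ge (R - 1 - D) u v'"
    using joint_ge_representatives assms u' u by blast
  then have "joint_ge (R - 1 - D) v' u" using joint_ge_commute by blast
  then have "joint_ge (R - 1 - D - D) v u"
    using joint_ge_representatives[OF assms(3) v u'(2)] by blast
  moreover have "R - 1 - D - D = R - 1 - 2 * D" by simp
  ultimately show ?thesis using joint_ge_commute by metis
qed

lemma ep_trans:
  assumes "ereal R \<le> ep q s" "ereal R \<le> ep s t"
    and b: "q \<in> bordification x\<^sub>0" "s \<in> bordification x\<^sub>0" "t \<in> bordification x\<^sub>0"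
  shows "ereal (R - K) \<le> ep q t"
proof -
  obtain u v w where r: "u \<in> representatives q" "v \<in> representatives s" "w \<in> representatives t"
    using representatives_nonempty b by meson
  have "joint_ge (R - 1 - 2 * D - D) u w"
    using ep_geD[OF assms(1) b(1,2) r(1,2)] ep_geD[OF assms(2) b(2,3) r(2,3)] by (rule joint_ge_trans)
  then show ?thesis
    using r by (intro ep_geI) (auto simp: K_def algebra_simps)
qed

lemma ep_mono: "ereal R \<le> ep q s \<Longrightarrow> S \<le> R \<Longrightarrow> ereal S \<le> ep q s"
  by (meson ereal_less_eq(3) order_trans)

text \<open>Chained estimates rarely carry equal bounds; weakening both to S + K first leaves only
  linear side conditions.\<close>

lemma ep_trans':
  assumes "ereal R\<^sub>1 \<le> ep q s" "ereal R\<^sub>2 \<le> ep s t" "S + K \<le> R\<^sub>1" "S + K \<le> R\<^sub>2"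
    and "q \<in> bordification x\<^sub>0" "s \<in> bordification x\<^sub>0" "t \<in> bordification x\<^sub>0"
  shows "ereal S \<le> ep q t"
  using ep_trans[of "S + K" q s t] ep_mono[OF assms(1,3)] ep_mono[OF assms(2,4)] assms(5-7) by simp

text \<open>Exact symmetry would require exchanging the suprema and the product filter. Going
  through \<open>joint_ge\<close>, which is symmetric, costs at most K.\<close>

lemma ep_commute:
  assumes "ereal R \<le> ep q s"
    and b: "q \<in> bordification x\<^sub>0" "s \<in> bordification x\<^sub>0"
  shows "ereal (R - K) \<le> ep s q"
proof -
  obtain u v where r: "u \<in> representatives q" "v \<in> representatives s"
    using representatives_nonempty b by meson
  have "joint_ge (R - K) v u"
    using ep_geD[OF assms r] D_nonneg unfolding joint_ge_commute[of _ v u]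
    by (rule_tac joint_ge_mono) (auto simp: K_def)
  then show ?thesis using r by (intro ep_geI)
qed

lemma ep_points: "R \<le> gp x y \<Longrightarrow> ereal R \<le> ep (Inl x) (Inl y)"
  by (rule ep_geI) auto

lemma ep_points_D: "ereal R \<le> ep (Inl x) (Inl y) \<Longrightarrow> R - K \<le> gp x y"
  using ep_geD[of R "Inl x" "Inl y" "\<lambda>_. x" "\<lambda>_. y"] D_nonneg by (auto simp: K_def)

lemma ep_self: "\<xi> \<in> gromov_boundary x\<^sub>0 \<Longrightarrow> ereal R \<le> ep (Inr \<xi>) (Inr \<xi>)"
  using boundary_nonempty[of \<xi>] boundary_joint_ge[of \<xi>] by (auto intro!: ep_geI)

lemma ep_nonneg: "q \<in> bordification x\<^sub>0 \<Longrightarrow> ereal 0 \<le> ep (Inl x) q"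
  using representatives_nonempty[of q]
  by (auto intro!: ep_geI[of "\<lambda>_. x" _ _ _ 0] simp: joint_ge_def gp_nonneg)

lemma ep_le_nrm: "ereal R \<le> ep (Inl x) q \<Longrightarrow> q \<in> bordification x\<^sub>0 \<Longrightarrow> R - K \<le> nrm x"
proof -
  assume a: "ereal R \<le> ep (Inl x) q" "q \<in> bordification x\<^sub>0"
  obtain u where u: "u \<in> representatives q" using representatives_nonempty[OF a(2)] by blast
  have "joint_ge (R - 1 - 2 * D) (\<lambda>_. x) u" using a u by (intro ep_geD[of _ "Inl x" q]) auto
  then obtain n where "R - 1 - 2 * D \<le> gp x (u n)" unfolding joint_ge_def by blast
  then show ?thesis using gp_le_left[of x "u n"] D_nonneg by (auto simp: K_def)
qed

lemma ep_lipschitz: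
  assumes "ereal R \<le> ep (Inl y) q" "q \<in> bordification x\<^sub>0"
  shows "ereal (R - dist x y - K) \<le> ep (Inl x) q"
proof -
  obtain u where u: "u \<in> representatives q" using representatives_nonempty[OF assms(2)] by blast
  have "joint_ge (R - 1 - 2 * D) (\<lambda>_. y) u" using assms u by (intro ep_geD[of _ "Inl y" q]) auto
  then have "joint_ge (R - dist x y - K) (\<lambda>_. x) u"
    unfolding joint_ge_def using gp_lipschitz[of y _ x] D_nonneg
    by (smt (verit, best) K_def dist_commute)
  then show ?thesis using u by (intro ep_geI) auto
qed

lemma boundary_eq_if_ep:
  assumes "\<xi> \<in> gromov_boundary x\<^sub>0" "\<eta> \<in> gromov_boundary x\<^sub>0"
    and "\<And>R. ereal R \<le> ep (Inr \<xi>) (Inr \<eta>)"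
  shows "\<xi> = \<eta>"
proof -
  obtain u v where uv: "u \<in> \<xi>" "v \<in> \<eta>" using assms boundary_nonempty by blast
  have "joint_ge R u v" for R
    using ep_geD[of "R + 1 + 2 * D" "Inr \<xi>" "Inr \<eta>" u v] assms uv by simp
  then show ?thesis using boundary_eq_if_joint_ge assms uv by blast
qed

lemma ep_sequence:
  assumes "\<xi> \<in> gromov_boundary x\<^sub>0" "u \<in> \<xi>"
  shows "\<exists>N. \<forall>n\<ge>N. ereal R \<le> ep (Inl (u n)) (Inr \<xi>)"
proof -
  obtain N where N: "R \<le> gp (u m) (u n)" if "m \<ge> N" "n \<ge> N" for m n
    using boundary_joint_ge[OF assms assms(2), of R] unfolding joint_ge_def by blast
  have "ereal R \<le> ep (Inl (u n)) (Inr \<xi>)" if "n \<ge> N" for n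
    using assms(2) N that by (intro ep_geI[of "\<lambda>_. u n" _ u]) (auto simp: joint_ge_def)
  then show ?thesis by blast
qed

text \<open>Converse of \<open>ep_sequence\<close>: a sequence converging to \<xi> in the extended
  product represents \<xi>. This is how an image g \<circ> u is recognised as a representative of
  the same point, hence how fixed points are found.\<close>

lemma boundary_mem_if_ep:
  assumes "\<xi> \<in> gromov_boundary x\<^sub>0"
    and "\<And>R. \<exists>N. \<forall>n\<ge>N. ereal R \<le> ep (Inl (u n)) (Inr \<xi>)"
  shows "u \<in> \<xi>"
proof -
  obtain v where v: "v \<in> \<xi>" using assms(1) boundary_nonempty by blast
  have vu: "joint_ge R v u" and uu: "joint_ge R u u" for R
  proof -
    obtain N where N: "\<And>n. n \<ge> N \<Longrightarrow> ereal (R + 4 * K) \<le> ep (Inl (u n)) (Inr \<xi>)"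
      using assms(2) by blast
    obtain M where M: "\<And>n. n \<ge> M \<Longrightarrow> ereal (R + 4 * K) \<le> ep (Inl (v n)) (Inr \<xi>)"
      using ep_sequence[OF assms(1) v] by blast
    have *: "R \<le> gp x y" if "ereal (R + 4 * K) \<le> ep (Inl x) (Inr \<xi>)" "ereal (R + 4 * K) \<le> ep (Inl y) (Inr \<xi>)"
      for x y
    proof -
      have "ereal (R + 3 * K) \<le> ep (Inr \<xi>) (Inl y)"
        using ep_commute[OF that(2)] assms(1) by (simp add: algebra_simps)
      then have "ereal (R + 3 * K - K) \<le> ep (Inl x) (Inl y)"
        using that(1) assms(1) K_ge by (rule_tac ep_trans'[of _ _ "Inr \<xi>"]) auto
      from ep_points_D[OF this] show ?thesis using K_ge by simp
    qed
    have "R \<le> gp (v m) (u n)" if "max N M \<le> m" "max N M \<le> n" for m n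
      using *[OF M N] that by simp
    then show "joint_ge R v u" unfolding joint_ge_def by blast
    have "R \<le> gp (u m) (u n)" if "N \<le> m" "N \<le> n" for m n
      using *[OF N N] that by simp
    then show "joint_ge R u u" unfolding joint_ge_def by blast
  qed
  have "u \<in> gromov_sequences x\<^sub>0" using uu by (simp add: gromov_sequences_iff)
  then have "(v, u) \<in> asymptotic" using vu v boundary_mem_sequence[OF assms(1) v]
    by (auto simp: asymptotic_iff)
  then show ?thesis using boundary_mem_iff[OF assms(1) v] by blast
qed

section \<open>The topology of the bordification and the Busemann function\<close>

text \<open>The topology says that an open set around \<xi> contains some set (q|\<xi>) >= R, not
  that such a set is a neighbourhood of \<xi>. So U is an interior of S built by hand, and the
  approximate triangle inequality \<open>ep_trans\<close> shows that U is open.\<close>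

lemma boundary_nhd:
  assumes \<xi>: "\<xi> \<in> gromov_boundary x\<^sub>0"
  shows "\<exists>U. openin (bordification_topology x\<^sub>0) U \<and> Inr \<xi> \<in> U \<and> (\<forall>q\<in>U. ereal R \<le> ep q (Inr \<xi>))"
proof -
  define S where "S = {q \<in> bordification x\<^sub>0. ereal R \<le> ep q (Inr \<xi>)}"
  define good where "good = (\<lambda>\<eta>. \<exists>R'. \<forall>q\<in>bordification x\<^sub>0. ereal R' \<le> ep q (Inr \<eta>) \<longrightarrow> q \<in> S)"
  define U where "U = Inl ` interior (Inl -` S) \<union> Inr ` {\<eta> \<in> gromov_boundary x\<^sub>0. good \<eta>}"
  have vim: "Inl -` U = interior (Inl -` S)" unfolding U_def by auto
  have "\<exists>R''. \<forall>q\<in>bordification x\<^sub>0. ereal R'' \<le> ep q (Inr \<eta>) \<longrightarrow> q \<in> U"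
    if "Inr \<eta> \<in> U" for \<eta>
  proof -
    have \<eta>: "\<eta> \<in> gromov_boundary x\<^sub>0" "good \<eta>" using that unfolding U_def by auto
    then obtain R' where R': "q \<in> S" if "q \<in> bordification x\<^sub>0" "ereal R' \<le> ep q (Inr \<eta>)" for q
      unfolding good_def by blast
    \<comment> \<open>The 1 leaves room for a unit ball around a point of X; the K pays for one
      Lipschitz or transitivity step.\<close>
    have "q \<in> U" if q: "q \<in> bordification x\<^sub>0" "ereal (R' + 1 + K) \<le> ep q (Inr \<eta>)" for q
    proof (cases q)
      case (Inl x)
      have "ball x 1 \<subseteq> Inl -` S"
      proof
        fix y assume "y \<in> ball x 1"
        then have "dist y x \<le> 1" by (simp add: dist_commute)
        moreover have "ereal (R' + 1 + K - dist y x - K) \<le> ep (Inl y) (Inr \<eta>)"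
          using q Inl \<eta> by (intro ep_lipschitz) auto
        ultimately have "ereal R' \<le> ep (Inl y) (Inr \<eta>)" by (elim ep_mono) auto
        then show "y \<in> Inl -` S" using R' by auto
      qed
      then have "x \<in> interior (Inl -` S)" by (auto simp: mem_interior intro: exI[of _ 1])
      then show ?thesis using Inl by (auto simp: U_def)
    next
      case (Inr \<zeta>)
      have \<zeta>: "\<zeta> \<in> gromov_boundary x\<^sub>0" using q Inr by simp
      have "s \<in> S" if s: "s \<in> bordification x\<^sub>0" "ereal (R' + 1 + K) \<le> ep s (Inr \<zeta>)" for s
      proof -
        have "ereal (R' + 1 + K - K) \<le> ep s (Inr \<eta>)"
          using s q \<eta> Inr by (intro ep_trans[of _ s "Inr \<zeta>"]) auto
        then have "ereal R' \<le> ep s (Inr \<eta>)" by (elim ep_mono) auto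
        then show ?thesis using R' s by auto
      qed
      then have "good \<zeta>" unfolding good_def by blast
      then show ?thesis using Inr \<zeta> by (auto simp: U_def)
    qed
    then show ?thesis by blast
  qed
  moreover have "U \<subseteq> bordification x\<^sub>0" by (auto simp: U_def)
  ultimately have "openin (bordification_topology x\<^sub>0) U"
    unfolding openin_bordification_topology vim by auto
  moreover have "good \<xi>" unfolding good_def S_def by blast
  then have "Inr \<xi> \<in> U" using \<xi> by (simp add: U_def)
  moreover have "U \<subseteq> S"
  proof
    fix q assume "q \<in> U"
    then show "q \<in> S" unfolding U_def good_def
      using interior_subset ep_self by fastforce
  qed
  ultimately show ?thesis unfolding S_def by blast
qed

lemma openin_boundaryD:
  assumes "openin (bordification_topology x\<^sub>0) U" "Inr \<xi> \<in> U"
  shows "\<exists>R. \<forall>q\<in>bordification x\<^sub>0. ereal R \<le> ep q (Inr \<xi>) \<longrightarrow> q \<in> U"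
  using assms unfolding openin_bordification_topology by blast

lemma converges_to_boundary_iff:
  "converges_to_boundary x\<^sub>0 f \<xi> F \<longleftrightarrow>
     \<xi> \<in> gromov_boundary x\<^sub>0 \<and> (\<forall>R. eventually (\<lambda>t. ereal R \<le> ep (Inl (f t)) (Inr \<xi>)) F)"
proof
  assume c: "converges_to_boundary x\<^sub>0 f \<xi> F"
  then have \<xi>: "\<xi> \<in> gromov_boundary x\<^sub>0"
    unfolding converges_to_boundary_def limitin_def by simp
  have "eventually (\<lambda>t. ereal R \<le> ep (Inl (f t)) (Inr \<xi>)) F" for R
  proof -
    obtain U where U: "openin (bordification_topology x\<^sub>0) U" "Inr \<xi> \<in> U"
      and "\<forall>q\<in>U. ereal R \<le> ep q (Inr \<xi>)"
      using boundary_nhd[OF \<xi>] by blast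
    moreover have "eventually (\<lambda>t. Inl (f t) \<in> U) F"
      using c U unfolding converges_to_boundary_def limitin_def by blast
    ultimately show ?thesis by (auto elim: eventually_mono)
  qed
  with \<xi> show "\<xi> \<in> gromov_boundary x\<^sub>0 \<and> (\<forall>R. eventually (\<lambda>t. ereal R \<le> ep (Inl (f t)) (Inr \<xi>)) F)"
    by blast
next
  assume r: "\<xi> \<in> gromov_boundary x\<^sub>0 \<and> (\<forall>R. eventually (\<lambda>t. ereal R \<le> ep (Inl (f t)) (Inr \<xi>)) F)"
  show "converges_to_boundary x\<^sub>0 f \<xi> F"
    unfolding converges_to_boundary_def limitin_def
  proof (intro conjI allI impI)
    show "Inr \<xi> \<in> topspace (bordification_topology x\<^sub>0)" using r by simp
    fix U assume "openin (bordification_topology x\<^sub>0) U \<and> Inr \<xi> \<in> U"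
    then obtain R where R: "\<forall>q\<in>bordification x\<^sub>0. ereal R \<le> ep q (Inr \<xi>) \<longrightarrow> q \<in> U"
      using openin_boundaryD by blast
    have "eventually (\<lambda>t. ereal R \<le> ep (Inl (f t)) (Inr \<xi>)) F" using r by blast
    then show "eventually (\<lambda>t. Inl (f t) \<in> U) F"
      by eventually_elim (use R in simp)
  qed
qed

section \<open>Busemann functions and horoballs in terms of Gromov products\<close>

definition approach :: "(nat \<Rightarrow> 'a) set \<Rightarrow> 'a filter" where
  "approach \<xi> = filtercomap Inl (nhdsin (bordification_topology x\<^sub>0) (Inr \<xi>))"

lemma eventually_approach:
  assumes "\<xi> \<in> gromov_boundary x\<^sub>0"
  shows "eventually (\<lambda>z. ereal R \<le> ep (Inl z) (Inr \<xi>)) (approach \<xi>)"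
  using boundary_nhd[OF assms, of R] assms
  unfolding approach_def eventually_filtercomap eventually_nhdsin by auto

lemma approach_neq_bot:
  assumes \<xi>: "\<xi> \<in> gromov_boundary x\<^sub>0"
  shows "approach \<xi> \<noteq> bot"
proof
  assume "approach \<xi> = bot"
  then have "eventually (\<lambda>_. False) (approach \<xi>)" by simp
  then obtain U where U: "openin (bordification_topology x\<^sub>0) U" "Inr \<xi> \<in> U" "\<And>z. Inl z \<notin> U"
    unfolding approach_def eventually_filtercomap eventually_nhdsin using \<xi> by auto
  then obtain R where R: "\<forall>q\<in>bordification x\<^sub>0. ereal R \<le> ep q (Inr \<xi>) \<longrightarrow> q \<in> U"
    using openin_boundaryD by blast
  obtain u where "u \<in> \<xi>" using boundary_nonempty[OF \<xi>] by blast
  then obtain n where "ereal R \<le> ep (Inl (u n)) (Inr \<xi>)" using ep_sequence[OF \<xi>] by blast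
  then show False using R U by auto
qed

text \<open>For z near \<xi> the Busemann difference is |x| - 2(x|z), and (x|z) is at least R - 3K;
  doubling gives 6K. An eventual upper bound passes to the \<open>Liminf\<close> only over a
  nontrivial filter, hence \<open>approach_neq_bot\<close>.\<close>

lemma horoballI:
  assumes \<xi>: "\<xi> \<in> gromov_boundary x\<^sub>0" and R: "ereal R \<le> ep (Inl x) (Inr \<xi>)"
    and le: "nrm x - 2 * R + 6 * K \<le> ln \<rho>"
  shows "x \<in> horoball x\<^sub>0 \<xi> \<rho>"
proof -
  have "eventually (\<lambda>z. ereal (dist x z - dist x\<^sub>0 z) \<le> ereal (ln \<rho>)) (approach \<xi>)"
    using eventually_approach[OF \<xi>, of R]
  proof eventually_elim
    case (elim z)
    have "ereal (R - K) \<le> ep (Inr \<xi>) (Inl z)" using ep_commute[OF elim] \<xi> by simp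
    then have "ereal (R - K - K) \<le> ep (Inl x) (Inl z)"
      using K_ge \<xi> by (intro ep_trans'[OF R]) auto
    from ep_points_D[OF this] have "R - 3 * K \<le> gp x z" by simp
    then show ?case using le dist_gp[of x z] by (simp add: dist_commute)
  qed
  then show ?thesis
    unfolding horoball_def busemann_def approach_def[symmetric]
    using approach_neq_bot[OF \<xi>] by (auto intro: Liminf_le)
qed

text \<open>An upper bound on a \<open>Liminf\<close> gives a Busemann difference below ln \<rho> +
  1 only frequently, but one such z sufficiently close to \<xi> is enough.\<close>

lemma horoballD:
  assumes \<xi>: "\<xi> \<in> gromov_boundary x\<^sub>0" and x: "x \<in> horoball x\<^sub>0 \<xi> \<rho>"
  shows "ereal ((nrm x - ln \<rho>) / 2 - 3 * K) \<le> ep (Inl x) (Inr \<xi>)"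
proof -
  have "Liminf (approach \<xi>) (\<lambda>z. ereal (dist x z - dist x\<^sub>0 z)) \<le> ereal (ln \<rho>)"
    using x unfolding horoball_def busemann_def approach_def[symmetric] by simp
  also have "\<dots> < ereal (ln \<rho> + 1)" by simp
  finally have "\<not> ereal (ln \<rho> + 1) \<le> Liminf (approach \<xi>) (\<lambda>z. ereal (dist x z - dist x\<^sub>0 z))"
    by (simp add: not_le)
  then have "\<not> eventually (\<lambda>z. ereal (ln \<rho> + 1) \<le> ereal (dist x z - dist x\<^sub>0 z)) (approach \<xi>)"
    by (rule contrapos_nn) (rule Liminf_bounded)
  then have "frequently (\<lambda>z. dist x z - dist x\<^sub>0 z < ln \<rho> + 1) (approach \<xi>)"
    by (simp add: frequently_def not_less)
  from frequently_eventually_frequently[OF this eventually_approach[OF \<xi>, of "(nrm x - ln \<rho>) / 2"]]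
  obtain z where z: "dist x z - dist x\<^sub>0 z < ln \<rho> + 1"
      "ereal ((nrm x - ln \<rho>) / 2) \<le> ep (Inl z) (Inr \<xi>)"
    using frequently_ex by blast
  have "(nrm x - ln \<rho>) / 2 - K \<le> gp x z"
    using z(1) dist_gp[of x z] K_ge by (simp add: dist_commute field_simps)
  then have "ereal ((nrm x - ln \<rho>) / 2 - K) \<le> ep (Inl x) (Inl z)" by (rule ep_points)
  then have "ereal ((nrm x - ln \<rho>) / 2 - K - K) \<le> ep (Inl x) (Inr \<xi>)"
    using z(2) \<xi> K_ge by (rule_tac ep_trans'[of _ _ "Inl z"]) (auto simp: field_simps)
  then show ?thesis by (rule ep_mono) (use K_ge in simp)
qed

section \<open>Geodesic rays and lines\<close>

text \<open>Limits of geodesics from Tychonoff's theorem: all the maps lie in a compact product of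
  balls, so they have a cluster point for pointwise convergence. Instead of a convergent subsequence
  one gets closeness for infinitely many n.\<close>

lemma geodesic_cluster:
  fixes c :: "nat \<Rightarrow> real \<Rightarrow> 'a" and I :: "nat \<Rightarrow> real set"
  assumes geo: "\<And>n. geodesic_on (I n) (c n)" and zero: "\<And>n. 0 \<in> I n"
    and base: "\<And>n. nrm (c n 0) \<le> M"
    and ev: "\<And>t. t \<in> J \<Longrightarrow> eventually (\<lambda>n. t \<in> I n) sequentially"
  shows "\<exists>\<gamma>. geodesic_on J \<gamma> \<and>
    (\<forall>t\<in>J. \<forall>\<epsilon>>0. \<exists>\<^sub>F n in sequentially. t \<in> I n \<and> dist (c n t) (\<gamma> t) < \<epsilon>)"
proof -
  \<comment> \<open>Outside its domain the geodesic takes its value at 0, which keeps every C n in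
    the product of balls.\<close>
  define C where "C n t = (if t \<in> I n then c n t else c n 0)" for n t
  define S where "S = PiE (UNIV :: real set) (\<lambda>t. cball x\<^sub>0 (M + \<bar>t\<bar>))"
  have "compactin (product_topology (\<lambda>_. euclidean) UNIV) S"
    unfolding S_def by (simp add: compactin_PiE)
  then have S: "compact S" by (simp add: euclidean_product_topology)
  have "C n \<in> S" for n
  proof -
    have "dist x\<^sub>0 (C n t) \<le> M + \<bar>t\<bar>" for t
    proof (cases "t \<in> I n")
      case True
      then have "dist (c n t) (c n 0) = \<bar>t\<bar>" using geo[of n] zero[of n] by (simp add: geodesic_on_def)
      then show ?thesis
        using True dist_triangle[of "c n t" x\<^sub>0 "c n 0"] base[of n] by (simp add: C_def dist_commute)
    qed (use base[of n] in \<open>simp add: C_def dist_commute\<close>)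
    then show ?thesis by (simp add: S_def PiE_iff)
  qed
  then have "eventually (\<lambda>f. f \<in> S) (filtermap C sequentially)" by (simp add: eventually_filtermap)
  moreover have "filtermap C sequentially \<noteq> bot" by (simp add: filtermap_bot_iff)
  ultimately obtain \<gamma> where \<gamma>: "inf (nhds \<gamma>) (filtermap C sequentially) \<noteq> bot"
    using S unfolding compact_filter by blast
  \<comment> \<open>Closeness at both times must hold for the same n, because being geodesic is a
    condition on pairs of times.\<close>
  have near: "\<exists>\<^sub>F n in sequentially. dist (C n s) (\<gamma> s) < \<epsilon> \<and> dist (C n t) (\<gamma> t) < \<epsilon>"
    if "\<epsilon> > 0" for s t \<epsilon>
  proof (rule ccontr)
    assume "\<not> ?thesis"
    then have 1: "eventually (\<lambda>f. \<not> (dist (f s) (\<gamma> s) < \<epsilon> \<and> dist (f t) (\<gamma> t) < \<epsilon>)) (filtermap C sequentially)"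
      by (simp add: frequently_def eventually_filtermap)
    have "open {f. dist (f s) (\<gamma> s) < \<epsilon> \<and> dist (f t) (\<gamma> t) < \<epsilon>}"
      by (intro open_Collect_conj open_Collect_less continuous_intros continuous_on_product_coordinates)
    then have 2: "eventually (\<lambda>f. dist (f s) (\<gamma> s) < \<epsilon> \<and> dist (f t) (\<gamma> t) < \<epsilon>) (nhds \<gamma>)"
      using that by (auto simp: eventually_nhds)
    from 1 2 have "eventually (\<lambda>_. False) (inf (nhds \<gamma>) (filtermap C sequentially))"
      unfolding eventually_inf by blast
    then show False using \<gamma> by (simp add: trivial_limit_def)
  qed
  have near': "\<exists>\<^sub>F n in sequentially. s \<in> I n \<and> t \<in> I n \<and>
      dist (c n s) (\<gamma> s) < \<epsilon> \<and> dist (c n t) (\<gamma> t) < \<epsilon>"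
    if "\<epsilon> > 0" "s \<in> J" "t \<in> J" for s t \<epsilon>
    using frequently_eventually_frequently[OF near[OF that(1), of s t]
        eventually_conj[OF ev[OF that(2)] ev[OF that(3)]]]
    by (rule frequently_elim1) (auto simp: C_def)
  have "geodesic_on J \<gamma>"
    unfolding geodesic_on_def
  proof (intro ballI)
    fix s t assume st: "s \<in> J" "t \<in> J"
    have "\<bar>dist (\<gamma> s) (\<gamma> t) - \<bar>s - t\<bar>\<bar> \<le> \<epsilon>" if "\<epsilon> > 0" for \<epsilon>
    proof -
      have "\<epsilon>/2 > 0" using that by simp
      from frequently_ex[OF near'[OF this st]] obtain n where n: "s \<in> I n" "t \<in> I n"
          "dist (c n s) (\<gamma> s) < \<epsilon>/2" "dist (c n t) (\<gamma> t) < \<epsilon>/2"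
        by blast
      have "dist (c n s) (c n t) = \<bar>s - t\<bar>" using geo[of n] n by (simp add: geodesic_on_def)
      moreover have "\<bar>dist (\<gamma> s) (\<gamma> t) - dist (c n s) (c n t)\<bar> \<le> dist (c n s) (\<gamma> s) + dist (c n t) (\<gamma> t)"
        using dist_triangle[of "\<gamma> s" "\<gamma> t" "c n s"] dist_triangle[of "c n s" "\<gamma> t" "c n t"]
          dist_triangle[of "c n s" "c n t" "\<gamma> s"] dist_triangle[of "\<gamma> s" "c n t" "\<gamma> t"]
        by (simp add: dist_commute)
      ultimately show ?thesis using n by simp
    qed
    from field_le_epsilon[of "\<bar>dist (\<gamma> s) (\<gamma> t) - \<bar>s - t\<bar>\<bar>" 0] this
    show "dist (\<gamma> s) (\<gamma> t) = \<bar>s - t\<bar>" by simp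
  qed
  moreover have "\<exists>\<^sub>F n in sequentially. t \<in> I n \<and> dist (c n t) (\<gamma> t) < \<epsilon>" if "t \<in> J" "\<epsilon> > 0" for t \<epsilon>
    using near'[OF that(2,1,1)] by (rule frequently_elim1) auto
  ultimately show ?thesis by blast
qed

section \<open>Rays and lines as limits of segments\<close>

lemma geodesic_segment:
  "\<exists>\<gamma>. geodesic_on {0..dist x y} \<gamma> \<and> \<gamma> 0 = x \<and> \<gamma> (dist x y) = (y :: 'a)"
  using geodesic unfolding geodesic_space_def by blast

lemma geodesic_on_nrm: "geodesic_on I \<gamma> \<Longrightarrow> \<gamma> 0 = x\<^sub>0 \<Longrightarrow> 0 \<in> I \<Longrightarrow> t \<in> I \<Longrightarrow> nrm (\<gamma> t) = \<bar>t\<bar>"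
  unfolding geodesic_on_def by fastforce

lemma geodesic_on_gromov_product:
  assumes "geodesic_on I \<gamma>" "0 \<in> I" "s \<in> I" "t \<in> I" "0 \<le> s * t" "\<bar>s\<bar> \<le> \<bar>t\<bar>"
  shows "gromov_product (\<gamma> 0) (\<gamma> s) (\<gamma> t) = \<bar>s\<bar>"
proof -
  have "dist (\<gamma> s) (\<gamma> 0) = \<bar>s\<bar>" "dist (\<gamma> t) (\<gamma> 0) = \<bar>t\<bar>" "dist (\<gamma> s) (\<gamma> t) = \<bar>s - t\<bar>"
    using assms(1-4) unfolding geodesic_on_def by fastforce+
  moreover have "\<bar>s - t\<bar> = \<bar>t\<bar> - \<bar>s\<bar>" using assms(5,6) by (auto simp: zero_le_mult_iff)
  ultimately show ?thesis by (simp add: gromov_product_def)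
qed

text \<open>The segments from the basepoint to \<open>u n\<close> cluster at a ray. Only divergence
  of u is assumed, so an arbitrary unbounded orbit sequence can be used to create a boundary point.
  The 1 is the closeness at the cluster point.\<close>

lemma ray_of_sequence:
  assumes u: "filterlim (\<lambda>n. nrm (u n)) at_top sequentially"
  shows "\<exists>\<gamma>. geodesic_on {0..} \<gamma> \<and> \<gamma> 0 = x\<^sub>0 \<and>
    (\<forall>t\<ge>0. \<exists>\<^sub>F n in sequentially. t - 1 \<le> gp (\<gamma> t) (u n))"
proof -
  have "\<forall>n. \<exists>c. geodesic_on {0..nrm (u n)} c \<and> c 0 = x\<^sub>0 \<and> c (nrm (u n)) = u n"
    using geodesic_segment[of x\<^sub>0] by (metis dist_commute)
  then obtain c where c: "\<And>n. geodesic_on {0..nrm (u n)} (c n)" "\<And>n. c n 0 = x\<^sub>0"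
      "\<And>n. c n (nrm (u n)) = u n"
    by metis
  have "eventually (\<lambda>n. t \<in> {0..nrm (u n)}) sequentially" if "t \<in> {0..}" for t
  proof -
    have "eventually (\<lambda>n. t \<le> nrm (u n)) sequentially" using u by (simp add: filterlim_at_top)
    then show ?thesis by (rule eventually_mono) (use that in simp)
  qed
  then obtain \<gamma> where \<gamma>: "geodesic_on {0..} \<gamma>"
    "\<And>t \<epsilon>. t \<in> {0..} \<Longrightarrow> \<epsilon> > 0 \<Longrightarrow> \<exists>\<^sub>F n in sequentially. t \<in> {0..nrm (u n)} \<and> dist (c n t) (\<gamma> t) < \<epsilon>"
    using geodesic_cluster[of "\<lambda>n. {0..nrm (u n)}" c 0 "{0..}"] c by auto
  have "\<gamma> 0 = x\<^sub>0"
  proof -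
    have "dist x\<^sub>0 (\<gamma> 0) \<le> 0 + \<epsilon>" if "\<epsilon> > 0" for \<epsilon>
      using frequently_ex[OF \<gamma>(2)[of 0 \<epsilon>]] that c by auto
    from field_le_epsilon[OF this] show ?thesis by simp
  qed
  moreover have "\<exists>\<^sub>F n in sequentially. t - 1 \<le> gp (\<gamma> t) (u n)" if "t \<ge> 0" for t
  proof -
    have "\<exists>\<^sub>F n in sequentially. t \<in> {0..nrm (u n)} \<and> dist (c n t) (\<gamma> t) < 1"
      using \<gamma>(2)[of t 1] that by auto
    then show ?thesis
    proof (rule frequently_elim1)
      fix n assume n: "t \<in> {0..nrm (u n)} \<and> dist (c n t) (\<gamma> t) < 1"
      have "gp (c n t) (u n) = t"
        using geodesic_on_gromov_product[OF c(1)[of n], of t "nrm (u n)"] n c by simp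
      then show "t - 1 \<le> gp (\<gamma> t) (u n)" using gp_lipschitz[of "c n t" "u n" "\<gamma> t"] n by simp
    qed
  qed
  ultimately show ?thesis using \<gamma> by blast
qed

definition ray :: "(real \<Rightarrow> 'a) \<Rightarrow> (nat \<Rightarrow> 'a) set \<Rightarrow> bool" where
  "ray \<gamma> \<xi> \<longleftrightarrow> geodesic_on {0..} \<gamma> \<and> \<gamma> 0 = x\<^sub>0 \<and> converges_to_boundary x\<^sub>0 \<gamma> \<xi> at_top"

lemma ray_boundary: "ray \<gamma> \<xi> \<Longrightarrow> \<xi> \<in> gromov_boundary x\<^sub>0"
  by (simp add: ray_def converges_to_boundary_iff)

lemma ray_nrm: "ray \<gamma> \<xi> \<Longrightarrow> 0 \<le> t \<Longrightarrow> nrm (\<gamma> t) = t"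
  using geodesic_on_nrm[of "{0..}" \<gamma> t] by (simp add: ray_def)

lemma ray_gp: "ray \<gamma> \<xi> \<Longrightarrow> 0 \<le> s \<Longrightarrow> s \<le> t \<Longrightarrow> gp (\<gamma> s) (\<gamma> t) = s"
  using geodesic_on_gromov_product[of "{0..}" \<gamma> s t] by (simp add: ray_def)

lemma ray_ep: 
  assumes "ray \<gamma> \<xi>" "0 \<le> t"
  shows "ereal (t - K) \<le> ep (Inl (\<gamma> t)) (Inr \<xi>)"
proof -
  have "eventually (\<lambda>s. ereal t \<le> ep (Inl (\<gamma> s)) (Inr \<xi>)) at_top"
    using assms by (simp add: ray_def converges_to_boundary_iff)
  from eventually_happens[OF eventually_conj[OF this eventually_ge_at_top[of t]]]
  obtain s where s: "ereal t \<le> ep (Inl (\<gamma> s)) (Inr \<xi>)" "t \<le> s" by auto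
  then show ?thesis
    using ray_boundary[OF assms(1)] ray_gp[OF assms s(2)] K_ge
    by (rule_tac ep_trans[of _ _ "Inl (\<gamma> s)"]) (auto intro: ep_points)
qed

text \<open>Products along the ray are min s t, so the values at integer times form a Gromov
  sequence whose class is the endpoint.\<close>

lemma geodesic_ray_endpoint:
  assumes \<gamma>: "geodesic_on {0..} \<gamma>" "\<gamma> 0 = x\<^sub>0"
  shows "\<exists>\<xi>. ray \<gamma> \<xi>"
proof -
  have g: "gp (\<gamma> s) (\<gamma> t) = min s t" if "0 \<le> s" "0 \<le> t" for s t
    using geodesic_on_gromov_product[OF \<gamma>(1), of s t] geodesic_on_gromov_product[OF \<gamma>(1), of t s] that \<gamma>(2)
    by (cases "s \<le> t") (auto simp: gp_commute)
  define u where "u n = \<gamma> (real n)" for n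
  have "joint_ge R u u" for R
  proof -
    obtain N :: nat where "R \<le> real N" using real_arch_simple by blast
    then have "\<forall>m\<ge>N. \<forall>n\<ge>N. R \<le> gp (u m) (u n)" by (auto simp: u_def g)
    then show ?thesis unfolding joint_ge_def by blast
  qed
  then have "u \<in> gromov_sequences x\<^sub>0" by (simp add: gromov_sequences_iff)
  then obtain \<xi> where \<xi>: "\<xi> \<in> gromov_boundary x\<^sub>0" "u \<in> \<xi>" using boundary_class by blast
  have "ereal R \<le> ep (Inl (\<gamma> t)) (Inr \<xi>)" if "t \<ge> max 0 R" for R t
  proof -
    obtain N :: nat where N: "t \<le> real N" using real_arch_simple by blast
    have "joint_ge R (\<lambda>_. \<gamma> t) u"
      unfolding joint_ge_def by (rule exI[of _ N]) (use N that in \<open>auto simp: u_def g\<close>)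
    then show ?thesis using \<xi> by (intro ep_geI) auto
  qed
  then have "eventually (\<lambda>t. ereal R \<le> ep (Inl (\<gamma> t)) (Inr \<xi>)) at_top" for R
    unfolding eventually_at_top_linorder by blast
  then show ?thesis using \<gamma> \<xi> unfolding ray_def converges_to_boundary_iff by blast
qed

lemma boundary_sequence_nrm:
  assumes "\<xi> \<in> gromov_boundary x\<^sub>0" "u \<in> \<xi>"
  shows "filterlim (\<lambda>n. nrm (u n)) at_top sequentially"
proof -
  have "\<exists>N. \<forall>n\<ge>N. R \<le> nrm (u n)" for R
  proof -
    have "joint_ge R u u" using boundary_joint_ge assms by blast
    then show ?thesis unfolding joint_ge_def by (meson gp_le_left order_trans)
  qed
  then show ?thesis by (simp add: filterlim_at_top eventually_sequentially)
qed

lemma ray_exists: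
  assumes \<xi>: "\<xi> \<in> gromov_boundary x\<^sub>0"
  shows "\<exists>\<gamma>. ray \<gamma> \<xi>"
proof -
  obtain u where u: "u \<in> \<xi>" using boundary_nonempty[OF \<xi>] by blast
  obtain \<gamma> where \<gamma>: "geodesic_on {0..} \<gamma>" "\<gamma> 0 = x\<^sub>0"
    "\<And>t. t \<ge> 0 \<Longrightarrow> \<exists>\<^sub>F n in sequentially. t - 1 \<le> gp (\<gamma> t) (u n)"
    using ray_of_sequence[OF boundary_sequence_nrm[OF \<xi> u]] by blast
  have *: "ereal (t - 1 - K) \<le> ep (Inl (\<gamma> t)) (Inr \<xi>)" if t: "t \<ge> 0" for t
  proof -
    have "eventually (\<lambda>n. ereal (t - 1) \<le> ep (Inl (u n)) (Inr \<xi>)) sequentially"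
      using ep_sequence[OF \<xi> u] by (simp add: eventually_sequentially)
    from frequently_eventually_frequently[OF \<gamma>(3)[OF t] this]
    obtain n where "t - 1 \<le> gp (\<gamma> t) (u n)" "ereal (t - 1) \<le> ep (Inl (u n)) (Inr \<xi>)"
      using frequently_ex by blast
    then show ?thesis using \<xi> by (rule_tac ep_trans[of _ _ "Inl (u n)"]) (auto intro: ep_points)
  qed
  have "eventually (\<lambda>t. ereal R \<le> ep (Inl (\<gamma> t)) (Inr \<xi>)) at_top" for R
    using eventually_ge_at_top[of "max 0 (R + 1 + K)"]
  proof eventually_elim
    case (elim t)
    then show ?case using ep_mono[OF *[of t], of R] by auto
  qed
  then show ?thesis using \<gamma>(1,2) \<xi> unfolding ray_def converges_to_boundary_iff by blast
qed

text \<open>At parameter 0 the products of c 0 with x and with y both equal the average of |c 0| and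
  (x|y); hyperbolicity bounds this average by (x|y) + D.\<close>

lemma geodesic_near_basepoint:
  "\<exists>c a b. 0 \<le> a \<and> 0 \<le> b \<and> geodesic_on {-a..b} c \<and> c (-a) = x \<and> c b = y \<and> nrm (c 0) \<le> gp x y + 2 * D"
proof -
  obtain \<gamma> where \<gamma>: "geodesic_on {0..dist x y} \<gamma>" "\<gamma> 0 = x" "\<gamma> (dist x y) = y"
    using geodesic_segment by blast
  \<comment> \<open>The Gromov product of y and the basepoint seen from x: the point at this
    distance from x is the branch point of the comparison tripod.\<close>
  define a where "a = (nrm x + dist x y - nrm y) / 2"
  define b where "b = dist x y - a"
  define c where "c t = \<gamma> (t + a)" for t
  have ab: "0 \<le> a" "0 \<le> b"
    using dist_triangle[of y x\<^sub>0 x] dist_triangle[of x x\<^sub>0 y] unfolding a_def b_def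
    by (simp_all add: dist_commute field_simps)
  have c: "geodesic_on {-a..b} c" using \<gamma>(1) unfolding geodesic_on_def c_def b_def by auto
  have ends: "c (-a) = x" "c b = y" using \<gamma> by (auto simp: c_def b_def)
  have "dist x (c 0) = a" "dist (c 0) y = b"
    using c ab ends unfolding geodesic_on_def
    by (metis abs_of_nonneg abs_minus_cancel atLeastAtMost_iff diff_0_right neg_le_0_iff_le order_refl order_trans,
        metis abs_minus_commute abs_of_nonneg atLeastAtMost_iff diff_0_right neg_le_0_iff_le order_refl order_trans)
  then have "gp x (c 0) = (nrm (c 0) + gp x y) / 2" "gp (c 0) y = (nrm (c 0) + gp x y) / 2"
    unfolding gromov_product_def b_def a_def by (simp_all add: field_simps)
  then have "nrm (c 0) \<le> gp x y + 2 * D"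
    using hyperbolic[of x\<^sub>0 x "c 0" y] by (simp add: field_simps)
  then show ?thesis using ab c ends by blast
qed

text \<open>A bounded product of \<xi> and \<eta> makes segments between suitable representatives
  pass close to the basepoint, so with parameter 0 placed there they cluster at a line. The final 1
  is again the closeness to the limit.\<close>

lemma line_exists:
  assumes \<xi>: "\<xi> \<in> gromov_boundary x\<^sub>0" and \<eta>: "\<eta> \<in> gromov_boundary x\<^sub>0"
    and far: "\<not> ereal M \<le> ep (Inr \<xi>) (Inr \<eta>)"
  shows "\<exists>\<gamma>. geodesic_on UNIV \<gamma> \<and> converges_to_boundary x\<^sub>0 \<gamma> \<xi> at_bot \<and>
    converges_to_boundary x\<^sub>0 \<gamma> \<eta> at_top \<and> nrm (\<gamma> 0) \<le> M + 2 * D + 1"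
proof -
  obtain u v where uv: "u \<in> \<xi>" "v \<in> \<eta>" using boundary_nonempty \<xi> \<eta> by blast
  \<comment> \<open>The failure of a joint bound only provides arbitrarily late index pairs with
    small product; f and g select them.\<close>
  have "\<not> joint_ge M u v" using far uv ep_geI[of u "Inr \<xi>" v "Inr \<eta>" M] by auto
  then have "\<forall>N. \<exists>m n. m \<ge> N \<and> n \<ge> N \<and> gp (u m) (v n) \<le> M"
    unfolding joint_ge_def by (meson linear)
  then obtain f g where fg: "\<And>N. f N \<ge> N" "\<And>N. g N \<ge> N" "\<And>N. gp (u (f N)) (v (g N)) \<le> M"
    by metis
  define M' where "M' = M + 2 * D"
  have "\<forall>N. \<exists>c a b. 0 \<le> a \<and> 0 \<le> b \<and> geodesic_on {-a..b} c \<and> c (-a) = u (f N) \<and> c b = v (g N) \<and>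
      nrm (c 0) \<le> M'"
    using geodesic_near_basepoint fg(3) unfolding M'_def by (smt (verit))
  then obtain c a b where abc: "\<And>N. 0 \<le> a N" "\<And>N. 0 \<le> b N" "\<And>N. geodesic_on {-a N..b N} (c N)"
      "\<And>N. c N (-a N) = u (f N)" "\<And>N. c N (b N) = v (g N)" "\<And>N. nrm (c N 0) \<le> M'"
    by metis
  have lf: "filterlim f at_top sequentially" "filterlim g at_top sequentially"
    unfolding filterlim_at_top eventually_sequentially using fg(1,2) order_trans by blast+
  have a_ge: "nrm (u (f N)) - M' \<le> a N" and b_ge: "nrm (v (g N)) - M' \<le> b N" for N
  proof -
    have "dist (c N (-a N)) (c N 0) = a N" "dist (c N (b N)) (c N 0) = b N"
      using abc(1-3)[of N] unfolding geodesic_on_def by auto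
    then show "nrm (u (f N)) - M' \<le> a N" "nrm (v (g N)) - M' \<le> b N"
      using dist_triangle[of "u (f N)" x\<^sub>0 "c N 0"] dist_triangle[of "v (g N)" x\<^sub>0 "c N 0"] abc(4-6)[of N]
      by simp_all
  qed
  have eu: "eventually (\<lambda>N. R \<le> nrm (u (f N))) sequentially"
    and ev: "eventually (\<lambda>N. R \<le> nrm (v (g N))) sequentially" for R
    using filterlim_compose[OF boundary_sequence_nrm[OF \<xi> uv(1)] lf(1)]
      filterlim_compose[OF boundary_sequence_nrm[OF \<eta> uv(2)] lf(2)]
    by (auto simp: filterlim_at_top)
  have "eventually (\<lambda>N. t \<in> {-a N..b N}) sequentially" for t
    using eu[of "\<bar>t\<bar> + M'"] ev[of "\<bar>t\<bar> + M'"]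
  proof eventually_elim
    case (elim N)
    then show ?case using a_ge[of N] b_ge[of N] by auto
  qed
  then obtain \<gamma> where \<gamma>: "geodesic_on UNIV \<gamma>"
    "\<And>t \<epsilon>. \<epsilon> > 0 \<Longrightarrow> \<exists>\<^sub>F N in sequentially. t \<in> {-a N..b N} \<and> dist (c N t) (\<gamma> t) < \<epsilon>"
    using geodesic_cluster[of "\<lambda>N. {-a N..b N}" c M' UNIV] abc by auto
  have top: "ereal (t - M' - 1 - K) \<le> ep (Inl (\<gamma> t)) (Inr \<eta>)" if t: "t \<ge> 0" for t
  proof -
    have "eventually (\<lambda>n. ereal (t - M' - 1) \<le> ep (Inl (v n)) (Inr \<eta>)) sequentially"
      using ep_sequence[OF \<eta> uv(2)] by (simp add: eventually_sequentially)
    then have "eventually (\<lambda>N. ereal (t - M' - 1) \<le> ep (Inl (v (g N))) (Inr \<eta>)) sequentially"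
      using lf(2) unfolding filterlim_iff by blast
    from frequently_eventually_frequently[OF \<gamma>(2)[of 1 t] this]
    obtain N where N: "t \<in> {-a N..b N}" "dist (c N t) (\<gamma> t) < 1" "ereal (t - M' - 1) \<le> ep (Inl (v (g N))) (Inr \<eta>)"
      using frequently_ex by force
    have "gromov_product (c N 0) (c N t) (v (g N)) = t"
      using geodesic_on_gromov_product[OF abc(3)[of N], of t "b N"] abc(1,2,5)[of N] N t by simp
    then have "t - M' \<le> gp (c N t) (v (g N))"
      using gromov_product_base_change[of "c N 0" "c N t" "v (g N)" x\<^sub>0] abc(6)[of N] by simp
    then have "t - M' - 1 \<le> gp (\<gamma> t) (v (g N))"
      using gp_lipschitz[of "c N t" "v (g N)" "\<gamma> t"] N(2) by simp
    then show ?thesis using \<eta> N by (rule_tac ep_trans[of _ _ "Inl (v (g N))"]) (auto intro: ep_points)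
  qed
  have bot: "ereal (- t - M' - 1 - K) \<le> ep (Inl (\<gamma> t)) (Inr \<xi>)" if t: "t \<le> 0" for t
  proof -
    have "eventually (\<lambda>n. ereal (- t - M' - 1) \<le> ep (Inl (u n)) (Inr \<xi>)) sequentially"
      using ep_sequence[OF \<xi> uv(1)] by (simp add: eventually_sequentially)
    then have "eventually (\<lambda>N. ereal (- t - M' - 1) \<le> ep (Inl (u (f N))) (Inr \<xi>)) sequentially"
      using lf(1) unfolding filterlim_iff by blast
    from frequently_eventually_frequently[OF \<gamma>(2)[of 1 t] this]
    obtain N where N: "t \<in> {-a N..b N}" "dist (c N t) (\<gamma> t) < 1" "ereal (- t - M' - 1) \<le> ep (Inl (u (f N))) (Inr \<xi>)"
      using frequently_ex by force
    have "gromov_product (c N 0) (c N t) (u (f N)) = - t"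
      using geodesic_on_gromov_product[OF abc(3)[of N], of t "- a N"] abc(1,2,4)[of N] N t
      by (simp add: mult_nonpos_nonneg)
    then have "- t - M' \<le> gp (c N t) (u (f N))"
      using gromov_product_base_change[of "c N 0" "c N t" "u (f N)" x\<^sub>0] abc(6)[of N] by simp
    then have "- t - M' - 1 \<le> gp (\<gamma> t) (u (f N))"
      using gp_lipschitz[of "c N t" "u (f N)" "\<gamma> t"] N(2) by simp
    then show ?thesis using \<xi> N by (rule_tac ep_trans[of _ _ "Inl (u (f N))"]) (auto intro: ep_points)
  qed
  have "eventually (\<lambda>t. ereal R \<le> ep (Inl (\<gamma> t)) (Inr \<eta>)) at_top" for R
    using eventually_ge_at_top[of "max 0 (R + M' + 1 + K)"]
  proof eventually_elim
    case (elim t)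
    then show ?case using ep_mono[OF top[of t], of R] by auto
  qed
  moreover have "eventually (\<lambda>t. ereal R \<le> ep (Inl (\<gamma> t)) (Inr \<xi>)) at_bot" for R
    using eventually_le_at_bot[of "- max 0 (R + M' + 1 + K)"]
  proof eventually_elim
    case (elim t)
    then show ?case using ep_mono[OF bot[of t], of R] by auto
  qed
  moreover have "nrm (\<gamma> 0) \<le> M + 2 * D + 1"
  proof -
    obtain N where "dist (c N 0) (\<gamma> 0) < 1" using frequently_ex[OF \<gamma>(2)[of 1 0]] by auto
    then show ?thesis using dist_triangle[of "\<gamma> 0" x\<^sub>0 "c N 0"] abc(6)[of N]
      by (simp add: M'_def dist_commute)
  qed
  ultimately show ?thesis using \<gamma>(1) \<xi> \<eta> unfolding converges_to_boundary_iff by blast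
qed

text \<open>Both points have product with \<xi> at least t up to constants, and lie at distance t
  and at most t + M from the basepoint; the bound is t + (t + M) - 2 (t - M - 4 K).\<close>

lemma ray_near_line:
  assumes \<gamma>: "ray \<gamma> \<xi>" and c: "geodesic_on UNIV c" "converges_to_boundary x\<^sub>0 c \<xi> at_top"
    and M: "nrm (c 0) \<le> M" and t: "0 \<le> t"
  shows "dist (\<gamma> t) (c t) \<le> 3 * M + 8 * K"
proof -
  have \<xi>: "\<xi> \<in> gromov_boundary x\<^sub>0" using \<gamma> by (rule ray_boundary)
  have M0: "0 \<le> M" using M zero_le_dist order_trans by blast
  have "eventually (\<lambda>s. ereal t \<le> ep (Inl (c s)) (Inr \<xi>)) at_top"
    using c by (simp add: converges_to_boundary_iff)
  from eventually_happens[OF eventually_conj[OF this eventually_ge_at_top[of t]]]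
  obtain s where s: "ereal t \<le> ep (Inl (c s)) (Inr \<xi>)" "t \<le> s" by auto
  have "gromov_product (c 0) (c t) (c s) = t"
    using geodesic_on_gromov_product[OF c(1), of t s] s t by simp
  then have "t - M \<le> gp (c t) (c s)"
    using gromov_product_base_change[of "c 0" "c t" "c s" x\<^sub>0] M by simp
  then have "ereal (t - M - K) \<le> ep (Inl (c t)) (Inr \<xi>)"
    using s(1) M0 \<xi> by (rule_tac ep_trans'[of "t - M" _ "Inl (c s)" t]) (auto intro: ep_points)
  from ep_commute[OF this] have "ereal (t - M - K - K) \<le> ep (Inr \<xi>) (Inl (c t))" using \<xi> by simp
  then have "ereal (t - M - K - K - K) \<le> ep (Inl (\<gamma> t)) (Inl (c t))"
    using \<xi> ray_ep[OF \<gamma> t] M0 K_ge by (rule_tac ep_trans'[of "t - K" _ "Inr \<xi>" "t - M - K - K"]) auto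
  from ep_points_D[OF this] have "t - M - 4 * K \<le> gp (\<gamma> t) (c t)" by simp
  moreover have "nrm (c t) \<le> t + M"
  proof -
    have "dist (c t) (c 0) = t" using c(1) t unfolding geodesic_on_def by simp
    then show ?thesis using dist_triangle[of "c t" x\<^sub>0 "c 0"] M by simp
  qed
  ultimately show ?thesis using dist_gp[of "\<gamma> t" "c t"] ray_nrm[OF \<gamma> t] by simp
qed

section \<open>Rays and horoballs\<close>

lemma horoball_shadow_iff:
  "\<eta> \<in> horoball_shadow x\<^sub>0 \<xi> \<rho> \<longleftrightarrow> (\<exists>\<gamma> t. ray \<gamma> \<eta> \<and> 0 \<le> t \<and> \<gamma> t \<in> horoball x\<^sub>0 \<xi> \<rho>)"
  unfolding horoball_shadow_def ray_def converges_to_boundary_iff by blast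

lemma horoball_nonempty:
  assumes \<xi>: "\<xi> \<in> gromov_boundary x\<^sub>0"
  shows "horoball x\<^sub>0 \<xi> \<rho> \<noteq> {}"
proof -
  obtain \<gamma> where \<gamma>: "ray \<gamma> \<xi>" using ray_exists[OF \<xi>] by blast
  define t where "t = max 0 (8 * K - ln \<rho>)"
  have t: "0 \<le> t" "t \<ge> 8 * K - ln \<rho>" by (auto simp: t_def)
  then have "\<gamma> t \<in> horoball x\<^sub>0 \<xi> \<rho>"
    using ray_ep[OF \<gamma> t(1)] ray_nrm[OF \<gamma> t(1)] by (intro horoballI[OF \<xi>, of "t - K"]) auto
  then show ?thesis by blast
qed

text \<open>Up to constants, membership at time t makes (\<gamma> t|\<xi>) at least (t - ln
  \<rho>)/2, while this product is at most t. Hence t, and then the product itself, is at least - ln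
  \<rho>.\<close>

lemma horoball_shadow_ep:
  assumes \<xi>: "\<xi> \<in> gromov_boundary x\<^sub>0" and \<eta>: "\<eta> \<in> horoball_shadow x\<^sub>0 \<xi> \<rho>"
  shows "ereal (- ln \<rho> - 12 * K) \<le> ep (Inr \<eta>) (Inr \<xi>)"
proof -
  obtain \<gamma> t where \<gamma>: "ray \<gamma> \<eta>" and t: "0 \<le> t" and h: "\<gamma> t \<in> horoball x\<^sub>0 \<xi> \<rho>"
    using \<eta> by (auto simp: horoball_shadow_iff)
  have \<eta>b: "\<eta> \<in> gromov_boundary x\<^sub>0" using \<gamma> by (rule ray_boundary)
  define e where "e = (t - ln \<rho>) / 2 - 3 * K"
  have e: "ereal e \<le> ep (Inl (\<gamma> t)) (Inr \<xi>)"
    using horoballD[OF \<xi> h] ray_nrm[OF \<gamma> t] by (simp add: e_def)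
  have "e - K \<le> t" using ep_le_nrm[OF e] \<xi> ray_nrm[OF \<gamma> t] by simp
  then have "t \<ge> - ln \<rho> - 8 * K" "e \<ge> - ln \<rho> - 8 * K" unfolding e_def using K_ge by (simp_all add: field_simps)
  moreover have "ereal (t - K - K) \<le> ep (Inr \<eta>) (Inl (\<gamma> t))"
    using ep_commute[OF ray_ep[OF \<gamma> t]] \<eta>b by simp
  ultimately show ?thesis
    using e \<xi> \<eta>b K_ge by (rule_tac ep_trans'[of "t - K - K" _ "Inl (\<gamma> t)" e]) auto
qed

lemma ray_in_horoball:
  assumes \<gamma>: "ray \<gamma> \<eta>" and \<xi>: "\<xi> \<in> gromov_boundary x\<^sub>0" and t: "0 \<le> t"
    and e: "ereal t \<le> ep (Inr \<eta>) (Inr \<xi>)" and \<rho>: "- t + 10 * K \<le> ln \<rho>"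
  shows "\<gamma> t \<in> horoball x\<^sub>0 \<xi> \<rho>"
proof -
  have "ereal (t - K - K) \<le> ep (Inl (\<gamma> t)) (Inr \<xi>)"
    using ray_ep[OF \<gamma> t] e \<xi> ray_boundary[OF \<gamma>] K_ge by (rule_tac ep_trans'[of "t - K" _ "Inr \<eta>" t]) auto
  then show ?thesis using ray_nrm[OF \<gamma> t] \<rho> by (intro horoballI[OF \<xi>]) auto
qed

lemma basepoint_in_horoball:
  assumes \<xi>: "\<xi> \<in> gromov_boundary x\<^sub>0" and "6 * K \<le> ln \<rho>"
  shows "x\<^sub>0 \<in> horoball x\<^sub>0 \<xi> \<rho>"
  using assms ep_nonneg[of "Inr \<xi>" x\<^sub>0] by (intro horoballI[OF \<xi>, of 0]) (auto simp: zero_ereal_def)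

text \<open>Both horoballs contain a point of the ray from the basepoint slightly beyond the level
  \<open>- ln s\<close> at which their tops lie.\<close>
lemma horoballs_intersect_if_shadows_intersect:
  assumes "\<xi>\<^sub>1 \<in> gromov_boundary x\<^sub>0" "\<xi>\<^sub>2 \<in> gromov_boundary x\<^sub>0"
    and s: "0 < s" "s \<le> r\<^sub>1" "s \<le> r\<^sub>2"
    and \<eta>: "\<eta> \<in> horoball_shadow x\<^sub>0 \<xi>\<^sub>1 \<rho>\<^sub>1" "\<eta> \<in> horoball_shadow x\<^sub>0 \<xi>\<^sub>2 \<rho>\<^sub>2"
    and \<rho>: "ln \<rho>\<^sub>1 + 22 * K \<le> ln s" "ln \<rho>\<^sub>2 + 22 * K \<le> ln s"
  shows "horoball x\<^sub>0 \<xi>\<^sub>1 r\<^sub>1 \<inter> horoball x\<^sub>0 \<xi>\<^sub>2 r\<^sub>2 \<noteq> {}"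
proof -
  have ln: "ln s \<le> ln r\<^sub>1" "ln s \<le> ln r\<^sub>2" using s by auto
  obtain \<gamma> where \<gamma>: "ray \<gamma> \<eta>" using \<eta> by (auto simp: horoball_shadow_iff)
  show ?thesis
  proof (cases "10 * K \<le> ln s")
    \<comment> \<open>For large s the basepoint itself lies in both horoballs, and no positive time
      along the ray is available.\<close>
    case True
    then have "x\<^sub>0 \<in> horoball x\<^sub>0 \<xi>\<^sub>1 r\<^sub>1" "x\<^sub>0 \<in> horoball x\<^sub>0 \<xi>\<^sub>2 r\<^sub>2"
      using assms(1,2) ln K_ge by (auto intro: basepoint_in_horoball)
    then show ?thesis by blast
  next
    case False
    \<comment> \<open>10K is the loss in \<open>ray_in_horoball\<close>; with the 12K of
      \<open>horoball_shadow_ep\<close> it makes up the 22K of the hypotheses.\<close>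
    define t where "t = 10 * K - ln s"
    have t: "0 \<le> t" using False by (simp add: t_def)
    have "ereal t \<le> ep (Inr \<eta>) (Inr \<xi>\<^sub>1)" "ereal t \<le> ep (Inr \<eta>) (Inr \<xi>\<^sub>2)"
      using horoball_shadow_ep[OF assms(1) \<eta>(1)] horoball_shadow_ep[OF assms(2) \<eta>(2)] \<rho>
      by (auto simp: t_def intro: ep_mono)
    from ray_in_horoball[OF \<gamma> assms(1) t this(1)] ray_in_horoball[OF \<gamma> assms(2) t this(2)]
    have "\<gamma> t \<in> horoball x\<^sub>0 \<xi>\<^sub>1 r\<^sub>1" "\<gamma> t \<in> horoball x\<^sub>0 \<xi>\<^sub>2 r\<^sub>2"
      using ln by (simp_all add: t_def)
    then show ?thesis by blast
  qed
qed

text \<open>A horoball that the ray approaches at time \<open>t\<close> up to distance \<open>R\<close> has its top before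
  time \<open>t\<close> up to a constant, and the ray penetrates it to at least half of the time it spends inside before \<open>t\<close>.\<close>
lemma shadow_if_ray_near_horoball:
  assumes \<gamma>: "ray \<gamma> \<eta>" and t: "0 \<le> t" and \<xi>: "\<xi> \<in> gromov_boundary x\<^sub>0"
    and x: "x \<in> horoball x\<^sub>0 \<xi> \<rho>" "dist (\<gamma> t) x \<le> R"
  shows "- t - 4 * R - 10 * K \<le> ln \<rho>"
    and "\<sigma> > 0 \<Longrightarrow> (ln \<rho> - t) / 2 + 2 * R + 16 * K \<le> ln \<sigma> \<Longrightarrow> \<eta> \<in> horoball_shadow x\<^sub>0 \<xi> \<sigma>"
proof -
  have "ereal ((nrm x - ln \<rho>) / 2 - 3 * K - dist (\<gamma> t) x - K) \<le> ep (Inl (\<gamma> t)) (Inr \<xi>)"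
    using horoballD[OF \<xi> x(1)] \<xi> by (intro ep_lipschitz) auto
  moreover have "t - R \<le> nrm x"
    using dist_triangle[of "\<gamma> t" x\<^sub>0 x] ray_nrm[OF \<gamma> t] x(2) by simp
  moreover define g where "g = (t - ln \<rho>) / 2 - 2 * R - 4 * K"
  moreover have "0 \<le> R" using x(2) zero_le_dist order_trans by blast
  ultimately have g: "ereal g \<le> ep (Inl (\<gamma> t)) (Inr \<xi>)"
    using x(2) by (elim ep_mono) (auto simp: field_simps)
  have gt: "g - K \<le> t" using ep_le_nrm[OF g] \<xi> ray_nrm[OF \<gamma> t] by simp
  have R0: "0 \<le> R" by fact
  show "- t - 4 * R - 10 * K \<le> ln \<rho>" using gt R0 K_ge unfolding g_def by (simp add: field_simps)
  assume \<sigma>: "\<sigma> > 0" "(ln \<rho> - t) / 2 + 2 * R + 16 * K \<le> ln \<sigma>"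
  \<comment> \<open>Up to about time g - K the ray follows a ray to \<xi>, so it is tested there. If
    g - K is negative, the horoball of radius \<sigma> already contains the basepoint.\<close>
  define \<tau> where "\<tau> = max 0 (g - K)"
  have \<tau>: "0 \<le> \<tau>" "\<tau> \<le> t" using gt t by (auto simp: \<tau>_def)
  have "\<gamma> \<tau> \<in> horoball x\<^sub>0 \<xi> \<sigma>"
  proof (cases "0 \<le> g - K")
    case True
    have "ereal (g - K - K) \<le> ep (Inl (\<gamma> \<tau>)) (Inr \<xi>)"
      using g \<xi> \<tau> K_ge ray_gp[OF \<gamma> \<tau>] True
      by (rule_tac ep_trans'[of "g - K" _ "Inl (\<gamma> t)" g]) (auto simp: \<tau>_def intro: ep_points)
    then show ?thesis
      using ray_nrm[OF \<gamma> \<tau>(1)] \<sigma> K_ge True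
      by (intro horoballI[OF \<xi>]) (auto simp: g_def \<tau>_def field_simps)
  next
    case False
    then have "\<gamma> \<tau> = x\<^sub>0" using \<gamma> by (simp add: \<tau>_def ray_def)
    moreover have "6 * K \<le> ln \<sigma>" using \<sigma> False K_ge unfolding g_def by (simp add: field_simps)
    ultimately show ?thesis using basepoint_in_horoball[OF \<xi>] by simp
  qed
  then show "\<eta> \<in> horoball_shadow x\<^sub>0 \<xi> \<sigma>" using \<gamma> \<tau> by (auto simp: horoball_shadow_iff)
qed

end

section \<open>Isometry groups and their limit sets\<close>

lemma subgroup_BijGroup_UNIV:
  "subgroup H (BijGroup UNIV) \<longleftrightarrow>
     (\<forall>h\<in>H. bij h) \<and> id \<in> H \<and> (\<forall>g\<in>H. \<forall>h\<in>H. g \<circ> h \<in> H) \<and> (\<forall>g\<in>H. inv_into UNIV g \<in> H)"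
proof -
  have carrier: "carrier (BijGroup UNIV) = {h :: 'a \<Rightarrow> 'a. bij h}"
    by (auto simp: BijGroup_def Bij_def)
  have one: "\<one>\<^bsub>BijGroup UNIV\<^esub> = (id :: 'a \<Rightarrow> 'a)"
    by (auto simp: BijGroup_def)
  have mult: "g \<otimes>\<^bsub>BijGroup UNIV\<^esub> h = g \<circ> h" if "bij g" "bij h" for g h :: "'a \<Rightarrow> 'a"
    using that by (auto simp: BijGroup_def Bij_def compose_def o_def)
  have inverse: "m_inv (BijGroup UNIV) g = inv_into UNIV g" if "bij g" for g :: "'a \<Rightarrow> 'a"
    using that inv_BijGroup[of g UNIV] by (simp add: Bij_def restrict_def)
  show ?thesis
    unfolding subgroup_def carrier one by (auto simp: mult inverse subset_iff)
qed

lemma funpow_conjugate: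
  assumes "\<And>x. g' (g x) = x" "\<And>x. g (g' x) = x"
  shows "((g \<circ> h \<circ> g') ^^ n) x = g ((h ^^ n) (g' x))"
  by (induction n arbitrary: x) (simp_all add: assms)

locale hyperbolic_group_action = gromov_hyperbolic_space +
  fixes \<Gamma> :: "('a \<Rightarrow> 'a) set"
  assumes isometry_group: "isometry_group \<Gamma>"
    and properly_discontinuous: "properly_discontinuous \<Gamma>"
begin

abbreviation "inverse_map \<equiv> inv_into (UNIV :: 'a set)"

lemma
  shows id_mem: "id \<in> \<Gamma>"
    and comp_mem: "g \<in> \<Gamma> \<Longrightarrow> h \<in> \<Gamma> \<Longrightarrow> g \<circ> h \<in> \<Gamma>"
    and inv_mem: "g \<in> \<Gamma> \<Longrightarrow> inverse_map g \<in> \<Gamma>"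
    and mem_bij: "g \<in> \<Gamma> \<Longrightarrow> bij g"
    and dist_isometry: "g \<in> \<Gamma> \<Longrightarrow> dist (g x) (g y) = dist x y"
  using isometry_group by (auto simp: isometry_group_def subgroup_BijGroup_UNIV)

lemma inv_left [simp]: "g \<in> \<Gamma> \<Longrightarrow> inverse_map g (g x) = x"
  and inv_right [simp]: "g \<in> \<Gamma> \<Longrightarrow> g (inverse_map g x) = x"
  using mem_bij[of g] by (simp_all add: bij_is_inj bij_is_surj surj_f_inv_f)

lemma inv_comp [simp]: "g \<in> \<Gamma> \<Longrightarrow> inverse_map g \<circ> g = id" "g \<in> \<Gamma> \<Longrightarrow> g \<circ> inverse_map g = id"
  by (auto simp: fun_eq_iff)

lemma nrm_inv: "g \<in> \<Gamma> \<Longrightarrow> nrm (inverse_map g x\<^sub>0) = nrm (g x\<^sub>0)"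
  using dist_isometry[of g "inverse_map g x\<^sub>0" x\<^sub>0] by (simp add: dist_commute)

lemma finite_orbit_ball: "finite {g \<in> \<Gamma>. dist x\<^sub>0 (g x\<^sub>0) \<le> R}"
proof (cases "0 \<le> R")
  case True
  have "finite {g \<in> \<Gamma>. g ` cball x\<^sub>0 R \<inter> cball x\<^sub>0 R \<noteq> {}}"
    using properly_discontinuous compact_cball[of x\<^sub>0 R] by (simp add: properly_discontinuous_def)
  moreover have "g ` cball x\<^sub>0 R \<inter> cball x\<^sub>0 R \<noteq> {}" if "dist x\<^sub>0 (g x\<^sub>0) \<le> R" for g
  proof -
    have "g x\<^sub>0 \<in> g ` cball x\<^sub>0 R \<inter> cball x\<^sub>0 R" using True that by simp
    then show ?thesis by blast
  qed
  ultimately show ?thesis by (auto elim: rev_finite_subset)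
next
  case False
  then have "\<not> dist x\<^sub>0 (g x\<^sub>0) \<le> R" for g using zero_le_dist[of x\<^sub>0 "g x\<^sub>0"] by linarith
  then show ?thesis by simp
qed

text \<open>An isometry turns products based at \<open>x\<^sub>0\<close> into products based at its
  image; moving the base back costs the distance moved.\<close>

lemma gp_move: "g \<in> \<Gamma> \<Longrightarrow> gp x y - nrm (g x\<^sub>0) \<le> gp (g x) (g y)"
  using gromov_product_base_change[of "g x\<^sub>0" "g x" "g y" x\<^sub>0]
  by (simp add: gromov_product_def dist_isometry)

lemma joint_ge_move:
  assumes "g \<in> \<Gamma>" "joint_ge R u v"
  shows "joint_ge (R - nrm (g x\<^sub>0)) (g \<circ> u) (g \<circ> v)"
proof -
  obtain N where N: "R \<le> gp (u m) (v n)" if "N \<le> m" "N \<le> n" for m n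
    using assms(2) unfolding joint_ge_def by blast
  have "R - nrm (g x\<^sub>0) \<le> gp ((g \<circ> u) m) ((g \<circ> v) n)" if "N \<le> m" "N \<le> n" for m n
    using N[OF that] gp_move[OF assms(1), of "u m" "v n"] by simp
  then show ?thesis unfolding joint_ge_def by blast
qed

lemma asymptotic_move: "g \<in> \<Gamma> \<Longrightarrow> (u, v) \<in> asymptotic \<Longrightarrow> (g \<circ> u, g \<circ> v) \<in> asymptotic"
  using joint_ge_move[of g "R + nrm (g x\<^sub>0)" for R]
  unfolding asymptotic_iff gromov_sequences_iff by (metis add_diff_cancel_right')

lemma boundary_action_id [simp]: "boundary_action id \<xi> = \<xi>"
  by (simp add: boundary_action_def)

lemma boundary_action_comp: "boundary_action (g \<circ> h) \<xi> = boundary_action g (boundary_action h \<xi>)"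
  by (simp add: boundary_action_def image_image comp_assoc)

lemma boundary_action_inv:
  "g \<in> \<Gamma> \<Longrightarrow> boundary_action (inverse_map g) (boundary_action g \<xi>) = \<xi>"
  "g \<in> \<Gamma> \<Longrightarrow> boundary_action g (boundary_action (inverse_map g) \<xi>) = \<xi>"
  by (simp_all flip: boundary_action_comp)

text \<open>The image of a class lies in one class; that it fills this class follows by applying the
  inverse isometry.\<close>

lemma boundary_action_boundary:
  assumes g: "g \<in> \<Gamma>" and \<xi>: "\<xi> \<in> gromov_boundary x\<^sub>0"
  shows "boundary_action g \<xi> \<in> gromov_boundary x\<^sub>0"
proof -
  obtain u where u: "u \<in> \<xi>" using boundary_nonempty[OF \<xi>] by blast
  have "(u, u) \<in> asymptotic" using u boundary_mem_iff[OF \<xi> u] by blast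
  from asymptotic_move[OF g this] obtain \<eta> where \<eta>: "\<eta> \<in> gromov_boundary x\<^sub>0" "g \<circ> u \<in> \<eta>"
    using boundary_class unfolding asymptotic_iff by blast
  have "boundary_action g \<xi> = \<eta>"
  proof (intro subset_antisym subsetI)
    fix w assume "w \<in> boundary_action g \<xi>"
    then obtain v where v: "v \<in> \<xi>" "w = g \<circ> v" by (auto simp: boundary_action_def)
    then show "w \<in> \<eta>"
      using asymptotic_move[OF g, of u v] boundary_mem_iff[OF \<xi> u] boundary_mem_iff[OF \<eta>] by blast
  next
    fix w assume w: "w \<in> \<eta>"
    have "(inverse_map g \<circ> (g \<circ> u), inverse_map g \<circ> w) \<in> asymptotic"
      using asymptotic_move[OF inv_mem[OF g]] boundary_mem_iff[OF \<eta>] w by blast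
    then have "inverse_map g \<circ> w \<in> \<xi>"
      using boundary_mem_iff[OF \<xi> u] g by (simp flip: comp_assoc)
    moreover have "w = g \<circ> (inverse_map g \<circ> w)" using g by (simp flip: comp_assoc)
    ultimately show "w \<in> boundary_action g \<xi>" unfolding boundary_action_def by blast
  qed
  then show ?thesis using \<eta> by simp
qed

lemma ep_move:
  assumes g: "g \<in> \<Gamma>" and \<xi>: "\<xi> \<in> gromov_boundary x\<^sub>0" and R: "ereal R \<le> ep (Inl x) (Inr \<xi>)"
  shows "ereal (R - K - nrm (g x\<^sub>0)) \<le> ep (Inl (g x)) (Inr (boundary_action g \<xi>))"
proof -
  obtain u where u: "u \<in> \<xi>" using boundary_nonempty[OF \<xi>] by blast
  have "joint_ge (R - 1 - 2 * D) (\<lambda>_. x) u" using \<xi> u by (intro ep_geD[OF R]) auto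
  then have "joint_ge (R - 1 - 2 * D - nrm (g x\<^sub>0)) (g \<circ> (\<lambda>_. x)) (g \<circ> u)" by (rule joint_ge_move[OF g])
  then have "joint_ge (R - K - nrm (g x\<^sub>0)) (\<lambda>_. g x) (g \<circ> u)"
    using D_nonneg by (auto elim!: joint_ge_mono simp: K_def comp_def)
  then show ?thesis using u by (intro ep_geI) (auto simp: boundary_action_def)
qed

section \<open>The limit set\<close>

lemma limit_set_iff:
  "\<xi> \<in> limit_set x\<^sub>0 H \<longleftrightarrow>
     \<xi> \<in> gromov_boundary x\<^sub>0 \<and> (\<forall>R. \<exists>h\<in>H. ereal R \<le> ep (Inl (h x\<^sub>0)) (Inr \<xi>))"
proof (cases "\<xi> \<in> gromov_boundary x\<^sub>0")
  case \<xi>: True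
  show ?thesis
  proof
    assume l: "\<xi> \<in> limit_set x\<^sub>0 H"
    have "\<exists>h\<in>H. ereal R \<le> ep (Inl (h x\<^sub>0)) (Inr \<xi>)" for R
    proof -
      obtain U where U: "openin (bordification_topology x\<^sub>0) U" "Inr \<xi> \<in> U"
          "\<forall>q\<in>U. ereal R \<le> ep q (Inr \<xi>)"
        using boundary_nhd[OF \<xi>] by blast
      then show ?thesis using l unfolding limit_set_def in_derived_set_of by blast
    qed
    then show "\<xi> \<in> gromov_boundary x\<^sub>0 \<and> (\<forall>R. \<exists>h\<in>H. ereal R \<le> ep (Inl (h x\<^sub>0)) (Inr \<xi>))"
      using \<xi> by blast
  next
    assume r: "\<xi> \<in> gromov_boundary x\<^sub>0 \<and> (\<forall>R. \<exists>h\<in>H. ereal R \<le> ep (Inl (h x\<^sub>0)) (Inr \<xi>))"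
    have "\<exists>y. y \<noteq> Inr \<xi> \<and> y \<in> (\<lambda>g. Inl (g x\<^sub>0)) ` H \<and> y \<in> U"
      if U: "Inr \<xi> \<in> U" "openin (bordification_topology x\<^sub>0) U" for U
    proof -
      obtain R where "\<forall>q\<in>bordification x\<^sub>0. ereal R \<le> ep q (Inr \<xi>) \<longrightarrow> q \<in> U"
        using openin_boundaryD[OF U(2,1)] by blast
      moreover obtain h where "h \<in> H" "ereal R \<le> ep (Inl (h x\<^sub>0)) (Inr \<xi>)" using r by blast
      ultimately show ?thesis by (intro exI[of _ "Inl (h x\<^sub>0)"]) auto
    qed
    then show "\<xi> \<in> limit_set x\<^sub>0 H" using \<xi> unfolding limit_set_def in_derived_set_of by auto
  qed
qed (simp add: limit_set_def)

lemma limit_set_boundary: "\<xi> \<in> limit_set x\<^sub>0 \<Gamma> \<Longrightarrow> \<xi> \<in> gromov_boundary x\<^sub>0"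
  by (simp add: limit_set_def)

lemma limit_set_invariant:
  assumes g: "g \<in> \<Gamma>" and \<xi>: "\<xi> \<in> limit_set x\<^sub>0 \<Gamma>"
  shows "boundary_action g \<xi> \<in> limit_set x\<^sub>0 \<Gamma>"
  unfolding limit_set_iff
proof (intro conjI allI)
  show "boundary_action g \<xi> \<in> gromov_boundary x\<^sub>0"
    using assms by (intro boundary_action_boundary limit_set_boundary)
  fix R
  obtain h where h: "h \<in> \<Gamma>" "ereal (R + K + nrm (g x\<^sub>0)) \<le> ep (Inl (h x\<^sub>0)) (Inr \<xi>)"
    using \<xi> unfolding limit_set_iff by blast
  have "ereal R \<le> ep (Inl ((g \<circ> h) x\<^sub>0)) (Inr (boundary_action g \<xi>))"
    using ep_move[OF g limit_set_boundary[OF \<xi>] h(2)] by simp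
  then show "\<exists>h\<in>\<Gamma>. ereal R \<le> ep (Inl (h x\<^sub>0)) (Inr (boundary_action g \<xi>))"
    using comp_mem[OF g h(1)] by blast
qed

section \<open>Parabolic points\<close>

lemma parabolic_point_boundary: "\<xi> \<in> parabolic_points x\<^sub>0 \<Gamma> \<Longrightarrow> \<xi> \<in> gromov_boundary x\<^sub>0"
  by (simp add: parabolic_points_def limit_set_boundary)

lemma parabolic_subgroup_fixed_point:
  assumes "parabolic_subgroup x\<^sub>0 \<Gamma> H"
  obtains \<xi> where "\<xi> \<in> gromov_boundary x\<^sub>0" "\<And>h. h \<in> H \<Longrightarrow> boundary_action h \<xi> = \<xi>"
    "\<And>\<zeta>. \<zeta> \<in> gromov_boundary x\<^sub>0 \<Longrightarrow> \<forall>h\<in>H. boundary_action h \<zeta> = \<zeta> \<Longrightarrow> \<zeta> = \<xi>"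
proof -
  have "\<exists>!\<xi>. \<xi> \<in> gromov_boundary x\<^sub>0 \<and> (\<forall>g\<in>H. boundary_action g \<xi> = \<xi>)"
    using assms by (simp add: parabolic_subgroup_def)
  then obtain \<xi> where "\<xi> \<in> gromov_boundary x\<^sub>0 \<and> (\<forall>g\<in>H. boundary_action g \<xi> = \<xi>)"
    and "\<forall>\<zeta>. \<zeta> \<in> gromov_boundary x\<^sub>0 \<and> (\<forall>g\<in>H. boundary_action g \<zeta> = \<zeta>) \<longrightarrow> \<zeta> = \<xi>"
    by (rule ex1E)
  then show thesis by (intro that[of \<xi>]) blast+
qed

lemma stabilizer_boundary_action:
  assumes g: "g \<in> \<Gamma>"
  shows "stabilizer \<Gamma> (boundary_action g \<xi>) = (\<lambda>h. g \<circ> h \<circ> inverse_map g) ` stabilizer \<Gamma> \<xi>"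
proof (intro subset_antisym subsetI)
  fix k assume k: "k \<in> stabilizer \<Gamma> (boundary_action g \<xi>)"
  define h where "h = inverse_map g \<circ> k \<circ> g"
  have "h \<in> stabilizer \<Gamma> \<xi>"
    using k g by (auto simp: stabilizer_def h_def boundary_action_comp boundary_action_inv intro!: comp_mem inv_mem)
  moreover have "k = g \<circ> h \<circ> inverse_map g" using g by (simp add: h_def fun_eq_iff)
  ultimately show "k \<in> (\<lambda>h. g \<circ> h \<circ> inverse_map g) ` stabilizer \<Gamma> \<xi>" by blast
next
  fix k assume "k \<in> (\<lambda>h. g \<circ> h \<circ> inverse_map g) ` stabilizer \<Gamma> \<xi>"
  then show "k \<in> stabilizer \<Gamma> (boundary_action g \<xi>)"
    using g by (auto simp: stabilizer_def boundary_action_comp boundary_action_inv intro!: comp_mem inv_mem)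
qed

lemma loxodromic_conjugate:
  assumes g: "g \<in> \<Gamma>" and l: "loxodromic (g \<circ> h \<circ> inverse_map g)"
  shows "loxodromic h"
proof -
  obtain \<tau> where \<tau>: "\<tau> > 0"
    "\<And>x. (\<lambda>n. dist x (((g \<circ> h \<circ> inverse_map g) ^^ n) x) / real n) \<longlonglongrightarrow> \<tau>"
    using l unfolding loxodromic_def by blast
  have "(\<lambda>n. dist x ((h ^^ n) x) / real n) \<longlonglongrightarrow> \<tau>" for x
    using \<tau>(2)[of "g x"] g by (simp add: funpow_conjugate dist_isometry)
  with \<tau>(1) show ?thesis unfolding loxodromic_def by blast
qed

text \<open>Needed so that \<Gamma> permutes the parabolic points. The unique fixed point is moved
  by g, and the stable translation length is a conjugation invariant.\<close>

lemma parabolic_subgroup_conjugate: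
  assumes g: "g \<in> \<Gamma>" and H: "parabolic_subgroup x\<^sub>0 \<Gamma> H"
  shows "parabolic_subgroup x\<^sub>0 \<Gamma> ((\<lambda>h. g \<circ> h \<circ> inverse_map g) ` H)" (is "parabolic_subgroup _ _ ?H'")
proof -
  have sub: "subgroup H (BijGroup UNIV)" "H \<subseteq> \<Gamma>" using H by (auto simp: parabolic_subgroup_def)
  note sub' = sub(1)[unfolded subgroup_BijGroup_UNIV]
  have "?H' \<subseteq> \<Gamma>" using sub(2) g by (auto intro!: comp_mem inv_mem)
  moreover have "subgroup ?H' (BijGroup UNIV)"
    unfolding subgroup_BijGroup_UNIV
  proof (intro conjI ballI)
    fix k assume k: "k \<in> ?H'"
    then show "bij k" using \<open>?H' \<subseteq> \<Gamma>\<close> mem_bij by blast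
    obtain h where h: "h \<in> H" "k = g \<circ> h \<circ> inverse_map g" using k by blast
    then have h\<Gamma>: "h \<in> \<Gamma>" using sub by blast
    have "inverse_map k = g \<circ> inverse_map h \<circ> inverse_map g"
      by (rule inv_unique_comp) (use h h\<Gamma> g in \<open>auto simp: fun_eq_iff\<close>)
    then show "inverse_map k \<in> ?H'" using sub' h by blast
    fix k' assume "k' \<in> ?H'"
    then obtain h' where h': "h' \<in> H" "k' = g \<circ> h' \<circ> inverse_map g" by blast
    then have "k \<circ> k' = g \<circ> (h \<circ> h') \<circ> inverse_map g" using g h by (simp add: fun_eq_iff)
    then show "k \<circ> k' \<in> ?H'" using sub' h h' by blast
  next
    have "id = g \<circ> id \<circ> inverse_map g" using g by simp
    then show "id \<in> ?H'" using sub' by blast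
  qed
  moreover have "infinite ?H'"
  proof -
    have "inj_on (\<lambda>h. g \<circ> h \<circ> inverse_map g) H"
    proof (rule inj_onI)
      fix h k assume e: "g \<circ> h \<circ> inverse_map g = g \<circ> k \<circ> inverse_map g"
      have "h x = k x" for x
      proof -
        have "g (h x) = g (k x)" using fun_cong[OF e, of "g x"] g by simp
        then show ?thesis using mem_bij[OF g] by (simp add: bij_is_inj inj_eq)
      qed
      then show "h = k" by blast
    qed
    then show ?thesis using H finite_image_iff by (auto simp: parabolic_subgroup_def)
  qed
  moreover have "\<exists>!\<zeta>. \<zeta> \<in> gromov_boundary x\<^sub>0 \<and> (\<forall>k\<in>?H'. boundary_action k \<zeta> = \<zeta>)"
  proof -
    obtain \<xi> where \<xi>: "\<xi> \<in> gromov_boundary x\<^sub>0" "\<And>h. h \<in> H \<Longrightarrow> boundary_action h \<xi> = \<xi>"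
      and u: "\<And>\<zeta>. \<zeta> \<in> gromov_boundary x\<^sub>0 \<Longrightarrow> \<forall>h\<in>H. boundary_action h \<zeta> = \<zeta> \<Longrightarrow> \<zeta> = \<xi>"
      using parabolic_subgroup_fixed_point[OF H] by metis
    show ?thesis
    proof (rule ex1I[of _ "boundary_action g \<xi>"])
      show "boundary_action g \<xi> \<in> gromov_boundary x\<^sub>0 \<and>
          (\<forall>k\<in>?H'. boundary_action k (boundary_action g \<xi>) = boundary_action g \<xi>)"
        using \<xi> g by (auto simp: boundary_action_comp boundary_action_inv intro: boundary_action_boundary)
      fix \<zeta> assume \<zeta>: "\<zeta> \<in> gromov_boundary x\<^sub>0 \<and> (\<forall>k\<in>?H'. boundary_action k \<zeta> = \<zeta>)"
      have "boundary_action h (boundary_action (inverse_map g) \<zeta>) = boundary_action (inverse_map g) \<zeta>"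
        if "h \<in> H" for h
      proof -
        have "boundary_action (g \<circ> h \<circ> inverse_map g) \<zeta> = \<zeta>" using \<zeta> that by blast
        then show ?thesis using g by (metis boundary_action_comp boundary_action_inv(1))
      qed
      then have "boundary_action (inverse_map g) \<zeta> = \<xi>"
        using \<zeta> g by (intro u boundary_action_boundary inv_mem) auto
      then show "\<zeta> = boundary_action g \<xi>" using g boundary_action_inv by metis
    qed
  qed
  moreover have "\<not> (\<exists>k\<in>?H'. loxodromic k)"
    using H loxodromic_conjugate[OF g] by (auto simp: parabolic_subgroup_def)
  ultimately show ?thesis unfolding parabolic_subgroup_def by simp
qed

lemma parabolic_points_invariant:
  assumes "g \<in> \<Gamma>" "\<xi> \<in> parabolic_points x\<^sub>0 \<Gamma>"
  shows "boundary_action g \<xi> \<in> parabolic_points x\<^sub>0 \<Gamma>"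
  using assms limit_set_invariant[of g \<xi>] parabolic_subgroup_conjugate[of g "stabilizer \<Gamma> \<xi>"]
  by (auto simp: parabolic_points_def stabilizer_boundary_action)

text \<open>Links the growth hypothesis on maximal parabolic subgroups with the stabilizers counted
  in the shadow lemma. A fixed point of a larger parabolic subgroup is fixed by the stabilizer too,
  so by uniqueness it is \<xi>.\<close>

lemma maximal_parabolic_stabilizer:
  assumes \<xi>: "\<xi> \<in> parabolic_points x\<^sub>0 \<Gamma>"
  shows "maximal_parabolic_subgroup x\<^sub>0 \<Gamma> (stabilizer \<Gamma> \<xi>)"
  unfolding maximal_parabolic_subgroup_def
proof (intro conjI allI impI)
  show p: "parabolic_subgroup x\<^sub>0 \<Gamma> (stabilizer \<Gamma> \<xi>)" using \<xi> by (simp add: parabolic_points_def)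
  fix L assume L: "parabolic_subgroup x\<^sub>0 \<Gamma> L \<and> stabilizer \<Gamma> \<xi> \<subseteq> L"
  then have "L \<subseteq> \<Gamma>" by (simp add: parabolic_subgroup_def)
  from L obtain \<zeta> where \<zeta>: "\<zeta> \<in> gromov_boundary x\<^sub>0" "\<And>g. g \<in> L \<Longrightarrow> boundary_action g \<zeta> = \<zeta>"
    using parabolic_subgroup_fixed_point by metis
  obtain \<xi>' where u: "\<And>\<zeta>. \<zeta> \<in> gromov_boundary x\<^sub>0 \<Longrightarrow>
      \<forall>g\<in>stabilizer \<Gamma> \<xi>. boundary_action g \<zeta> = \<zeta> \<Longrightarrow> \<zeta> = \<xi>'"
    using parabolic_subgroup_fixed_point[OF p] by metis
  have "\<xi> = \<xi>'" using parabolic_point_boundary[OF \<xi>] by (intro u) (auto simp: stabilizer_def)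
  moreover have "\<zeta> = \<xi>'" using \<zeta> L by (intro u) auto
  ultimately have "L \<subseteq> stabilizer \<Gamma> \<xi>" using \<zeta> \<open>L \<subseteq> \<Gamma>\<close> by (auto simp: stabilizer_def)
  then show "L = stabilizer \<Gamma> \<xi>" using L by blast
qed

end

section \<open>Parabolic elements in a cocompact region\<close>

text \<open>\<open>loxodromic\<close> demands convergence of the quotients, so a linear lower bound
  on displacements must be supplemented by the existence of the limit.\<close>

lemma fekete:
  fixes a :: "nat \<Rightarrow> real"
  assumes sub: "\<And>m n. a (m + n) \<le> a m + a n" and nonneg: "\<And>n. 0 \<le> a n"
  shows "(\<lambda>n. a n / real n) \<longlonglongrightarrow> (INF n\<in>{1..}. a n / real n)"
proof -
  define L where "L = (INF n\<in>{1..}. a n / real n)"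
  have bdd: "bdd_below ((\<lambda>n. a n / real n) ` {1..})"
    by (rule bdd_belowI[of _ 0]) (auto simp: nonneg)
  have L_le: "L \<le> a n / real n" if "n \<ge> 1" for n
    unfolding L_def using that by (intro cINF_lower bdd) auto
  have mult: "a (q * k + s) \<le> real q * a k + a s" for q k s
  proof (induction q)
    case (Suc q)
    then show ?case using sub[of k "q * k + s"] by (simp add: algebra_simps)
  qed simp
  show ?thesis
    unfolding L_def[symmetric]
  proof (rule order_tendstoI)
    fix y assume "y < L"
    then show "eventually (\<lambda>n. y < a n / real n) sequentially"
      using L_le unfolding eventually_sequentially by (meson less_le_trans)
  next
    fix y assume "L < y"
    then obtain k where k: "k \<ge> 1" "a k / real k < y"
      unfolding L_def using cINF_less_iff[OF _ bdd] by auto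
    \<comment> \<open>Bounds the contribution of the remainder n mod k, which vanishes after
      division by n.\<close>
    define M where "M = Max (a ` {..<k})"
    have M: "a s \<le> M" if "s < k" for s unfolding M_def using that by (intro Max_ge) auto
    have "(\<lambda>n. a k / real k + M / real n) \<longlonglongrightarrow> a k / real k + 0"
      by (intro tendsto_intros lim_const_over_n)
    then have "eventually (\<lambda>n. a k / real k + M / real n < y) sequentially"
      using k(2) by (intro order_tendstoD(2)) auto
    then show "eventually (\<lambda>n. a n / real n < y) sequentially"
      using eventually_ge_at_top[of 1]
    proof eventually_elim
      case (elim n)
      have "a n \<le> real (n div k) * a k + a (n mod k)" using mult[of "n div k" k "n mod k"] by simp
      also have "\<dots> \<le> real n / real k * a k + M"
        using k M nonneg[of k] of_nat_div_le_of_nat[of n k, where ?'a = real] by (intro add_mono mult_right_mono) auto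
      finally have "a n / real n \<le> (real n / real k * a k + M) / real n"
        using elim by (intro divide_right_mono) auto
      also have "\<dots> = a k / real k + M / real n" using elim k by (simp add: field_simps)
      finally show ?case using elim by linarith
    qed
  qed
qed

context gromov_hyperbolic_space
begin

lemma eventually_approach_iff:
  assumes \<xi>: "\<xi> \<in> gromov_boundary x\<^sub>0"
  shows "eventually Q (approach \<xi>) \<longleftrightarrow> (\<exists>R. \<forall>z. ereal R \<le> ep (Inl z) (Inr \<xi>) \<longrightarrow> Q z)"
proof
  assume "eventually Q (approach \<xi>)"
  then obtain S where "eventually S (nhdsin (bordification_topology x\<^sub>0) (Inr \<xi>))" "\<And>z. S (Inl z) \<Longrightarrow> Q z"
    unfolding approach_def eventually_filtercomap by blast
  then obtain U where U: "openin (bordification_topology x\<^sub>0) U" "Inr \<xi> \<in> U" "\<And>z. Inl z \<in> U \<Longrightarrow> Q z"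
    using \<xi> unfolding eventually_nhdsin by auto
  then show "\<exists>R. \<forall>z. ereal R \<le> ep (Inl z) (Inr \<xi>) \<longrightarrow> Q z"
    using openin_boundaryD[OF U(1,2)] by (meson Inl_in_bordification)
next
  assume "\<exists>R. \<forall>z. ereal R \<le> ep (Inl z) (Inr \<xi>) \<longrightarrow> Q z"
  then obtain R where R: "\<And>z. ereal R \<le> ep (Inl z) (Inr \<xi>) \<Longrightarrow> Q z" by blast
  show "eventually Q (approach \<xi>)" using eventually_approach[OF \<xi>, of R] by (rule eventually_mono) (rule R)
qed

lemma eventually_ray_approach:
  assumes "ray \<gamma> \<xi>" "eventually Q (approach \<xi>)"
  shows "eventually (\<lambda>t. Q (\<gamma> t)) at_top"
proof -
  obtain R where R: "\<And>z. ereal R \<le> ep (Inl z) (Inr \<xi>) \<Longrightarrow> Q z"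
    using assms eventually_approach_iff[OF ray_boundary] by blast
  have "eventually (\<lambda>t. ereal R \<le> ep (Inl (\<gamma> t)) (Inr \<xi>)) at_top"
    using assms(1) by (simp add: ray_def converges_to_boundary_iff)
  then show ?thesis by (rule eventually_mono) (rule R)
qed

text \<open>Once (z|z') exceeds |y|, which bounds (y|z) and (y|z'), hyperbolicity makes these two
  products agree up to D. So d(y,z) - |z| is constant near \<xi> up to 2D, and its value at a single
  far point can serve as b y.\<close>

lemma coarse_busemann:
  assumes \<xi>: "\<xi> \<in> gromov_boundary x\<^sub>0"
  shows "\<exists>b. \<forall>y. \<bar>b y\<bar> \<le> nrm y \<and>
    (\<forall>\<^sub>F z in approach \<xi>. \<bar>dist y z - nrm z - b y\<bar> \<le> 2 * D)"
proof -
  have "\<exists>b. \<bar>b\<bar> \<le> nrm y \<and> (\<forall>\<^sub>F z in approach \<xi>. \<bar>dist y z - nrm z - b\<bar> \<le> 2 * D)" for y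
  proof -
    define R where "R = nrm y + 3 * K"
    have *: "nrm y \<le> gp z z'" if z: "ereal R \<le> ep (Inl z) (Inr \<xi>)" "ereal R \<le> ep (Inl z') (Inr \<xi>)" for z z'
    proof -
      have "ereal (R - K) \<le> ep (Inr \<xi>) (Inl z')" using ep_commute[OF z(2)] \<xi> by simp
      then have "ereal (R - K - K) \<le> ep (Inl z) (Inl z')"
        using z(1) \<xi> K_ge by (rule_tac ep_trans'[of R _ "Inr \<xi>" "R - K"]) auto
      from ep_points_D[OF this] show ?thesis by (simp add: R_def)
    qed
    obtain z\<^sub>0 where z\<^sub>0: "ereal R \<le> ep (Inl z\<^sub>0) (Inr \<xi>)"
      using eventually_happens[OF eventually_approach[OF \<xi>]] approach_neq_bot[OF \<xi>]
      by (auto simp: trivial_limit_def)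
    define b where "b = dist y z\<^sub>0 - nrm z\<^sub>0"
    have "\<bar>b\<bar> \<le> nrm y" unfolding b_def
      using dist_triangle[of y z\<^sub>0 x\<^sub>0] dist_triangle[of z\<^sub>0 x\<^sub>0 y] by (auto simp: dist_commute abs_le_iff)
    moreover have "\<forall>\<^sub>F z in approach \<xi>. \<bar>dist y z - nrm z - b\<bar> \<le> 2 * D"
      using eventually_approach[OF \<xi>, of R]
    proof eventually_elim
      case (elim z)
      have "gp y z\<^sub>0 - D \<le> gp y z"
        using *[OF z\<^sub>0 elim] gp_le_left[of y z\<^sub>0] by (intro hyperbolic_ge[of _ _ z\<^sub>0]) auto
      moreover have "gp y z - D \<le> gp y z\<^sub>0"
        using *[OF elim z\<^sub>0] gp_le_left[of y z] by (intro hyperbolic_ge[of _ _ z]) auto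
      ultimately show ?case using dist_gp[of y z] dist_gp[of y z\<^sub>0] unfolding b_def by linarith
    qed
    ultimately show ?thesis by blast
  qed
  then show ?thesis by metis
qed

end

context hyperbolic_group_action
begin

section \<open>Displacement of isometries fixing a boundary point\<close>

lemma funpow_mem: "h \<in> \<Gamma> \<Longrightarrow> h ^^ n \<in> \<Gamma>"
  by (induction n) (auto intro: id_mem comp_mem)

lemma loxodromic_if_linear_growth:
  assumes h: "h \<in> \<Gamma>" and c: "0 < c" "\<And>n. c * real n \<le> nrm ((h ^^ n) x\<^sub>0)"
  shows "loxodromic h"
proof -
  define a where "a n = dist x\<^sub>0 ((h ^^ n) x\<^sub>0)" for n
  define L where "L = (INF n\<in>{1..}. a n / real n)"
  have "a (m + n) \<le> a m + a n" for m n
    using dist_triangle[of x\<^sub>0 "(h ^^ (m + n)) x\<^sub>0" "(h ^^ m) x\<^sub>0"]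
      dist_isometry[OF funpow_mem[OF h, of m], of x\<^sub>0 "(h ^^ n) x\<^sub>0"]
    by (simp add: a_def funpow_add)
  then have lim: "(\<lambda>n. a n / real n) \<longlonglongrightarrow> L"
    unfolding L_def by (intro fekete) (auto simp: a_def)
  have "c \<le> L" unfolding L_def
  proof (rule cINF_greatest)
    fix n :: nat assume "n \<in> {1..}"
    then show "c \<le> a n / real n" using c(2)[of n] by (simp add: a_def dist_commute field_simps)
  qed simp
  have "(\<lambda>n. dist x ((h ^^ n) x) / real n) \<longlonglongrightarrow> L" for x
  proof (rule Lim_transform[OF lim])
    have "\<bar>dist x ((h ^^ n) x) - a n\<bar> \<le> 2 * nrm x" for n
      using dist_triangle[of x "(h ^^ n) x" x\<^sub>0] dist_triangle[of x\<^sub>0 "(h ^^ n) x" "(h ^^ n) x\<^sub>0"]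
        dist_triangle[of x\<^sub>0 "(h ^^ n) x\<^sub>0" x] dist_triangle[of x "(h ^^ n) x\<^sub>0" "(h ^^ n) x"]
        dist_isometry[OF funpow_mem[OF h, of n], of x x\<^sub>0]
      unfolding a_def by (auto simp: dist_commute abs_le_iff)
    then have "norm (dist x ((h ^^ n) x) / real n - a n / real n) \<le> 2 * nrm x / real n" for n
      unfolding diff_divide_distrib[symmetric] real_norm_def abs_divide
      by (simp add: divide_right_mono)
    then show "(\<lambda>n. dist x ((h ^^ n) x) / real n - a n / real n) \<longlonglongrightarrow> 0"
      by (intro Lim_null_comparison[OF always_eventually lim_const_over_n[of "2 * nrm x"]]) blast
  qed
  then show ?thesis using c(1) \<open>c \<le> L\<close> unfolding loxodromic_def by (meson less_le_trans)
qed

lemma eventually_approach_move: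
  assumes g: "g \<in> \<Gamma>" and \<xi>: "\<xi> \<in> gromov_boundary x\<^sub>0" "boundary_action g \<xi> = \<xi>"
    and Q: "eventually Q (approach \<xi>)"
  shows "eventually (\<lambda>z. Q (g z)) (approach \<xi>)"
proof -
  obtain R where R: "\<And>z. ereal R \<le> ep (Inl z) (Inr \<xi>) \<Longrightarrow> Q z"
    using Q eventually_approach_iff[OF \<xi>(1)] by blast
  show ?thesis
    using eventually_approach[OF \<xi>(1), of "R + K + nrm (g x\<^sub>0)"]
  proof eventually_elim
    case (elim z)
    show ?case using ep_move[OF g \<xi>(1) elim] \<xi>(2) by (intro R) simp
  qed
qed

lemma nrm_move: "g \<in> \<Gamma> \<Longrightarrow> nrm (g z) = dist (inverse_map g x\<^sub>0) z"
  using dist_isometry[of "inverse_map g" "g z" x\<^sub>0] inv_mem[of g] by (simp add: dist_commute)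

text \<open>The coarse Busemann function at a fixed point is a quasimorphism, and it is unbounded on the
  powers of an element on which it exceeds the defect.\<close>
lemma busemann_bounded_if_not_loxodromic:
  assumes \<xi>: "\<xi> \<in> gromov_boundary x\<^sub>0"
    and b: "\<And>y. \<bar>b y\<bar> \<le> nrm y" "\<And>y. \<forall>\<^sub>F z in approach \<xi>. \<bar>dist y z - nrm z - b y\<bar> \<le> 2 * D"
    and h: "h \<in> \<Gamma>" "boundary_action h \<xi> = \<xi>" and nl: "\<not> loxodromic h"
  shows "\<bar>b (inverse_map h x\<^sub>0)\<bar> \<le> 6 * D"
proof -
  define \<phi> where "\<phi> g = b (inverse_map g x\<^sub>0)" for g
  \<comment> \<open>One error 2D for each of the three values of b, read off at a common z near
    \<xi>. As g fixes \<xi>, the point g z is near \<xi> as well, and the approximation for f is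
    used there.\<close>
  have quasi: "\<bar>\<phi> (f \<circ> g) - \<phi> f - \<phi> g\<bar> \<le> 6 * D"
    if fg: "f \<in> \<Gamma>" "g \<in> \<Gamma>" "boundary_action g \<xi> = \<xi>" for f g
  proof -
    have "eventually (\<lambda>_. \<bar>\<phi> (f \<circ> g) - \<phi> f - \<phi> g\<bar> \<le> 6 * D) (approach \<xi>)"
      using b(2)[of "inverse_map (f \<circ> g) x\<^sub>0"] b(2)[of "inverse_map g x\<^sub>0"]
        eventually_approach_move[OF fg(2) \<xi> fg(3) b(2)[of "inverse_map f x\<^sub>0"]]
    proof eventually_elim
      case (elim z)
      have "dist (inverse_map (f \<circ> g) x\<^sub>0) z = dist (inverse_map f x\<^sub>0) (g z)"
        using nrm_move[OF comp_mem[OF fg(1,2)], of z] nrm_move[OF fg(1), of "g z"] by simp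
      then show ?case using elim nrm_move[OF fg(2), of z] unfolding \<phi>_def by linarith
    qed
    then show ?thesis using approach_neq_bot[OF \<xi>] by simp
  qed
  have fixed: "boundary_action (h ^^ n) \<xi> = \<xi>" for n
    by (induction n) (simp_all only: funpow.simps boundary_action_id boundary_action_comp h)
  have pow: "\<bar>\<phi> (h ^^ n) - real n * \<phi> h\<bar> \<le> real n * (6 * D)" for n
  proof (induction n)
    case 0
    have "inverse_map id x\<^sub>0 = x\<^sub>0" using inv_left[OF id_mem, of x\<^sub>0] by simp
    then have "\<phi> id = 0" using b(1)[of x\<^sub>0] by (simp add: \<phi>_def)
    then have "\<phi> (h ^^ 0) = 0" by (simp only: funpow.simps)
    then show ?case by (simp only: of_nat_0 mult_zero_left diff_0_right abs_zero order_refl)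
  next
    case (Suc n)
    have "\<bar>\<phi> (h ^^ Suc n) - \<phi> h - \<phi> (h ^^ n)\<bar> \<le> 6 * D"
      using quasi[OF h(1) funpow_mem[OF h(1), of n] fixed] unfolding funpow.simps by linarith
    then have "\<bar>\<phi> (h ^^ Suc n) - (real n * \<phi> h + \<phi> h)\<bar> \<le> real n * (6 * D) + 6 * D"
      using Suc.IH by linarith
    moreover have "real (Suc n) * c = real n * c + c" for c by (simp add: algebra_simps)
    ultimately show ?case by (simp only:)
  qed
  \<comment> \<open>If |\<phi> h| exceeded 6D, this would be linear growth and h would be
    loxodromic.\<close>
  have "(\<bar>\<phi> h\<bar> - 6 * D) * real n \<le> nrm ((h ^^ n) x\<^sub>0)" for n
  proof -
    have "real n * \<bar>\<phi> h\<bar> = \<bar>real n * \<phi> h\<bar>" by (simp add: abs_mult)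
    also have "\<dots> \<le> real n * (6 * D) + \<bar>\<phi> (h ^^ n)\<bar>" using pow[of n] by linarith
    also have "\<bar>\<phi> (h ^^ n)\<bar> \<le> nrm ((h ^^ n) x\<^sub>0)"
      using b(1)[of "inverse_map (h ^^ n) x\<^sub>0"] nrm_inv[OF funpow_mem[OF h(1)]] by (simp add: \<phi>_def)
    finally show ?thesis by (simp add: algebra_simps)
  qed
  then show ?thesis
    using loxodromic_if_linear_growth[OF h(1), of "\<bar>\<phi> h\<bar> - 6 * D"] nl unfolding \<phi>_def
    by (meson not_le diff_gt_0_iff_gt)
qed

text \<open>Far out, h changes the distance to the basepoint along the ray by at most 8D (6D for its
  Busemann value, 2D for the approximation), and the image ray has the same endpoint, so both points
  have product about t with \<xi>. Only the time from which the bound holds depends on h, not the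
  bound.\<close>

lemma ray_displacement:
  assumes \<gamma>: "ray \<gamma> \<xi>" and h: "h \<in> \<Gamma>" "boundary_action h \<xi> = \<xi>" "\<not> loxodromic h"
  shows "eventually (\<lambda>t. dist (\<gamma> t) (h (\<gamma> t)) \<le> 32 * K) at_top"
proof -
  have \<xi>: "\<xi> \<in> gromov_boundary x\<^sub>0" using \<gamma> by (rule ray_boundary)
  obtain b where b: "\<And>y. \<bar>b y\<bar> \<le> nrm y" "\<And>y. \<forall>\<^sub>F z in approach \<xi>. \<bar>dist y z - nrm z - b y\<bar> \<le> 2 * D"
    using coarse_busemann[OF \<xi>] by blast
  have "eventually (\<lambda>t. \<bar>nrm (h (\<gamma> t)) - t\<bar> \<le> 8 * D \<and> 0 \<le> t) at_top"
    using eventually_ray_approach[OF \<gamma> b(2)[of "inverse_map h x\<^sub>0"]] eventually_ge_at_top[of 0]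
  proof eventually_elim
    case (elim t)
    then show ?case
      using busemann_bounded_if_not_loxodromic[OF \<xi> b h] ray_nrm[OF \<gamma>, of t] nrm_move[OF h(1), of "\<gamma> t"]
      by linarith
  qed
  then obtain T where T: "\<And>t. t \<ge> T \<Longrightarrow> \<bar>nrm (h (\<gamma> t)) - t\<bar> \<le> 8 * D \<and> 0 \<le> t"
    unfolding eventually_at_top_linorder by blast
  have "dist (\<gamma> t) (h (\<gamma> t)) \<le> 32 * K" if t: "t \<ge> T" for t
  proof -
    have t0: "0 \<le> t" using T t by blast
    \<comment> \<open>Chosen so that the losses K in \<open>ray_ep\<close> and K + |h
      \<open>x\<^sub>0\<close>| in \<open>ep_move\<close> leave exactly t.\<close>
    define s where "s = t + 2 * K + nrm (h x\<^sub>0)"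
    have s: "s \<ge> t" using K_ge by (simp add: s_def)
    have "dist (h (\<gamma> t)) (h (\<gamma> s)) = s - t"
      using \<gamma> dist_isometry[OF h(1)] s t0 by (simp add: ray_def geodesic_on_def)
    then have "t - 8 * D \<le> gp (h (\<gamma> t)) (h (\<gamma> s))"
      using T[OF t] T[of s] s t dist_gp[of "h (\<gamma> t)" "h (\<gamma> s)"] by linarith
    moreover have "ereal t \<le> ep (Inl (h (\<gamma> s))) (Inr \<xi>)"
      using ep_move[OF h(1) \<xi> ray_ep[OF \<gamma>, of s]] s t0 h(2) by (simp add: s_def)
    ultimately have "ereal (t - 8 * D - K) \<le> ep (Inl (h (\<gamma> t))) (Inr \<xi>)"
      using \<xi> D_nonneg
      by (rule_tac ep_trans'[of "t - 8 * D" _ "Inl (h (\<gamma> s))" t]) (auto intro: ep_points)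
    from ep_commute[OF this] have "ereal (t - 8 * D - K - K) \<le> ep (Inr \<xi>) (Inl (h (\<gamma> t)))"
      using \<xi> by simp
    then have "ereal (t - 8 * D - K - K - K) \<le> ep (Inl (\<gamma> t)) (Inl (h (\<gamma> t)))"
      using \<xi> ray_ep[OF \<gamma> t0] D_nonneg K_ge
      by (rule_tac ep_trans'[of "t - K" _ "Inr \<xi>" "t - 8 * D - K - K"]) auto
    from ep_points_D[OF this] have "t - 8 * D - 4 * K \<le> gp (\<gamma> t) (h (\<gamma> t))" by simp
    then show ?thesis
      using dist_gp[of "\<gamma> t" "h (\<gamma> t)"] ray_nrm[OF \<gamma> t0] T[OF t] K_ge by linarith
  qed
  then show ?thesis unfolding eventually_at_top_linorder by blast
qed

text \<open>Proper discontinuity makes the orbit of H unbounded, so it accumulates at some \<eta>.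
  Commutation gives h (w x) = w (h x), which stays at distance |h x| from w x for the basepoint x;
  hence h maps a sequence converging to \<eta> to another one.\<close>

lemma abelian_subgroup_fixed_limit_point:
  assumes H: "H \<subseteq> \<Gamma>" "infinite H" and comm: "\<And>g h. g \<in> H \<Longrightarrow> h \<in> H \<Longrightarrow> g \<circ> h = h \<circ> g"
  shows "\<exists>\<eta>\<in>limit_set x\<^sub>0 \<Gamma>. \<forall>h\<in>H. boundary_action h \<eta> = \<eta>"
proof -
  have "\<exists>h\<in>H. real n \<le> nrm (h x\<^sub>0)" for n :: nat
  proof (rule ccontr)
    assume "\<not> ?thesis"
    then have "H \<subseteq> {g \<in> \<Gamma>. dist x\<^sub>0 (g x\<^sub>0) \<le> real n}" using H by (force simp: dist_commute)
    then show False using H finite_orbit_ball rev_finite_subset by blast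
  qed
  then obtain f where f: "\<And>n. f n \<in> H" "\<And>n :: nat. real n \<le> nrm (f n x\<^sub>0)" by metis
  have "filterlim (\<lambda>n. nrm (f n x\<^sub>0)) at_top sequentially"
    using filterlim_at_top_mono[OF filterlim_real_sequentially] f(2) by (auto intro: always_eventually)
  then obtain \<gamma> where "geodesic_on {0..} \<gamma>" "\<gamma> 0 = x\<^sub>0"
    and \<gamma>': "\<And>t. t \<ge> 0 \<Longrightarrow> \<exists>\<^sub>F n in sequentially. t - 1 \<le> gp (\<gamma> t) (f n x\<^sub>0)"
    using ray_of_sequence[of "\<lambda>n. f n x\<^sub>0"] by blast
  then obtain \<eta> where \<gamma>: "ray \<gamma> \<eta>" using geodesic_ray_endpoint by blast
  have \<eta>: "\<eta> \<in> gromov_boundary x\<^sub>0" using \<gamma> by (rule ray_boundary)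
  have "\<exists>h\<in>H. ereal (real k - 2 * K) \<le> ep (Inl (h x\<^sub>0)) (Inr \<eta>)" for k :: nat
  proof -
    obtain n where "real k - 1 \<le> gp (\<gamma> k) (f n x\<^sub>0)" using frequently_ex[OF \<gamma>'[of "real k"]] by auto
    then have "ereal (real k - K) \<le> ep (Inl (f n x\<^sub>0)) (Inl (\<gamma> k))"
      using K_ge by (intro ep_points) (simp add: gp_commute)
    then have "ereal (real k - K - K) \<le> ep (Inl (f n x\<^sub>0)) (Inr \<eta>)"
      using ray_ep[OF \<gamma>, of "real k"] \<eta> by (rule_tac ep_trans'[of "real k - K" _ "Inl (\<gamma> k)" "real k - K"]) auto
    then show ?thesis using f(1)[of n] by (intro bexI[of _ "f n"]) (auto simp: algebra_simps)
  qed
  then obtain w where w: "\<And>k. w k \<in> H" "\<And>k. ereal (real k - 2 * K) \<le> ep (Inl (w k x\<^sub>0)) (Inr \<eta>)"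
    by metis
  have arch: "\<exists>N. \<forall>k\<ge>N. R \<le> real k - c" for R c :: real
  proof -
    obtain N :: nat where N: "R + c \<le> real N" using real_arch_simple by blast
    have "R \<le> real k - c" if "N \<le> k" for k
    proof -
      have "real N \<le> real k" using that by simp
      then show ?thesis using N by linarith
    qed
    then show ?thesis by blast
  qed
  have "\<exists>h\<in>\<Gamma>. ereal R \<le> ep (Inl (h x\<^sub>0)) (Inr \<eta>)" for R
    using arch[of R "2 * K"] w H ep_mono by blast
  then have "\<eta> \<in> limit_set x\<^sub>0 \<Gamma>" using \<eta> unfolding limit_set_iff by blast
  moreover have "boundary_action h \<eta> = \<eta>" if h: "h \<in> H" for h
  proof -
    have h\<Gamma>: "h \<in> \<Gamma>" using H h by blast
    have "(\<lambda>k. w k x\<^sub>0) \<in> \<eta>"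
      using arch[of _ "2 * K"] w(2) ep_mono by (intro boundary_mem_if_ep[OF \<eta>]) blast
    then have "h \<circ> (\<lambda>k. w k x\<^sub>0) \<in> boundary_action h \<eta>" by (simp add: boundary_action_def)
    moreover have "h \<circ> (\<lambda>k. w k x\<^sub>0) \<in> \<eta>"
    proof (rule boundary_mem_if_ep[OF \<eta>])
      fix R
      have "ereal (real k - (nrm (h x\<^sub>0) + 3 * K)) \<le> ep (Inl ((h \<circ> (\<lambda>k. w k x\<^sub>0)) k)) (Inr \<eta>)" for k
      proof -
        have "h (w k x\<^sub>0) = w k (h x\<^sub>0)" using fun_cong[OF comm[OF h w(1)[of k]], of x\<^sub>0] by simp
        then have "dist (h (w k x\<^sub>0)) (w k x\<^sub>0) = nrm (h x\<^sub>0)"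
          using dist_isometry[of "w k"] w(1) H by auto
        then show ?thesis using ep_lipschitz[OF w(2)[of k], of "h (w k x\<^sub>0)"] \<eta> by (simp add: algebra_simps)
      qed
      then show "\<exists>N. \<forall>k\<ge>N. ereal R \<le> ep (Inl ((h \<circ> (\<lambda>k. w k x\<^sub>0)) k)) (Inr \<eta>)"
        using arch[of R "nrm (h x\<^sub>0) + 3 * K"] ep_mono by blast
    qed
    ultimately show ?thesis using boundary_eqI boundary_action_boundary[OF h\<Gamma> \<eta>] \<eta> by blast
  qed
  ultimately show ?thesis by blast
qed

lemma cyclic_group_commutes:
  assumes "f \<in> generate (BijGroup UNIV) {g}" "h \<in> generate (BijGroup UNIV) {g}" "g \<in> \<Gamma>"
  shows "f \<circ> h = h \<circ> f"
proof -
  interpret G: group "BijGroup (UNIV :: 'a set)" by (rule group_BijGroup)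
  have g: "g \<in> carrier (BijGroup UNIV)" using mem_bij[OF assms(3)] by (simp add: BijGroup_def Bij_def)
  obtain i j :: int where ij: "f = g [^]\<^bsub>BijGroup UNIV\<^esub> i" "h = g [^]\<^bsub>BijGroup UNIV\<^esub> j"
    using assms(1,2) unfolding G.generate_pow[OF g] by blast
  have "f \<otimes>\<^bsub>BijGroup UNIV\<^esub> h = h \<otimes>\<^bsub>BijGroup UNIV\<^esub> f"
    unfolding ij G.int_pow_mult[OF g, symmetric] by (simp add: add.commute)
  moreover have "f \<in> carrier (BijGroup UNIV)" "h \<in> carrier (BijGroup UNIV)"
    using ij g by auto
  ultimately show ?thesis by (simp add: BijGroup_def Bij_def compose_def o_def restrict_def)
qed

text \<open>Near a ray staying close to the orbit of the basepoint, arbitrarily many elements with small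
  displacement would have to be conjugated into a fixed finite set.\<close>
lemma parabolic_ray_leaves_orbit:
  assumes g: "parabolic_element x\<^sub>0 \<Gamma> g"
  shows "\<exists>\<xi>\<in>limit_set x\<^sub>0 \<Gamma>. \<exists>\<gamma> t. ray \<gamma> \<xi> \<and> 0 \<le> t \<and> (\<forall>f\<in>\<Gamma>. R < dist (\<gamma> t) (f x\<^sub>0))"
proof -
  define H where "H = generate (BijGroup UNIV) {g}"
  have H: "H \<subseteq> \<Gamma>" "infinite H" "\<And>h. h \<in> H \<Longrightarrow> \<not> loxodromic h" and g\<Gamma>: "g \<in> \<Gamma>"
    using g by (auto simp: parabolic_element_def parabolic_subgroup_def H_def)
  have "f \<circ> h = h \<circ> f" if "f \<in> H" "h \<in> H" for f h
    using cyclic_group_commutes that g\<Gamma> unfolding H_def by blast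
  \<comment> \<open>The fixed point in \<open>parabolic_subgroup\<close> is only a boundary point,
    so a fixed limit point is taken from the orbit of the abelian group H.\<close>
  then obtain \<xi> where \<xi>: "\<xi> \<in> limit_set x\<^sub>0 \<Gamma>" "\<And>h. h \<in> H \<Longrightarrow> boundary_action h \<xi> = \<xi>"
    using abelian_subgroup_fixed_limit_point[OF H(1,2)] by blast
  obtain \<gamma> where \<gamma>: "ray \<gamma> \<xi>" using ray_exists limit_set_boundary[OF \<xi>(1)] by blast
  \<comment> \<open>If f \<open>x\<^sub>0\<close> is within R of a ray point moved by at most 32K,
    then h moves f \<open>x\<^sub>0\<close> by at most 2R + 32K, and the conjugate of h by f lies in
    S. Taking one element more than S has contradicts injectivity of conjugation.\<close>
  define S where "S = {f \<in> \<Gamma>. dist x\<^sub>0 (f x\<^sub>0) \<le> 2 * R + 32 * K}"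
  have S: "finite S" unfolding S_def by (rule finite_orbit_ball)
  obtain F where F: "finite F" "card F = Suc (card S)" "F \<subseteq> H"
    using infinite_arbitrarily_large[OF H(2)] by blast
  have "eventually (\<lambda>t. \<forall>h\<in>F. dist (\<gamma> t) (h (\<gamma> t)) \<le> 32 * K) at_top"
    using F H \<xi> by (intro eventually_ball_finite ballI ray_displacement[OF \<gamma>]) auto
  from eventually_happens[OF eventually_conj[OF this eventually_ge_at_top[of 0]]]
  obtain t where t: "0 \<le> t" "\<And>h. h \<in> F \<Longrightarrow> dist (\<gamma> t) (h (\<gamma> t)) \<le> 32 * K" by auto
  have "R < dist (\<gamma> t) (f x\<^sub>0)" if f: "f \<in> \<Gamma>" for f
  proof (rule ccontr)
    assume "\<not> ?thesis"
    then have d: "dist (\<gamma> t) (f x\<^sub>0) \<le> R" by simp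
    have "inj_on (\<lambda>h. inverse_map f \<circ> h \<circ> f) F"
    proof (rule inj_onI)
      fix h k assume e: "inverse_map f \<circ> h \<circ> f = inverse_map f \<circ> k \<circ> f"
      have "f \<circ> (inverse_map f \<circ> h \<circ> f) \<circ> inverse_map f = f \<circ> (inverse_map f \<circ> k \<circ> f) \<circ> inverse_map f"
        unfolding e ..
      then show "h = k" using f by (simp add: fun_eq_iff)
    qed
    moreover have "inverse_map f \<circ> h \<circ> f \<in> S" if h: "h \<in> F" for h
    proof -
      have h\<Gamma>: "h \<in> \<Gamma>" using h F H by blast
      have "dist (f x\<^sub>0) (h (f x\<^sub>0)) \<le> dist (f x\<^sub>0) (\<gamma> t) + dist (\<gamma> t) (h (\<gamma> t)) + dist (h (\<gamma> t)) (h (f x\<^sub>0))"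
        using dist_triangle[of "f x\<^sub>0" "h (f x\<^sub>0)" "\<gamma> t"] dist_triangle[of "\<gamma> t" "h (f x\<^sub>0)" "h (\<gamma> t)"] by linarith
      also have "\<dots> \<le> 2 * R + 32 * K" using d t(2)[OF h] dist_isometry[OF h\<Gamma>] by (simp add: dist_commute)
      finally have "dist (f x\<^sub>0) (h (f x\<^sub>0)) \<le> 2 * R + 32 * K" .
      then have "dist x\<^sub>0 (inverse_map f (h (f x\<^sub>0))) \<le> 2 * R + 32 * K"
        using dist_isometry[OF f, of x\<^sub>0 "inverse_map f (h (f x\<^sub>0))"] f by simp
      then show ?thesis using f h\<Gamma> by (auto simp: S_def intro!: comp_mem inv_mem)
    qed
    ultimately have "card F \<le> card S" using S by (intro card_inj_on_le) auto
    then show False using F by simp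
  qed
  then show ?thesis using \<xi> \<gamma> t by blast
qed

end

section \<open>Horoball decompositions and the Dirichlet covering\<close>

locale horoball_decomposed_action = hyperbolic_group_action +
  fixes r :: "(nat \<Rightarrow> 'a) set \<Rightarrow> real"
  assumes decomposition: "horoball_decomposition x\<^sub>0 \<Gamma> r"
    and nonelementary: "\<exists>\<xi>\<in>limit_set x\<^sub>0 \<Gamma>. \<exists>\<eta>\<in>limit_set x\<^sub>0 \<Gamma>. \<xi> \<noteq> \<eta>"
    and has_parabolic: "\<exists>g. parabolic_element x\<^sub>0 \<Gamma> g"
begin

abbreviation "pts \<equiv> parabolic_points x\<^sub>0 \<Gamma>"

lemma radius_pos: "q \<in> pts \<Longrightarrow> 0 < r q"
  using decomposition by (simp add: horoball_decomposition_def)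

lemma horoballs_disjoint:
  "p \<in> pts \<Longrightarrow> q \<in> pts \<Longrightarrow> p \<noteq> q \<Longrightarrow> horoball x\<^sub>0 p (r p) \<inter> horoball x\<^sub>0 q (r q) = {}"
  using decomposition by (simp add: horoball_decomposition_def)

text \<open>The neighbourhoods V n of the orbit are open and invariant under \<Gamma>, so their
  traces on the hull have open images in the quotient. These images increase and cover it;
  compactness bounds n.\<close>

lemma cocompact_outside_horoballs:
  "\<exists>R. \<forall>x\<in>limit_hull x\<^sub>0 \<Gamma> - (\<Union>q\<in>pts. horoball x\<^sub>0 q (r q)). \<exists>g\<in>\<Gamma>. dist x (g x\<^sub>0) \<le> R"
proof -
  define C where "C = limit_hull x\<^sub>0 \<Gamma>"
  define A where "A = C - (\<Union>q\<in>pts. horoball x\<^sub>0 q (r q))"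
  define orb where "orb x = (\<lambda>g. g x) ` \<Gamma>" for x
  define Q where "Q = quotient_topology (top_of_set C) orb"
  have Q: "quotient_map (top_of_set C) Q orb" unfolding Q_def by (rule quotient_map_quotient_topology)
  then have topQ: "topspace Q = orb ` C" by (auto simp: quotient_map_def)
  have comp: "compactin Q (Abstract_Topology.closure_of Q (orb ` A))"
    using decomposition unfolding horoball_decomposition_def Let_def
    by (simp add: Q_def A_def C_def orb_def[abs_def])
  define V where "V n = (\<Union>g\<in>\<Gamma>. ball (g x\<^sub>0) (real n))" for n :: nat
  have V_orbit: "x \<in> V n" if e: "orb x = orb y" and y: "y \<in> V n" for x y n
  proof -
    have "x \<in> orb x" unfolding orb_def using id_mem by (intro image_eqI[of _ _ id]) auto
    then have "x \<in> orb y" using e by simp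
    then obtain h where h: "h \<in> \<Gamma>" "x = h y" unfolding orb_def by auto
    obtain g where "g \<in> \<Gamma>" "dist (g x\<^sub>0) y < real n" using y by (auto simp: V_def)
    then have "h \<circ> g \<in> \<Gamma>" "dist ((h \<circ> g) x\<^sub>0) x < real n" using h by (auto simp: comp_mem dist_isometry)
    then show ?thesis unfolding V_def by (metis UN_I mem_ball)
  qed
  have "openin Q (orb ` (C \<inter> V n))" for n
  proof -
    have "{x \<in> C. orb x \<in> orb ` (C \<inter> V n)} = C \<inter> V n" using V_orbit by blast
    moreover have "open (V n)" by (auto simp: V_def)
    ultimately have "openin (top_of_set C) {x \<in> C. orb x \<in> orb ` (C \<inter> V n)}"
      by (simp add: openin_open_Int)
    moreover have "orb ` (C \<inter> V n) \<subseteq> topspace Q" unfolding topQ by blast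
    ultimately show ?thesis using Q by (simp add: quotient_map_def)
  qed
  moreover have "Abstract_Topology.closure_of Q (orb ` A) \<subseteq> (\<Union>n. orb ` (C \<inter> V n))"
  proof -
    have "x \<in> (\<Union>n. V n)" for x
    proof -
      obtain n :: nat where "dist x\<^sub>0 x < real n" using reals_Archimedean2 by blast
      then have "x \<in> V n" unfolding V_def using id_mem by (intro UN_I[of id]) auto
      then show ?thesis by blast
    qed
    then have "orb x \<in> (\<Union>n. orb ` (C \<inter> V n))" if "x \<in> C" for x using that by blast
    then have "topspace Q \<subseteq> (\<Union>n. orb ` (C \<inter> V n))" unfolding topQ by (rule image_subsetI)
    then show ?thesis using closure_of_subset_topspace by (rule order_trans[rotated])
  qed
  ultimately have "\<exists>\<F>. finite \<F> \<and> \<F> \<subseteq> range (\<lambda>n. orb ` (C \<inter> V n)) \<and>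
      Abstract_Topology.closure_of Q (orb ` A) \<subseteq> \<Union>\<F>"
    by (intro compactinD[OF comp]) blast+
  then obtain \<F> where \<F>: "finite \<F>" "\<F> \<subseteq> range (\<lambda>n. orb ` (C \<inter> V n))"
      "Abstract_Topology.closure_of Q (orb ` A) \<subseteq> \<Union>\<F>"
    by blast
  obtain I where I: "finite I" "\<F> = (\<lambda>n. orb ` (C \<inter> V n)) ` I"
    using finite_subset_image[OF \<F>(1,2)] by blast
  \<comment> \<open>Inserting 0 keeps the maximum meaningful for an empty subcover.\<close>
  have "\<exists>g\<in>\<Gamma>. dist x (g x\<^sub>0) \<le> real (Max (insert 0 I))" if x: "x \<in> A" for x
  proof -
    have "orb ` A \<subseteq> topspace Q" unfolding topQ A_def by blast
    then have "orb x \<in> \<Union>\<F>" using closure_of_subset \<F>(3) x by blast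
    then obtain n y where n: "n \<in> I" "orb x = orb y" "y \<in> V n" using I by auto
    then have "x \<in> V n" using V_orbit by blast
    then obtain g where g: "g \<in> \<Gamma>" "dist x (g x\<^sub>0) < real n" by (auto simp: V_def dist_commute)
    have "real n \<le> real (Max (insert 0 I))" using I n by simp
    then show ?thesis using g by (intro bexI[of _ g]) simp_all
  qed
  then show ?thesis unfolding A_def C_def by blast
qed

text \<open>A limit point is far from one of two fixed limit points, so a geodesic line with both ends
  in the limit set and one of them equal to it passes uniformly close to the basepoint.\<close>
lemma ray_near_limit_hull:
  "\<exists>R. \<forall>\<xi>\<in>limit_set x\<^sub>0 \<Gamma>. \<forall>\<gamma> t. ray \<gamma> \<xi> \<longrightarrow> 0 \<le> t \<longrightarrow> (\<exists>x\<in>limit_hull x\<^sub>0 \<Gamma>. dist (\<gamma> t) x \<le> R)"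
proof -
  obtain \<xi>\<^sub>1 \<xi>\<^sub>2 where \<xi>: "\<xi>\<^sub>1 \<in> limit_set x\<^sub>0 \<Gamma>" "\<xi>\<^sub>2 \<in> limit_set x\<^sub>0 \<Gamma>" "\<xi>\<^sub>1 \<noteq> \<xi>\<^sub>2"
    using nonelementary by blast
  note b = limit_set_boundary[OF \<xi>(1)] limit_set_boundary[OF \<xi>(2)]
  obtain M where M: "\<not> ereal M \<le> ep (Inr \<xi>\<^sub>1) (Inr \<xi>\<^sub>2)"
    using boundary_eq_if_ep[OF b] \<xi>(3) by blast
  define M' where "M' = M + 2 * K"
  have "\<exists>x\<in>limit_hull x\<^sub>0 \<Gamma>. dist (\<gamma> t) x \<le> 3 * (M' + 2 * D + 1) + 8 * K"
    if l: "\<xi> \<in> limit_set x\<^sub>0 \<Gamma>" and \<gamma>: "ray \<gamma> \<xi>" and t: "0 \<le> t" for \<xi> \<gamma> t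
  proof -
    note b' = limit_set_boundary[OF l]
    have "\<exists>\<eta>\<in>limit_set x\<^sub>0 \<Gamma>. \<not> ereal M' \<le> ep (Inr \<eta>) (Inr \<xi>)"
    proof (rule ccontr)
      assume "\<not> ?thesis"
      then have e: "ereal M' \<le> ep (Inr \<xi>\<^sub>1) (Inr \<xi>)" "ereal M' \<le> ep (Inr \<xi>\<^sub>2) (Inr \<xi>)" using \<xi> by auto
      have "ereal (M' - K) \<le> ep (Inr \<xi>) (Inr \<xi>\<^sub>2)" using ep_commute[OF e(2)] b b' by simp
      then have "ereal M \<le> ep (Inr \<xi>\<^sub>1) (Inr \<xi>\<^sub>2)"
        using e(1) b b' K_ge by (rule_tac ep_trans'[of M' _ "Inr \<xi>" "M' - K"]) (auto simp: M'_def)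
      then show False using M by blast
    qed
    then obtain \<eta> where \<eta>: "\<eta> \<in> limit_set x\<^sub>0 \<Gamma>" "\<not> ereal M' \<le> ep (Inr \<eta>) (Inr \<xi>)" by blast
    obtain c where c: "geodesic_on UNIV c" "converges_to_boundary x\<^sub>0 c \<eta> at_bot"
        "converges_to_boundary x\<^sub>0 c \<xi> at_top" "nrm (c 0) \<le> M' + 2 * D + 1"
      using line_exists[OF limit_set_boundary[OF \<eta>(1)] b' \<eta>(2)] by blast
    have "c t \<in> limit_hull x\<^sub>0 \<Gamma>" unfolding limit_hull_def using c \<eta>(1) l by blast
    then show ?thesis using ray_near_line[OF \<gamma> c(1,3,4) t] by blast
  qed
  then show ?thesis by blast
qed

lemma ray_near_horoball_or_orbit:
  "\<exists>R. \<forall>\<xi>\<in>limit_set x\<^sub>0 \<Gamma>. \<forall>\<gamma> t. ray \<gamma> \<xi> \<longrightarrow> 0 \<le> t \<longrightarrow>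
     (\<exists>q\<in>pts. \<exists>x\<in>horoball x\<^sub>0 q (r q). dist (\<gamma> t) x \<le> R) \<or> (\<exists>g\<in>\<Gamma>. dist (\<gamma> t) (g x\<^sub>0) \<le> R)"
proof -
  obtain R\<^sub>1 where R\<^sub>1: "\<And>x. x \<in> limit_hull x\<^sub>0 \<Gamma> - (\<Union>q\<in>pts. horoball x\<^sub>0 q (r q)) \<Longrightarrow>
      \<exists>g\<in>\<Gamma>. dist x (g x\<^sub>0) \<le> R\<^sub>1"
    using cocompact_outside_horoballs by blast
  obtain R\<^sub>2 where R\<^sub>2: "\<And>\<xi> \<gamma> t. \<xi> \<in> limit_set x\<^sub>0 \<Gamma> \<Longrightarrow> ray \<gamma> \<xi> \<Longrightarrow> 0 \<le> t \<Longrightarrow>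
      \<exists>x\<in>limit_hull x\<^sub>0 \<Gamma>. dist (\<gamma> t) x \<le> R\<^sub>2"
    using ray_near_limit_hull by blast
  have "(\<exists>q\<in>pts. \<exists>x\<in>horoball x\<^sub>0 q (r q). dist (\<gamma> t) x \<le> R\<^sub>2 + max 0 R\<^sub>1) \<or>
      (\<exists>g\<in>\<Gamma>. dist (\<gamma> t) (g x\<^sub>0) \<le> R\<^sub>2 + max 0 R\<^sub>1)"
    if \<gamma>: "\<xi> \<in> limit_set x\<^sub>0 \<Gamma>" "ray \<gamma> \<xi>" "0 \<le> t" for \<xi> \<gamma> t
  proof -
    obtain x where x: "x \<in> limit_hull x\<^sub>0 \<Gamma>" "dist (\<gamma> t) x \<le> R\<^sub>2" using R\<^sub>2[OF \<gamma>] by blast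
    show ?thesis
    proof (cases "x \<in> (\<Union>q\<in>pts. horoball x\<^sub>0 q (r q))")
      case True
      then obtain q where "q \<in> pts" "x \<in> horoball x\<^sub>0 q (r q)" by blast
      moreover have "dist (\<gamma> t) x \<le> R\<^sub>2 + max 0 R\<^sub>1" using x(2) by simp
      ultimately show ?thesis by blast
    next
      case False
      then obtain g where g: "g \<in> \<Gamma>" "dist x (g x\<^sub>0) \<le> R\<^sub>1" using R\<^sub>1 x by blast
      have "dist (\<gamma> t) (g x\<^sub>0) \<le> R\<^sub>2 + max 0 R\<^sub>1"
        using dist_triangle[of "\<gamma> t" "g x\<^sub>0" x] g x(2) by simp
      then show ?thesis using g by blast
    qed
  qed
  then show ?thesis by blast
qed

lemma parabolic_points_nonempty: "pts \<noteq> {}"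
proof
  assume empty: "pts = {}"
  obtain R where R: "\<And>\<xi> \<gamma> t. \<xi> \<in> limit_set x\<^sub>0 \<Gamma> \<Longrightarrow> ray \<gamma> \<xi> \<Longrightarrow> 0 \<le> t \<Longrightarrow> \<exists>g\<in>\<Gamma>. dist (\<gamma> t) (g x\<^sub>0) \<le> R"
    using ray_near_horoball_or_orbit empty by (metis empty_iff)
  obtain g where "parabolic_element x\<^sub>0 \<Gamma> g" using has_parabolic by blast
  from parabolic_ray_leaves_orbit[OF this, of R] obtain \<xi> \<gamma> t where
    "\<xi> \<in> limit_set x\<^sub>0 \<Gamma>" "ray \<gamma> \<xi>" "0 \<le> t" "\<forall>f\<in>\<Gamma>. R < dist (\<gamma> t) (f x\<^sub>0)" by blast
  then show False using R by (meson not_le)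
qed

text \<open>Fix one horoball: g \<open>x\<^sub>0\<close> is at constant distance from its image
  under g, which quasi-invariance places within bounded distance of the chosen horoball at the image
  point.\<close>

lemma orbit_near_horoballs: "\<exists>R. \<forall>g\<in>\<Gamma>. \<exists>q\<in>pts. \<exists>x\<in>horoball x\<^sub>0 q (r q). dist (g x\<^sub>0) x \<le> R"
proof -
  obtain E where "\<forall>g\<in>\<Gamma>. \<forall>q\<in>pts.
      hausdorff_distance (horoball x\<^sub>0 (boundary_action g q) (r (boundary_action g q)))
        (g ` horoball x\<^sub>0 q (r q)) \<le> ennreal E"
    using decomposition unfolding horoball_decomposition_def by (elim conjE exE)
  note E = this[rule_format]
  \<comment> \<open>The 1 makes room for an infimum that is not attained, and max 0 is there because
    \<open>ennreal\<close> truncates negative numbers.\<close>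
  define E' where "E' = max 0 E + 1"
  obtain q where q: "q \<in> pts" using parabolic_points_nonempty by blast
  obtain y where y: "y \<in> horoball x\<^sub>0 q (r q)"
    using horoball_nonempty parabolic_point_boundary[OF q] by blast
  have "\<exists>q\<in>pts. \<exists>x\<in>horoball x\<^sub>0 q (r q). dist (g x\<^sub>0) x \<le> dist x\<^sub>0 y + E'" if g: "g \<in> \<Gamma>" for g
  proof -
    define A where "A = horoball x\<^sub>0 (boundary_action g q) (r (boundary_action g q))"
    have "(INF x\<in>A. ennreal (dist x (g y))) \<le> hausdorff_distance A (g ` horoball x\<^sub>0 q (r q))"
      unfolding hausdorff_distance_def using y by (intro max.coboundedI2 SUP_upper) auto
    also have "\<dots> \<le> ennreal E" using E[OF g q] by (simp add: A_def)
    also have "\<dots> < ennreal E'" unfolding E'_def by (rule ennreal_lessI) auto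
    finally obtain x where x: "x \<in> A" "ennreal (dist x (g y)) < ennreal E'" unfolding INF_less_iff by blast
    then have "dist x (g y) < E'" by (simp add: ennreal_less_iff)
    then have "dist (g x\<^sub>0) x \<le> dist x\<^sub>0 y + E'"
      using dist_triangle[of "g x\<^sub>0" x "g y"] dist_isometry[OF g, of x\<^sub>0 y] by (simp add: dist_commute)
    then show ?thesis using x(1) parabolic_points_invariant[OF g q] unfolding A_def by blast
  qed
  then show ?thesis by blast
qed

lemma ray_near_horoball:
  "\<exists>R. \<forall>\<xi>\<in>limit_set x\<^sub>0 \<Gamma>. \<forall>\<gamma> t. ray \<gamma> \<xi> \<longrightarrow> 0 \<le> t \<longrightarrow>
     (\<exists>q\<in>pts. \<exists>x\<in>horoball x\<^sub>0 q (r q). dist (\<gamma> t) x \<le> R)"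
proof -
  obtain R\<^sub>1 where R\<^sub>1: "\<And>\<xi> \<gamma> t. \<xi> \<in> limit_set x\<^sub>0 \<Gamma> \<Longrightarrow> ray \<gamma> \<xi> \<Longrightarrow> 0 \<le> t \<Longrightarrow>
     (\<exists>q\<in>pts. \<exists>x\<in>horoball x\<^sub>0 q (r q). dist (\<gamma> t) x \<le> R\<^sub>1) \<or> (\<exists>g\<in>\<Gamma>. dist (\<gamma> t) (g x\<^sub>0) \<le> R\<^sub>1)"
    using ray_near_horoball_or_orbit by blast
  obtain R\<^sub>2 where R\<^sub>2: "\<And>g. g \<in> \<Gamma> \<Longrightarrow> \<exists>q\<in>pts. \<exists>x\<in>horoball x\<^sub>0 q (r q). dist (g x\<^sub>0) x \<le> R\<^sub>2"
    using orbit_near_horoballs by blast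
  have "\<exists>q\<in>pts. \<exists>x\<in>horoball x\<^sub>0 q (r q). dist (\<gamma> t) x \<le> R\<^sub>1 + max 0 R\<^sub>2"
    if "\<xi> \<in> limit_set x\<^sub>0 \<Gamma>" "ray \<gamma> \<xi>" "0 \<le> t" for \<xi> \<gamma> t
    using R\<^sub>1[OF that]
  proof
    assume "\<exists>q\<in>pts. \<exists>x\<in>horoball x\<^sub>0 q (r q). dist (\<gamma> t) x \<le> R\<^sub>1"
    then show ?thesis by (metis add_increasing2 max.cobounded1)
  next
    assume "\<exists>g\<in>\<Gamma>. dist (\<gamma> t) (g x\<^sub>0) \<le> R\<^sub>1"
    then obtain g where g: "g \<in> \<Gamma>" "dist (\<gamma> t) (g x\<^sub>0) \<le> R\<^sub>1" by blast
    obtain q x where qx: "q \<in> pts" "x \<in> horoball x\<^sub>0 q (r q)" "dist (g x\<^sub>0) x \<le> R\<^sub>2" using R\<^sub>2[OF g(1)] by blast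
    have "dist (\<gamma> t) x \<le> R\<^sub>1 + max 0 R\<^sub>2" using dist_triangle[of "\<gamma> t" x "g x\<^sub>0"] g qx by simp
    then show ?thesis using qx by blast
  qed
  then show ?thesis by blast
qed

lemma dirichlet_covering:
  "\<exists>\<kappa>>0. \<exists>s\<^sub>0>0. \<forall>s. 0 < s \<longrightarrow> s \<le> s\<^sub>0 \<longrightarrow>
     (\<forall>\<xi>\<in>limit_set x\<^sub>0 \<Gamma>. \<exists>q\<in>pts. s \<le> r q \<and> \<xi> \<in> horoball_shadow x\<^sub>0 q (\<kappa> * sqrt (s / r q) * r q))"
proof -
  obtain R where R: "\<And>\<xi> \<gamma> t. \<xi> \<in> limit_set x\<^sub>0 \<Gamma> \<Longrightarrow> ray \<gamma> \<xi> \<Longrightarrow> 0 \<le> t \<Longrightarrow>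
     \<exists>q\<in>pts. \<exists>x\<in>horoball x\<^sub>0 q (r q). dist (\<gamma> t) x \<le> R"
    using ray_near_horoball by blast
  \<comment> \<open>Exactly the constant that \<open>shadow_if_ray_near_horoball\<close> leaves at
    the time t chosen below: 2R + 16K from the penetration estimate and 2R + 5K from half the shift
    of t.\<close>
  define \<kappa> where "\<kappa> = exp (4 * R + 21 * K)"
  define s\<^sub>0 where "s\<^sub>0 = exp (- 4 * R - 10 * K)"
  have "\<exists>q\<in>pts. s \<le> r q \<and> \<xi> \<in> horoball_shadow x\<^sub>0 q (\<kappa> * sqrt (s / r q) * r q)"
    if s: "0 < s" "s \<le> s\<^sub>0" and \<xi>: "\<xi> \<in> limit_set x\<^sub>0 \<Gamma>" for s \<xi>
  proof -
    \<comment> \<open>With this shift the first estimate for a nearby horoball reads ln s <= ln (r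
      q); \<open>s\<^sub>0\<close> is the bound that keeps t nonnegative.\<close>
    define t where "t = - 4 * R - 10 * K - ln s"
    have "ln s \<le> ln s\<^sub>0" using s by simp
    then have t: "0 \<le> t" by (simp add: t_def s\<^sub>0_def)
    obtain \<gamma> where \<gamma>: "ray \<gamma> \<xi>" using ray_exists limit_set_boundary[OF \<xi>] by blast
    obtain q x where qx: "q \<in> pts" "x \<in> horoball x\<^sub>0 q (r q)" "dist (\<gamma> t) x \<le> R" using R[OF \<xi> \<gamma> t] by blast
    note near = shadow_if_ray_near_horoball[OF \<gamma> t parabolic_point_boundary[OF qx(1)] qx(2,3)]
    have r0: "0 < r q" using radius_pos[OF qx(1)] .
    have "ln s \<le> ln (r q)" using near(1) by (simp add: t_def)
    then have "s \<le> r q" using s r0 by simp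
    moreover have "ln (\<kappa> * sqrt (s / r q) * r q) = 4 * R + 21 * K + (ln s + ln (r q)) / 2"
      using s r0 by (simp add: \<kappa>_def ln_mult ln_div ln_sqrt field_simps)
    then have "\<xi> \<in> horoball_shadow x\<^sub>0 q (\<kappa> * sqrt (s / r q) * r q)"
      using s r0 by (intro near(2)) (simp_all add: \<kappa>_def t_def field_simps)
    ultimately show ?thesis using qx by blast
  qed
  moreover have "\<kappa> > 0" "s\<^sub>0 > 0" by (simp_all add: \<kappa>_def s\<^sub>0_def)
  ultimately show ?thesis by blast
qed

text \<open>If two of these shadows met, so would the disjoint horoballs themselves.\<close>
lemma small_shadows_disjoint:
  assumes p: "p \<in> pts" "q \<in> pts" "p \<noteq> q" and A: "1 \<le> A" and s: "0 < s"
    and r: "r p \<in> {s..A * s}" "r q \<in> {s..A * s}" and c: "c = exp (- 22 * K) / A"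
  shows "horoball_shadow x\<^sub>0 p (c * r p) \<inter> horoball_shadow x\<^sub>0 q (c * r q) = {}"
proof (rule ccontr)
  assume "\<not> ?thesis"
  then obtain \<eta> where \<eta>: "\<eta> \<in> horoball_shadow x\<^sub>0 p (c * r p)" "\<eta> \<in> horoball_shadow x\<^sub>0 q (c * r q)" by blast
  \<comment> \<open>Dividing by A absorbs the spread of the radii: c times a radius of at most A s
    is at most exp(-22K) s.\<close>
  have *: "ln (c * \<rho>) + 22 * K \<le> ln s" if \<rho>: "\<rho> \<in> {s..A * s}" for \<rho>
  proof -
    have "ln \<rho> \<le> ln (A * s)" using \<rho> s A by (subst ln_le_cancel_iff) auto
    then show ?thesis using \<rho> s A by (simp add: c ln_mult ln_div)
  qed
  have "horoball x\<^sub>0 p (r p) \<inter> horoball x\<^sub>0 q (r q) \<noteq> {}"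
    using s r \<eta> * by (intro horoballs_intersect_if_shadows_intersect[OF _ _ s(1), where \<eta> = \<eta>]
        parabolic_point_boundary p) auto
  then show False using horoballs_disjoint[OF p] by blast
qed

end

section \<open>Tempered growth\<close>

text \<open>The supremum times \<open>h\<close> is subadditive and monotone in \<open>h\<close>, so the limit exists, possibly
  infinite, and equals the infimum.\<close>
lemma growth_rate_limit:
  fixes B :: "real \<Rightarrow> real"
  assumes mono: "\<And>s t. s \<le> t \<Longrightarrow> B s \<le> B t" and B1: "\<And>t. 0 < t \<Longrightarrow> 1 \<le> B t"
    and lim: "Lim at_top (\<lambda>h. SUP t\<in>{0<..}. ereal (1 / h * ln (B (t + h) / B t))) < ereal \<delta>"
  shows "\<exists>c C. 0 \<le> c \<and> c < \<delta> \<and> 0 < C \<and> (\<forall>t\<ge>0. B t \<le> C * exp (c * t))"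
proof -
  define f where "f h = (SUP t\<in>{0<..}. ereal (1 / h * ln (B (t + h) / B t)))" for h
  define L where "L = (INF h\<in>{0<..}. f h)"
  have f_nonneg: "0 \<le> f h" if "0 < h" for h
  proof -
    have "1 \<le> B (1 + h) / B 1" using mono[of 1 "1 + h"] B1[of 1] that by simp
    then have "0 \<le> ereal (1 / h * ln (B (1 + h) / B 1))" using that by simp
    also have "\<dots> \<le> f h" unfolding f_def by (intro SUP_upper) simp
    finally show ?thesis .
  qed
  \<comment> \<open>Iterate the estimate for one step of length \<open>h\<^sub>0\<close> and round h
    up to a multiple of it by monotonicity; the overshoot of less than one step costs the factor
    exp(c \<open>h\<^sub>0\<close>).\<close>
  have bound: "B (t + h) \<le> exp (c * h + c * h\<^sub>0) * B t"
    if h: "0 < h\<^sub>0" "f h\<^sub>0 \<le> ereal c" "0 \<le> c" "0 \<le> h" "0 < t" for h\<^sub>0 c h t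
  proof -
    have step: "B (t + h\<^sub>0) \<le> exp (c * h\<^sub>0) * B t" if t: "0 < t" for t
    proof -
      have "ereal (1 / h\<^sub>0 * ln (B (t + h\<^sub>0) / B t)) \<le> f h\<^sub>0"
        unfolding f_def using t by (intro SUP_upper) simp
      also note \<open>f h\<^sub>0 \<le> ereal c\<close>
      finally have "ln (B (t + h\<^sub>0) / B t) \<le> c * h\<^sub>0" using h(1) by (simp add: field_simps)
      moreover have "0 < B (t + h\<^sub>0)" "0 < B t" using B1[of t] B1[of "t + h\<^sub>0"] t h(1) by auto
      ultimately have "B (t + h\<^sub>0) / B t \<le> exp (c * h\<^sub>0)"
        by (metis divide_pos_pos exp_le_cancel_iff exp_ln)
      then show ?thesis using \<open>0 < B t\<close> by (simp add: field_simps)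
    qed
    have iter: "B (t + real n * h\<^sub>0) \<le> exp (c * (real n * h\<^sub>0)) * B t" for n
    proof (induction n)
      case (Suc n)
      have "B (t + real n * h\<^sub>0 + h\<^sub>0) \<le> exp (c * h\<^sub>0) * B (t + real n * h\<^sub>0)"
        using h by (intro step add_pos_nonneg) auto
      also have "\<dots> \<le> exp (c * h\<^sub>0) * (exp (c * (real n * h\<^sub>0)) * B t)"
        by (intro mult_left_mono Suc.IH) simp
      also have "\<dots> = exp (c * (real (Suc n) * h\<^sub>0)) * B t"
        by (simp add: exp_add[symmetric] algebra_simps)
      finally show ?case by (simp add: algebra_simps)
    qed simp
    define n where "n = nat \<lceil>h / h\<^sub>0\<rceil>"
    have n: "h / h\<^sub>0 \<le> real n" "real n \<le> h / h\<^sub>0 + 1"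
      using h of_int_ceiling_le_add_one[of "h / h\<^sub>0"] by (auto simp: n_def)
    have "h \<le> real n * h\<^sub>0" "real n * h\<^sub>0 \<le> h + h\<^sub>0" using n h by (simp_all add: field_simps)
    then have "B (t + h) \<le> B (t + real n * h\<^sub>0)" by (intro mono) simp
    also note iter
    also have "exp (c * (real n * h\<^sub>0)) * B t \<le> exp (c * (h + h\<^sub>0)) * B t"
      using \<open>real n * h\<^sub>0 \<le> h + h\<^sub>0\<close> h B1[of t] by (intro mult_right_mono) (auto intro: mult_left_mono)
    finally show ?thesis by (simp add: algebra_simps)
  qed
  \<comment> \<open>\<open>Lim\<close> is a definite description, so its bound becomes usable only
    after convergence has been proved.\<close>
  have "(f \<longlongrightarrow> L) at_top"
  proof (rule order_tendstoI)
    fix y assume y: "y < L"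
    show "eventually (\<lambda>h. y < f h) at_top"
      using eventually_gt_at_top[of 0]
    proof eventually_elim
      case (elim h)
      then have "L \<le> f h" unfolding L_def by (intro INF_lower) simp
      then show ?case using y by (rule less_le_trans[rotated])
    qed
  next
    fix y assume "L < y"
    then obtain h\<^sub>0 where h\<^sub>0: "0 < h\<^sub>0" "f h\<^sub>0 < y" unfolding L_def INF_less_iff by auto
    then obtain c where c: "f h\<^sub>0 < ereal c" "ereal c < y" using ereal_dense2 by blast
    have c0: "0 \<le> c" using le_less_trans[OF f_nonneg[OF h\<^sub>0(1)] c(1)] by simp
    have le: "f h \<le> ereal (c + c * h\<^sub>0 / h)" if h: "0 < h" for h
      unfolding f_def
    proof (rule SUP_least)
      fix t :: real assume "t \<in> {0<..}"
      then have t: "0 < t" "0 < B t" "0 < B (t + h)" using B1[of t] B1[of "t + h"] h by auto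
      have "B (t + h) / B t \<le> exp (c * h + c * h\<^sub>0)"
        using bound[OF h\<^sub>0(1) less_imp_le[OF c(1)] c0, of h t] h t by (simp add: field_simps)
      then have "ln (B (t + h) / B t) \<le> ln (exp (c * h + c * h\<^sub>0))"
        using t by (subst ln_le_cancel_iff) auto
      then have "ln (B (t + h) / B t) \<le> c * h + c * h\<^sub>0" by simp
      then have "1 / h * ln (B (t + h) / B t) \<le> 1 / h * (c * h + c * h\<^sub>0)"
        using h by (intro mult_left_mono) auto
      also have "\<dots> = c + c * h\<^sub>0 / h" using h by (simp add: field_simps)
      finally show "ereal (1 / h * ln (B (t + h) / B t)) \<le> ereal (c + c * h\<^sub>0 / h)" by simp
    qed
    have "((\<lambda>h. ereal (c + c * h\<^sub>0 / h)) \<longlongrightarrow> ereal (c + 0)) at_top"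
      by (intro tendsto_intros tendsto_divide_0[OF tendsto_const] filterlim_at_top_imp_at_infinity filterlim_ident)
    then have "eventually (\<lambda>h. ereal (c + c * h\<^sub>0 / h) < y) at_top"
      using c(2) by (intro order_tendstoD(2)) auto
    then show "eventually (\<lambda>h. f h < y) at_top"
      using eventually_gt_at_top[of 0] by eventually_elim (use le in \<open>blast intro: le_less_trans\<close>)
  qed
  then have "L < ereal \<delta>" using lim tendsto_Lim[of at_top f L] by (simp add: f_def[abs_def])
  then obtain h\<^sub>0 where h\<^sub>0: "0 < h\<^sub>0" "f h\<^sub>0 < ereal \<delta>" unfolding L_def INF_less_iff by auto
  then obtain c where c: "f h\<^sub>0 < ereal c" "ereal c < ereal \<delta>" using ereal_dense2 by blast
  have c0: "0 \<le> c" using le_less_trans[OF f_nonneg[OF h\<^sub>0(1)] c(1)] by simp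
  \<comment> \<open>Starting at 1 rather than 0 stays in the range t > 0 of the growth estimate, and
    monotonicity then covers t = 0.\<close>
  have "B t \<le> (exp (c * h\<^sub>0) * B 1) * exp (c * t)" if "0 \<le> t" for t
  proof -
    have "B t \<le> B (1 + t)" by (rule mono) simp
    also have "\<dots> \<le> exp (c * t + c * h\<^sub>0) * B 1"
      using bound[OF h\<^sub>0(1) less_imp_le[OF c(1)] c0 that, of 1] by simp
    finally show ?thesis by (simp add: exp_add algebra_simps)
  qed
  moreover have "0 < exp (c * h\<^sub>0) * B 1" using B1[of 1] by simp
  ultimately show ?thesis using c0 c(2) by (metis less_ereal.simps(1))
qed

context hyperbolic_group_action
begin

lemma orbit_count_ge_1:
  assumes "H \<subseteq> \<Gamma>" "id \<in> H" "0 \<le> t"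
  shows "1 \<le> orbit_count x\<^sub>0 H t"
proof -
  have "finite {g \<in> H. dist x\<^sub>0 (g x\<^sub>0) \<le> t}"
    using finite_orbit_ball[of t] by (rule finite_subset[rotated]) (use assms in auto)
  moreover have "id \<in> {g \<in> H. dist x\<^sub>0 (g x\<^sub>0) \<le> t}" using assms by simp
  ultimately show ?thesis unfolding orbit_count_def using card_gt_0_iff by (metis One_nat_def Suc_leI empty_iff)
qed

lemma orbit_count_mono:
  assumes "H \<subseteq> \<Gamma>" "s \<le> t"
  shows "orbit_count x\<^sub>0 H s \<le> orbit_count x\<^sub>0 H t"
  unfolding orbit_count_def
proof (rule card_mono)
  show "finite {g \<in> H. dist x\<^sub>0 (g x\<^sub>0) \<le> t}"
    using finite_orbit_ball[of t] by (rule finite_subset[rotated]) (use assms in auto)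
qed (use assms in auto)

lemma tempered_growth_bound:
  assumes H: "H \<subseteq> \<Gamma>" "id \<in> H" and t: "tempered_growth x\<^sub>0 \<delta> H"
  shows "\<exists>c C. 0 \<le> c \<and> c < \<delta> \<and> 0 < C \<and> (\<forall>t\<ge>0. real (orbit_count x\<^sub>0 H t) \<le> C * exp (c * t))"
proof (rule growth_rate_limit)
  show "Lim at_top (\<lambda>h. SUP t\<in>{0<..}. ereal (1 / h *
      ln (real (orbit_count x\<^sub>0 H (t + h)) / real (orbit_count x\<^sub>0 H t)))) < ereal \<delta>"
    using t by (simp add: tempered_growth_def upper_growth_def growth_rate_def)
  show "1 \<le> real (orbit_count x\<^sub>0 H t)" if "0 < t" for t
    using orbit_count_ge_1[OF H, of t] that by simp
qed (simp add: orbit_count_mono[OF H(1)])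

end

section \<open>Counting horoballs\<close>

lemma sum_powers_le:
  fixes x :: real
  assumes x: "0 \<le> x" "x < 1" and I: "finite I" "I \<subseteq> {J..}"
  shows "(\<Sum>j\<in>I. x ^ j) \<le> x ^ J / (1 - x)"
proof -
  obtain N where "\<forall>i\<in>I. i < N" using finite_nat_set_iff_bounded[of I] I(1) by blast
  then have N: "I \<subseteq> {J..<J + N}" using I(2) by fastforce
  have *: "(\<Sum>j\<in>{J..<J + N}. x ^ j) * (1 - x) = x ^ J - x ^ (J + N)"
  proof (induction N)
    case (Suc N)
    then show ?case by (simp add: distrib_right) (simp add: algebra_simps)
  qed simp
  have "(\<Sum>j\<in>I. x ^ j) \<le> (\<Sum>j\<in>{J..<J + N}. x ^ j)" using N x by (intro sum_mono2) auto
  also have "\<dots> \<le> x ^ J / (1 - x)"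
    using * x zero_le_power[OF x(1), of "J + N"] by (simp add: pos_le_divide_eq)
  finally show ?thesis .
qed

text \<open>The exponent is one less than that of the first power of two exceeding y. The form
  matches the closed bands of radii in the count.\<close>

lemma dyadic_level_exists:
  fixes y :: real
  assumes "2 ^ J \<le> y"
  shows "\<exists>j\<ge>J. 2 ^ j \<le> y \<and> y \<le> 2 * 2 ^ j"
proof -
  obtain n where n: "y < 2 ^ n" using real_arch_pow[of 2 y] by auto
  define m where "m = (LEAST n. y < 2 ^ n)"
  have m: "y < 2 ^ m" unfolding m_def by (rule LeastI[of "\<lambda>n. y < 2 ^ n", OF n])
  then have "(2 :: real) ^ J < 2 ^ m" using assms by linarith
  then have "J < m" by simp
  then obtain j where j: "m = Suc j" "J \<le> j" by (cases m) auto
  have "\<not> y < 2 ^ j" using not_less_Least[of j "\<lambda>n. y < 2 ^ n"] j by (simp add: m_def)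
  then show ?thesis using j m by (intro exI[of _ j]) auto
qed

locale horoball_shadow_action = horoball_decomposed_action +
  fixes a :: nat and p :: "nat \<Rightarrow> (nat \<Rightarrow> 'a) set" and \<mu> :: "(nat \<Rightarrow> 'a) set measure" and \<delta> :: real
  assumes representatives: "parabolic_representatives x\<^sub>0 \<Gamma> a p"
    and tempered: "tempered_parabolic_subgroups x\<^sub>0 \<delta> \<Gamma>"
    and measure: "measure_on_limit_set x\<^sub>0 \<Gamma> \<mu>"
    and shadow_lemma: "horoball_shadow_lemma x\<^sub>0 \<Gamma> a p r \<mu> \<delta>"
begin

section \<open>Consequences of the shadow lemma and of tempered growth\<close>

abbreviation shadow where "shadow \<equiv> horoball_shadow x\<^sub>0"

lemma representative_parabolic: "i \<in> {1..a} \<Longrightarrow> p i \<in> pts"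
  using representatives by (auto simp: parabolic_representatives_def)

lemma representative_exists:
  assumes "q \<in> pts"
  obtains i where "i \<in> {1..a}" "q \<in> boundary_orbit \<Gamma> (p i)"
  using representatives assms unfolding parabolic_representatives_def by blast

lemma stabilizer_facts: "stabilizer \<Gamma> \<xi> \<subseteq> \<Gamma>" "id \<in> stabilizer \<Gamma> \<xi>"
  by (auto simp: stabilizer_def id_mem)

lemma stabilizer_tempered: "q \<in> pts \<Longrightarrow> tempered_growth x\<^sub>0 \<delta> (stabilizer \<Gamma> q)"
  using tempered maximal_parabolic_stabilizer by (simp add: tempered_parabolic_subgroups_def)

text \<open>One exponent below \<delta> for all stabilizers, as a maximum over the finitely many
  representatives. The maxima are over a nonempty set because a parabolic point exists.\<close>

lemma growth_bound:
  "\<exists>c C. 0 \<le> c \<and> c < \<delta> \<and> 0 < C \<and>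
     (\<forall>i\<in>{1..a}. \<forall>t\<ge>0. real (orbit_count x\<^sub>0 (stabilizer \<Gamma> (p i)) t) \<le> C * exp (c * t))"
proof -
  have "\<forall>i\<in>{1..a}. \<exists>c C. 0 \<le> c \<and> c < \<delta> \<and> 0 < C \<and>
      (\<forall>t\<ge>0. real (orbit_count x\<^sub>0 (stabilizer \<Gamma> (p i)) t) \<le> C * exp (c * t))"
    by (intro ballI tempered_growth_bound stabilizer_facts stabilizer_tempered representative_parabolic)
  then obtain c C where cC: "\<And>i. i \<in> {1..a} \<Longrightarrow> 0 \<le> c i" "\<And>i. i \<in> {1..a} \<Longrightarrow> c i < \<delta>"
      "\<And>i. i \<in> {1..a} \<Longrightarrow> (0 :: real) < C i"
      "\<And>i t. i \<in> {1..a} \<Longrightarrow> 0 \<le> t \<Longrightarrow> real (orbit_count x\<^sub>0 (stabilizer \<Gamma> (p i)) t) \<le> C i * exp (c i * t)"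
    by metis
  obtain q where "q \<in> pts" using parabolic_points_nonempty by blast
  then have ne: "{1..a} \<noteq> {}" using representative_exists by blast
  define c' where "c' = Max (c ` {1..a})"
  define C' where "C' = Max (C ` {1..a})"
  have fin: "finite (c ` {1..a})" "finite (C ` {1..a})" "c ` {1..a} \<noteq> {}" "C ` {1..a} \<noteq> {}" using ne by auto
  have le: "c i \<le> c'" "C i \<le> C'" if "i \<in> {1..a}" for i unfolding c'_def C'_def using that by auto
  have c': "0 \<le> c'" using ne cC(1) le(1) order_trans by blast
  have C': "0 < C'" using ne cC(3) le(2) less_le_trans by blast
  have "c' < \<delta>" using cC(2) fin by (auto simp: c'_def)
  moreover have "real (orbit_count x\<^sub>0 (stabilizer \<Gamma> (p i)) t) \<le> C' * exp (c' * t)"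
    if it: "i \<in> {1..a}" "0 \<le> t" for i t
  proof -
    have "C i * exp (c i * t) \<le> C' * exp (c' * t)"
      using le[OF it(1)] it(2) C' by (intro mult_mono) (auto intro: mult_right_mono)
    then show ?thesis using cC(4)[OF it] by linarith
  qed
  ultimately show ?thesis using c' C' by blast
qed

lemma delta_pos: "0 < \<delta>"
  using growth_bound by force

text \<open>Any positive radius is admissible in the shadow lemma with \<open>\<theta> = 1\<close>.\<close>
lemma shadow_measure_bounds:
  assumes c: "0 < c"
  shows "\<exists>k>0. \<forall>q\<in>pts. ennreal (k * r q powr \<delta>) \<le> emeasure \<mu> (shadow q (c * r q)) \<and>
    emeasure \<mu> (shadow q (c * r q)) < \<infinity>"
proof -
  obtain k where k: "k \<ge> 1" "\<And>i q. i \<in> {1..a} \<Longrightarrow> q \<in> boundary_orbit \<Gamma> (p i) \<Longrightarrow>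
      ennreal (inverse k * real (orbit_count x\<^sub>0 (stabilizer \<Gamma> (p i)) 0) * r q powr \<delta>)
        \<le> emeasure \<mu> (shadow q (c * r q)) \<and>
      emeasure \<mu> (shadow q (c * r q))
        \<le> ennreal (k * real (orbit_count x\<^sub>0 (stabilizer \<Gamma> (p i)) 0) * r q powr \<delta>)"
  proof -
    obtain k where k: "k \<ge> 1" "\<forall>\<theta>. 0 < \<theta> \<and> \<theta> \<le> 1 \<longrightarrow> (\<forall>c\<in>{c..c + 1}. \<forall>i\<in>{1..a}. \<forall>q\<in>boundary_orbit \<Gamma> (p i).
       (let B = real (orbit_count x\<^sub>0 (stabilizer \<Gamma> (p i)) (- 2 * ln \<theta>))
        in ennreal (inverse k * B * \<theta> powr (2 * \<delta>) * r q powr \<delta>)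
             \<le> emeasure \<mu> (shadow q (c * \<theta> * r q)) \<and>
           emeasure \<mu> (shadow q (c * \<theta> * r q))
             \<le> ennreal (k * B * \<theta> powr (2 * \<delta>) * r q powr \<delta>)))"
      \<comment> \<open>The shadow lemma asks for an interval with distinct endpoints; c + 1 is an
        arbitrary right end.\<close>
      using shadow_lemma[unfolded horoball_shadow_lemma_def, rule_format, of c "c + 1"] c by auto
    show ?thesis
      using k(2)[rule_format, of 1 c] by (intro that[OF k(1)]) (simp add: Let_def)
  qed
  have "ennreal (inverse k * r q powr \<delta>) \<le> emeasure \<mu> (shadow q (c * r q)) \<and>
    emeasure \<mu> (shadow q (c * r q)) < \<infinity>" if q: "q \<in> pts" for q
  proof -
    obtain i where i: "i \<in> {1..a}" "q \<in> boundary_orbit \<Gamma> (p i)" using representative_exists[OF q] .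
    define B where "B = real (orbit_count x\<^sub>0 (stabilizer \<Gamma> (p i)) 0)"
    \<comment> \<open>The identity is always counted, so the growth factor is at least 1 even at
      0.\<close>
    have "1 \<le> B" using orbit_count_ge_1[OF stabilizer_facts, of 0 "p i"] by (simp add: B_def)
    then have "inverse k * 1 * r q powr \<delta> \<le> inverse k * B * r q powr \<delta>"
      using k(1) by (intro mult_right_mono mult_left_mono) auto
    then have "ennreal (inverse k * r q powr \<delta>) \<le> ennreal (inverse k * B * r q powr \<delta>)"
      by (intro ennreal_leI) simp
    also have "\<dots> \<le> emeasure \<mu> (shadow q (c * r q))" using k(2)[OF i] by (simp add: B_def)
    finally show ?thesis
      using le_less_trans[OF conjunct2[OF k(2)[OF i]] ennreal_less_top] by simp
  qed
  then show ?thesis using k(1) by (intro exI[of _ "inverse k"]) auto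
qed

text \<open>\<open>emeasure\<close> is 0 by default on nonmeasurable sets, so the positive lower
  bound of the shadow lemma forces measurability.\<close>

lemma shadow_sets:
  assumes q: "q \<in> pts" and \<rho>: "0 < \<rho>"
  shows "shadow q \<rho> \<in> sets \<mu>"
proof (rule ccontr)
  assume "shadow q \<rho> \<notin> sets \<mu>"
  then have "emeasure \<mu> (shadow q \<rho>) = 0" by (rule emeasure_notin_sets)
  moreover obtain k where "k > 0" "ennreal (k * r q powr \<delta>) \<le> emeasure \<mu> (shadow q (\<rho> / r q * r q))"
    using shadow_measure_bounds[of "\<rho> / r q"] q \<rho> radius_pos[OF q] by auto
  ultimately show False using radius_pos[OF q] by simp
qed

lemma space_measure: "space \<mu> = gromov_boundary x\<^sub>0"
  using sets_eq_imp_space_eq[of \<mu> "sigma (gromov_boundary x\<^sub>0) {U. openin (boundary_topology x\<^sub>0) U}"] measure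
  by (simp add: measure_on_limit_set_def space_measure_of_conv)

lemma shadow_subset: "shadow q \<rho> \<subseteq> space \<mu>"
  by (auto simp: space_measure horoball_shadow_def)

text \<open>The radius exp(6K) is the one at which \<open>basepoint_in_horoball\<close> applies;
  every ray starts in that horoball, so its shadow is the whole boundary. The two shadow bounds give
  finiteness and positivity.\<close>

lemma finite_measure: "finite_measure \<mu>" and measure_space_pos: "0 < Sigma_Algebra.measure \<mu> (space \<mu>)"
proof -
  obtain q where q: "q \<in> pts" using parabolic_points_nonempty by blast
  define c where "c = exp (6 * K) / r q"
  have c: "0 < c" "c * r q = exp (6 * K)" using radius_pos[OF q] by (auto simp: c_def)
  have "\<eta> \<in> shadow q (c * r q)" if \<eta>: "\<eta> \<in> gromov_boundary x\<^sub>0" for \<eta>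
  proof -
    obtain \<gamma> where \<gamma>: "ray \<gamma> \<eta>" using ray_exists[OF \<eta>] by blast
    have "\<gamma> 0 \<in> horoball x\<^sub>0 q (c * r q)"
      using basepoint_in_horoball[OF parabolic_point_boundary[OF q], of "c * r q"] \<gamma> by (simp add: c ray_def)
    then show ?thesis using \<gamma> unfolding horoball_shadow_iff by blast
  qed
  then have eq: "shadow q (c * r q) = space \<mu>" using shadow_subset space_measure by blast
  obtain k where k: "k > 0" "ennreal (k * r q powr \<delta>) \<le> emeasure \<mu> (space \<mu>)" "emeasure \<mu> (space \<mu>) < \<infinity>"
    using shadow_measure_bounds[OF c(1)] q eq by metis
  then show fin: "finite_measure \<mu>" by (intro finite_measureI) auto
  have "0 < k * r q powr \<delta>" using k(1) radius_pos[OF q] by simp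
  moreover have "k * r q powr \<delta> \<le> Sigma_Algebra.measure \<mu> (space \<mu>)"
    using k(2) finite_measure.emeasure_eq_measure[OF fin] by simp
  ultimately show "0 < Sigma_Algebra.measure \<mu> (space \<mu>)" by linarith
qed

lemma limit_set_measure:
  "limit_set x\<^sub>0 \<Gamma> \<in> sets \<mu>" "Sigma_Algebra.measure \<mu> (limit_set x\<^sub>0 \<Gamma>) = Sigma_Algebra.measure \<mu> (space \<mu>)"
proof -
  have null: "space \<mu> - limit_set x\<^sub>0 \<Gamma> \<in> null_sets \<mu>"
    using measure by (simp add: measure_on_limit_set_def space_measure)
  have eq: "space \<mu> - (space \<mu> - limit_set x\<^sub>0 \<Gamma>) = limit_set x\<^sub>0 \<Gamma>"
    using limit_set_boundary by (auto simp: space_measure)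
  show "limit_set x\<^sub>0 \<Gamma> \<in> sets \<mu>"
    using sets.compl_sets[OF null_setsD2[OF null]] unfolding eq .
  show "Sigma_Algebra.measure \<mu> (limit_set x\<^sub>0 \<Gamma>) = Sigma_Algebra.measure \<mu> (space \<mu>)"
    using measure_Diff_null_set[OF sets.top null] unfolding eq .
qed

section \<open>Upper bound for the number of horoballs of comparable radius\<close>

lemma count_upper_bound:
  assumes A: "1 \<le> A"
  shows "\<exists>C>0. \<forall>s>0. finite {q \<in> pts. r q \<in> {s..A * s}} \<and>
    real (card {q \<in> pts. r q \<in> {s..A * s}}) \<le> C * s powr (- \<delta>)"
proof -
  interpret finite_measure \<mu> by (rule finite_measure)
  define c where "c = exp (- 22 * K) / A"
  have c: "0 < c" using A by (simp add: c_def)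
  obtain k where k: "k > 0" "\<And>q. q \<in> pts \<Longrightarrow> ennreal (k * r q powr \<delta>) \<le> emeasure \<mu> (shadow q (c * r q))"
    using shadow_measure_bounds[OF c] by blast
  define C where "C = Sigma_Algebra.measure \<mu> (space \<mu>) / k"
  have C: "0 < C" using measure_space_pos k(1) by (simp add: C_def)
  have "finite {q \<in> pts. r q \<in> {s..A * s}} \<and> real (card {q \<in> pts. r q \<in> {s..A * s}}) \<le> C * s powr (- \<delta>)"
    if s: "0 < s" for s
  proof -
    define S where "S = {q \<in> pts. r q \<in> {s..A * s}}"
    \<comment> \<open>A bound on \<open>card\<close> alone would hold for infinite sets, whose
      \<open>card\<close> is 0. Bounding all finite subsets uniformly gives finiteness together with
      the count.\<close>
    have "card G \<le> nat \<lfloor>C * s powr (- \<delta>)\<rfloor>" if G: "G \<subseteq> S" "finite G" for G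
    proof -
      have pG: "q \<in> pts" "r q \<in> {s..A * s}" if "q \<in> G" for q using that G by (auto simp: S_def)
      have sG: "shadow q (c * r q) \<in> sets \<mu>" if "q \<in> G" for q
        using pG[OF that] c radius_pos by (intro shadow_sets) auto
      have "real (card G) * (k * s powr \<delta>) \<le> (\<Sum>q\<in>G. Sigma_Algebra.measure \<mu> (shadow q (c * r q)))"
      proof (rule sum_bounded_below)
        fix q assume q: "q \<in> G"
        have "k * s powr \<delta> \<le> k * r q powr \<delta>"
          using pG[OF q] s k(1) delta_pos by (intro mult_left_mono powr_mono2) auto
        also have "\<dots> \<le> Sigma_Algebra.measure \<mu> (shadow q (c * r q))"
          using k(2)[OF pG(1)[OF q]] by (simp add: emeasure_eq_measure)
        finally show "k * s powr \<delta> \<le> Sigma_Algebra.measure \<mu> (shadow q (c * r q))" .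
      qed
      also have "\<dots> = Sigma_Algebra.measure \<mu> (\<Union>q\<in>G. shadow q (c * r q))"
      proof (rule finite_measure_finite_Union[symmetric])
        show "disjoint_family_on (\<lambda>q. shadow q (c * r q)) G"
          unfolding disjoint_family_on_def using pG small_shadows_disjoint[OF _ _ _ A s] c_def by blast
      qed (use G sG in auto)
      also have "\<dots> \<le> Sigma_Algebra.measure \<mu> (space \<mu>)" by (rule bounded_measure)
      finally have "real (card G) * (k * s powr \<delta>) \<le> C * k" using k(1) by (simp add: C_def)
      then have "real (card G) * s powr \<delta> \<le> C" using k(1) by (simp add: algebra_simps)
      then have "real (card G) \<le> C * s powr (- \<delta>)" using s by (simp add: powr_minus field_simps)
      then show ?thesis by (simp add: le_nat_floor)
    qed
    from finite_if_finite_subsets_card_bdd[OF this]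
    have "finite S" "card S \<le> nat \<lfloor>C * s powr (- \<delta>)\<rfloor>" by auto
    moreover from this(2) have "real (card S) \<le> C * s powr (- \<delta>)"
      using C s by (simp add: le_nat_iff le_floor_iff)
    ultimately show ?thesis by (simp add: S_def)
  qed
  then show ?thesis using C by blast
qed

text \<open>The count at s = r q includes q itself, so 1 <= C (r q)^(-\<delta>) and the radii are
  bounded above. A single band from s then contains all radii that are at least s.\<close>

lemma finite_large_horoballs:
  assumes s: "0 < s"
  shows "finite {q \<in> pts. s \<le> r q}"
proof -
  obtain C where C: "C > 0" "\<And>s. s > 0 \<Longrightarrow> finite {q \<in> pts. r q \<in> {s..1 * s}} \<and>
      real (card {q \<in> pts. r q \<in> {s..1 * s}}) \<le> C * s powr (- \<delta>)"
    using count_upper_bound[of 1] by auto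
  have bounded: "r q \<le> C powr (1 / \<delta>)" if q: "q \<in> pts" for q
  proof -
    have r0: "0 < r q" by (rule radius_pos[OF q])
    have "q \<in> {q' \<in> pts. r q' \<in> {r q..1 * r q}}" using q by simp
    then have "0 < card {q' \<in> pts. r q' \<in> {r q..1 * r q}}" using C(2)[OF r0] card_gt_0_iff by blast
    then have "1 \<le> C * r q powr (- \<delta>)" using C(2)[OF r0] by linarith
    then have "r q powr \<delta> \<le> C" using r0 by (simp add: powr_minus field_simps)
    then have "(r q powr \<delta>) powr (1 / \<delta>) \<le> C powr (1 / \<delta>)"
      using delta_pos by (intro powr_mono2) auto
    then show ?thesis using r0 delta_pos by (simp add: powr_powr)
  qed
  define A where "A = max 1 (C powr (1 / \<delta>) / s)"
  have "r q \<le> A * s" if "q \<in> pts" for q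
  proof -
    have "C powr (1 / \<delta>) = C powr (1 / \<delta>) / s * s" using s by simp
    also have "\<dots> \<le> A * s" using s by (intro mult_right_mono) (auto simp: A_def)
    finally show ?thesis using bounded[OF that] by linarith
  qed
  then have "{q \<in> pts. s \<le> r q} \<subseteq> {q \<in> pts. r q \<in> {s..A * s}}" by auto
  moreover have "1 \<le> A" by (simp add: A_def)
  ultimately show ?thesis using count_upper_bound[of A] s finite_subset by blast
qed

text \<open>The shadow lemma at \<theta> = sqrt(s/r q): the growth function at - 2 ln \<theta> = ln
  (r q/s) is at most C (r q/s)^c, and the remaining powers combine to s^\<delta>.\<close>

lemma covering_shadow_measure:
  assumes \<kappa>: "0 < \<kappa>"
  shows "\<exists>c k. 0 \<le> c \<and> c < \<delta> \<and> 0 < k \<and> (\<forall>q\<in>pts. \<forall>s. 0 < s \<longrightarrow> s \<le> r q \<longrightarrow>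
    emeasure \<mu> (shadow q (\<kappa> * sqrt (s / r q) * r q)) \<le> ennreal (k * (r q / s) powr c * s powr \<delta>))"
proof -
  obtain c C where c: "0 \<le> c" "c < \<delta>" "0 < C" and B: "\<And>i t. i \<in> {1..a} \<Longrightarrow> 0 \<le> t \<Longrightarrow>
      real (orbit_count x\<^sub>0 (stabilizer \<Gamma> (p i)) t) \<le> C * exp (c * t)"
    using growth_bound by blast
  obtain k where k: "k \<ge> 1" "\<forall>\<theta>. 0 < \<theta> \<and> \<theta> \<le> 1 \<longrightarrow> (\<forall>c\<in>{\<kappa>..\<kappa> + 1}. \<forall>i\<in>{1..a}. \<forall>q\<in>boundary_orbit \<Gamma> (p i).
     (let B = real (orbit_count x\<^sub>0 (stabilizer \<Gamma> (p i)) (- 2 * ln \<theta>))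
      in ennreal (inverse k * B * \<theta> powr (2 * \<delta>) * r q powr \<delta>)
           \<le> emeasure \<mu> (shadow q (c * \<theta> * r q)) \<and>
         emeasure \<mu> (shadow q (c * \<theta> * r q))
           \<le> ennreal (k * B * \<theta> powr (2 * \<delta>) * r q powr \<delta>)))"
    using shadow_lemma[unfolded horoball_shadow_lemma_def, rule_format, of \<kappa> "\<kappa> + 1"] \<kappa> by auto
  have "emeasure \<mu> (shadow q (\<kappa> * sqrt (s / r q) * r q)) \<le> ennreal ((k * C) * (r q / s) powr c * s powr \<delta>)"
    if q: "q \<in> pts" and s: "0 < s" "s \<le> r q" for q s
  proof -
    obtain i where i: "i \<in> {1..a}" "q \<in> boundary_orbit \<Gamma> (p i)" using representative_exists[OF q] .
    have r0: "0 < r q" using s by simp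
    define \<theta> where "\<theta> = sqrt (s / r q)"
    have \<theta>: "0 < \<theta>" "\<theta> \<le> 1" using s r0 by (auto simp: \<theta>_def)
    have ln\<theta>: "- 2 * ln \<theta> = ln (r q / s)" using s r0 by (simp add: \<theta>_def ln_sqrt ln_div)
    define B where "B = real (orbit_count x\<^sub>0 (stabilizer \<Gamma> (p i)) (- 2 * ln \<theta>))"
    have "B \<le> C * exp (c * (- 2 * ln \<theta>))" unfolding B_def using \<theta> by (intro B i) simp
    also have "exp (c * (- 2 * ln \<theta>)) = (r q / s) powr c" unfolding ln\<theta> using s r0 by (simp add: powr_def)
    finally have B: "B \<le> C * (r q / s) powr c" .
    have "\<theta> powr (2 * \<delta>) = (\<theta> powr 2) powr \<delta>" by (simp add: powr_powr)
    also have "\<theta> powr 2 = s / r q" using \<theta> s r0 by (simp add: \<theta>_def)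
    finally have "\<theta> powr (2 * \<delta>) * r q powr \<delta> = s powr \<delta>" using s r0 by (simp add: powr_divide)
    then have "k * B * \<theta> powr (2 * \<delta>) * r q powr \<delta> = k * B * s powr \<delta>" by (simp add: mult.assoc)
    also have "\<dots> \<le> k * (C * (r q / s) powr c) * s powr \<delta>"
      using B k(1) by (intro mult_right_mono mult_left_mono) auto
    finally have "k * B * \<theta> powr (2 * \<delta>) * r q powr \<delta> \<le> (k * C) * (r q / s) powr c * s powr \<delta>"
      by (simp add: mult.assoc)
    moreover have "emeasure \<mu> (shadow q (\<kappa> * \<theta> * r q)) \<le> ennreal (k * B * \<theta> powr (2 * \<delta>) * r q powr \<delta>)"
      using k(2)[rule_format, of \<theta> \<kappa> i q] \<theta> i by (simp add: Let_def B_def)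
    ultimately show ?thesis unfolding \<theta>_def[symmetric] using ennreal_leI order_trans by blast
  qed
  then show ?thesis using c k(1) by (intro exI[of _ c] exI[of _ "k * C"]) auto
qed

text \<open>Sort the points by dyadic size of r q/s. Level n has at most C (2^n s)^(-\<delta>)
  points of weight at most 2^c 2^(nc), so the levels are dominated by a geometric series of ratio
  2^(c - \<delta>) < 1, here summed from J on.\<close>

lemma tail_sum_bound:
  assumes c0: "0 \<le> c" and c: "c < \<delta>"
  shows "\<exists>C>0. \<forall>J. \<forall>s>0. (\<Sum>q\<in>{q \<in> pts. 2 ^ J * s \<le> r q}. (r q / s) powr c) \<le>
    C * (2 powr (c - \<delta>)) ^ J * s powr (- \<delta>)"
proof -
  obtain C where C: "C > 0" "\<And>s. s > 0 \<Longrightarrow> finite {q \<in> pts. r q \<in> {s..2 * s}} \<and>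
      real (card {q \<in> pts. r q \<in> {s..2 * s}}) \<le> C * s powr (- \<delta>)"
    using count_upper_bound[of 2] by auto
  define x :: real where "x = 2 powr (c - \<delta>)"
  have "x < 2 powr 0" unfolding x_def using c by (intro powr_less_mono) auto
  then have x: "0 \<le> x" "x < 1" by (auto simp: x_def)
  define C' where "C' = C * 2 powr c / (1 - x)"
  have "(\<Sum>q\<in>{q \<in> pts. 2 ^ J * s \<le> r q}. (r q / s) powr c) \<le> C' * x ^ J * s powr (- \<delta>)"
    if s: "0 < s" for J s
  proof -
    define T where "T = {q \<in> pts. 2 ^ J * s \<le> r q}"
    have T: "finite T" unfolding T_def using s by (intro finite_large_horoballs) simp
    have "\<exists>j\<ge>J. 2 ^ j \<le> r q / s \<and> r q / s \<le> 2 * 2 ^ j" if "q \<in> T" for q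
      using that s by (intro dyadic_level_exists) (simp add: T_def field_simps)
    then obtain j where j: "\<And>q. q \<in> T \<Longrightarrow> J \<le> j q" "\<And>q. q \<in> T \<Longrightarrow> 2 ^ j q \<le> r q / s"
        "\<And>q. q \<in> T \<Longrightarrow> r q / s \<le> 2 * 2 ^ j q"
      by metis
    have level: "(\<Sum>q\<in>{q \<in> T. j q = n}. (r q / s) powr c) \<le> C * 2 powr c * s powr (- \<delta>) * x ^ n" for n
    proof -
      define S where "S = {q \<in> pts. r q \<in> {2 ^ n * s..2 * (2 ^ n * s)}}"
      have S: "finite S" "real (card S) \<le> C * (2 ^ n * s) powr (- \<delta>)" using C(2)[of "2 ^ n * s"] s by (auto simp: S_def)
      have "{q \<in> T. j q = n} \<subseteq> S"
        using j s by (auto simp: S_def T_def field_simps)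
      then have card: "real (card {q \<in> T. j q = n}) \<le> real (card S)" using card_mono[OF S(1)] by simp
      have "(\<Sum>q\<in>{q \<in> T. j q = n}. (r q / s) powr c) \<le> real (card {q \<in> T. j q = n}) * (2 * 2 ^ n) powr c"
      proof (rule sum_bounded_above)
        fix q assume q: "q \<in> {q \<in> T. j q = n}"
        then show "(r q / s) powr c \<le> (2 * 2 ^ n) powr c"
          using j(3)[of q] s radius_pos[of q] c0 by (intro powr_mono2) (auto simp: T_def less_imp_le)
      qed
      also have "\<dots> \<le> (C * (2 ^ n * s) powr (- \<delta>)) * (2 * 2 ^ n) powr c"
        using card S(2) by (intro mult_right_mono) auto
      also have "\<dots> = C * 2 powr c * s powr (- \<delta>) * x ^ n"
      proof -
        have "(2 :: real) ^ n = 2 powr real n" by (simp add: powr_realpow)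
        moreover have "x ^ n = 2 powr (real n * c) * 2 powr (- (real n * \<delta>))"
          by (simp add: x_def powr_powr powr_realpow[symmetric] powr_add[symmetric] algebra_simps)
        ultimately show ?thesis using s by (simp add: powr_mult powr_powr)
      qed
      finally show ?thesis .
    qed
    have "(\<Sum>q\<in>T. (r q / s) powr c) = (\<Sum>n\<in>j ` T. \<Sum>q\<in>{q \<in> T. j q = n}. (r q / s) powr c)"
      by (rule sum.image_gen[OF T])
    also have "\<dots> \<le> (\<Sum>n\<in>j ` T. C * 2 powr c * s powr (- \<delta>) * x ^ n)" by (intro sum_mono level)
    also have "\<dots> = C * 2 powr c * s powr (- \<delta>) * (\<Sum>n\<in>j ` T. x ^ n)" by (simp add: sum_distrib_left)
    also have "\<dots> \<le> C * 2 powr c * s powr (- \<delta>) * (x ^ J / (1 - x))"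
      using T j(1) C(1) by (intro mult_left_mono sum_powers_le[OF x]) auto
    finally show ?thesis by (simp add: T_def C'_def mult_ac)
  qed
  moreover have "C' > 0" using C x by (simp add: C'_def)
  ultimately show ?thesis unfolding x_def by blast
qed

text \<open>The covering shadows together carry at least the total mass M. Their bounds share the
  factor s^\<delta>; dividing by M s^\<delta> leaves a statement about radii alone.\<close>

lemma covering_measure_bound:
  "\<exists>c k s\<^sub>0. 0 \<le> c \<and> c < \<delta> \<and> 0 < k \<and> 0 < s\<^sub>0 \<and> (\<forall>s. 0 < s \<longrightarrow> s \<le> s\<^sub>0 \<longrightarrow>
     s powr (- \<delta>) \<le> k * (\<Sum>q\<in>{q \<in> pts. s \<le> r q}. (r q / s) powr c))"
proof -
  interpret finite_measure \<mu> by (rule finite_measure)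
  obtain \<kappa> s\<^sub>0 where \<kappa>: "\<kappa> > 0" and s\<^sub>0: "s\<^sub>0 > 0" and cover: "\<And>s \<xi>. 0 < s \<Longrightarrow> s \<le> s\<^sub>0 \<Longrightarrow> \<xi> \<in> limit_set x\<^sub>0 \<Gamma> \<Longrightarrow>
     \<exists>q\<in>pts. s \<le> r q \<and> \<xi> \<in> shadow q (\<kappa> * sqrt (s / r q) * r q)"
    using dirichlet_covering by blast
  obtain c k where ck: "0 \<le> c" "c < \<delta>" "0 < k" and k: "\<And>q s. q \<in> pts \<Longrightarrow> 0 < s \<Longrightarrow> s \<le> r q \<Longrightarrow>
    emeasure \<mu> (shadow q (\<kappa> * sqrt (s / r q) * r q)) \<le> ennreal (k * (r q / s) powr c * s powr \<delta>)"
    using covering_shadow_measure[OF \<kappa>] by blast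
  define M where "M = Sigma_Algebra.measure \<mu> (space \<mu>)"
  have M: "0 < M" unfolding M_def by (rule measure_space_pos)
  have "s powr (- \<delta>) \<le> (k / M) * (\<Sum>q\<in>{q \<in> pts. s \<le> r q}. (r q / s) powr c)"
    if s: "0 < s" "s \<le> s\<^sub>0" for s
  proof -
    define F where "F = {q \<in> pts. s \<le> r q}"
    define V where "V q = shadow q (\<kappa> * sqrt (s / r q) * r q)" for q
    have F: "finite F" unfolding F_def using s(1) by (rule finite_large_horoballs)
    have V: "V q \<in> sets \<mu>" if "q \<in> F" for q
      using that \<kappa> s radius_pos[of q] unfolding V_def F_def by (intro shadow_sets) auto
    have "limit_set x\<^sub>0 \<Gamma> \<subseteq> (\<Union>q\<in>F. V q)" using cover[OF s] unfolding F_def V_def by blast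
    then have "M \<le> Sigma_Algebra.measure \<mu> (\<Union>q\<in>F. V q)"
      unfolding M_def limit_set_measure(2)[symmetric]
      using F V by (intro finite_measure_mono) auto
    also have "\<dots> \<le> (\<Sum>q\<in>F. Sigma_Algebra.measure \<mu> (V q))"
      using F V by (intro finite_measure_subadditive_finite) auto
    also have "\<dots> \<le> (\<Sum>q\<in>F. k * (r q / s) powr c * s powr \<delta>)"
    proof (rule sum_mono)
      fix q assume "q \<in> F"
      then have "ennreal (Sigma_Algebra.measure \<mu> (V q)) \<le> ennreal (k * (r q / s) powr c * s powr \<delta>)"
        using k[of q s] s unfolding V_def F_def by (simp add: emeasure_eq_measure)
      then show "Sigma_Algebra.measure \<mu> (V q) \<le> k * (r q / s) powr c * s powr \<delta>"
        using ck by (subst (asm) ennreal_le_iff) auto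
    qed
    also have "\<dots> = k * (\<Sum>q\<in>F. (r q / s) powr c) * s powr \<delta>"
      by (simp add: sum_distrib_left sum_distrib_right)
    finally show ?thesis using M s by (simp add: F_def powr_minus field_simps)
  qed
  then show ?thesis using ck s\<^sub>0 M by (intro exI[of _ c] exI[of _ "k / M"] exI[of _ s\<^sub>0]) auto
qed

lemma count_lower_bound:
  "\<exists>J\<^sub>0. \<forall>J\<ge>J\<^sub>0. \<exists>C>0. \<forall>s. 0 < s \<longrightarrow> s \<le> (1 / 2) ^ J \<longrightarrow>
     C * s powr (- \<delta>) \<le> real (card {q \<in> pts. r q \<in> {s..2 ^ J * s}})"
proof -
  obtain c k s\<^sub>0 where c: "0 \<le> c" "c < \<delta>" and k: "0 < k" and s\<^sub>0: "0 < s\<^sub>0" and cover: "\<And>s. 0 < s \<Longrightarrow> s \<le> s\<^sub>0 \<Longrightarrow>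
     s powr (- \<delta>) \<le> k * (\<Sum>q\<in>{q \<in> pts. s \<le> r q}. (r q / s) powr c)"
    using covering_measure_bound by blast
  obtain T where T: "T > 0" and tail: "\<And>J s. 0 < s \<Longrightarrow>
      (\<Sum>q\<in>{q \<in> pts. 2 ^ J * s \<le> r q}. (r q / s) powr c) \<le> T * (2 powr (c - \<delta>)) ^ J * s powr (- \<delta>)"
    using tail_sum_bound[OF c] by blast
  have "2 powr (c - \<delta>) < 2 powr (0 :: real)" using c by (intro powr_less_mono) auto
  then have "(\<lambda>J. (2 powr (c - \<delta>)) ^ J) \<longlonglongrightarrow> 0" by (intro LIMSEQ_realpow_zero) auto
  \<comment> \<open>Below this threshold, k times the tail beyond \<open>2 ^ J * s\<close> is at
    most half of s^(-\<delta>), and the band has to supply the other half.\<close>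
  then have "eventually (\<lambda>J. (2 powr (c - \<delta>)) ^ J < 1 / (2 * k * T)) sequentially"
    using k T by (intro order_tendstoD(2)[of _ 0]) auto
  moreover have "(\<lambda>J. (1 / 2 :: real) ^ J) \<longlonglongrightarrow> 0" by (intro LIMSEQ_realpow_zero) auto
  then have "eventually (\<lambda>J. (1 / 2 :: real) ^ J < s\<^sub>0) sequentially" using s\<^sub>0 by (rule order_tendstoD(2))
  ultimately have "eventually (\<lambda>J. (2 powr (c - \<delta>)) ^ J < 1 / (2 * k * T) \<and> (1 / 2 :: real) ^ J < s\<^sub>0) sequentially"
    by (rule eventually_conj)
  then obtain J\<^sub>0 where J\<^sub>0: "\<And>J. J \<ge> J\<^sub>0 \<Longrightarrow> (2 powr (c - \<delta>)) ^ J < 1 / (2 * k * T)"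
      "\<And>J. J \<ge> J\<^sub>0 \<Longrightarrow> (1 / 2 :: real) ^ J < s\<^sub>0"
    unfolding eventually_sequentially by blast
  have "1 / (2 * k * (2 ^ J) powr c) * s powr (- \<delta>) \<le> real (card {q \<in> pts. r q \<in> {s..2 ^ J * s}})"
    if J: "J \<ge> J\<^sub>0" and s: "0 < s" "s \<le> (1 / 2) ^ J" for J s
  proof -
    define S where "S = {q \<in> pts. r q \<in> {s..2 ^ J * s}}"
    define U where "U = {q \<in> pts. 2 ^ J * s \<le> r q}"
    define w where "w q = (r q / s) powr c" for q
    have fin: "finite {q \<in> pts. s \<le> r q}" "finite U"
      unfolding U_def using s by (auto intro!: finite_large_horoballs)
    have "finite S" by (rule finite_subset[OF _ fin(1)]) (auto simp: S_def)
    have "sum w {q \<in> pts. s \<le> r q} \<le> sum w (S \<union> U)"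
      using \<open>finite S\<close> fin by (intro sum_mono2) (auto simp: S_def U_def w_def)
    \<comment> \<open>Only an inequality: radii equal to \<open>2 ^ J * s\<close> lie in both the
      band and the tail.\<close>
    also have "\<dots> \<le> sum w S + sum w U"
      using sum.union_inter[OF \<open>finite S\<close> fin(2), of w] sum_nonneg[of "S \<inter> U" w] by (simp add: w_def)
    also have "sum w S \<le> real (card S) * (2 ^ J) powr c"
    proof (rule sum_bounded_above)
      fix q assume "q \<in> S"
      then show "w q \<le> (2 ^ J) powr c" unfolding w_def S_def
        using s c by (intro powr_mono2) (auto simp: field_simps)
    qed
    also have "sum w U \<le> T * (2 powr (c - \<delta>)) ^ J * s powr (- \<delta>)"
      unfolding U_def w_def using s(1) by (rule tail)
    also have "\<dots> \<le> T * (1 / (2 * k * T)) * s powr (- \<delta>)"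
      using J\<^sub>0(1)[OF J] T by (intro mult_right_mono mult_left_mono) auto
    finally have "sum w {q \<in> pts. s \<le> r q} \<le> real (card S) * (2 ^ J) powr c + s powr (- \<delta>) / (2 * k)"
      using T by simp
    then have "k * sum w {q \<in> pts. s \<le> r q} \<le> k * (real (card S) * (2 ^ J) powr c + s powr (- \<delta>) / (2 * k))"
      using k by (intro mult_left_mono) auto
    moreover have "s powr (- \<delta>) \<le> k * sum w {q \<in> pts. s \<le> r q}"
      unfolding w_def using s J\<^sub>0(2)[OF J] by (intro cover) auto
    ultimately have "s powr (- \<delta>) \<le> k * (real (card S) * (2 ^ J) powr c) + s powr (- \<delta>) / 2"
      using k by (simp add: distrib_left)
    then have "s powr (- \<delta>) \<le> real (card S) * (2 * k * (2 ^ J) powr c)" by (simp add: mult_ac)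
    then show ?thesis unfolding S_def[symmetric] using k by (simp add: pos_divide_le_eq)
  qed
  then show ?thesis using k by (intro exI[of _ J\<^sub>0] allI impI exI[of _ "1 / (2 * k * (2 ^ J) powr c)" for J]) auto
qed

lemma parabolic_points_level_count:
  "\<exists>lam k :: real. 0 < lam \<and> lam < 1 \<and> 1 \<le> k \<and>
    (\<forall>n::nat. finite (parabolic_points_level x\<^sub>0 \<Gamma> r lam n) \<and>
       inverse k * lam powr (- (real n * \<delta>)) \<le> real (card (parabolic_points_level x\<^sub>0 \<Gamma> r lam n)) \<and>
       real (card (parabolic_points_level x\<^sub>0 \<Gamma> r lam n)) \<le> k * lam powr (- (real n * \<delta>)))"
proof -
  obtain J\<^sub>0 where J\<^sub>0: "\<And>J. J \<ge> J\<^sub>0 \<Longrightarrow> \<exists>C>0. \<forall>s. 0 < s \<longrightarrow> s \<le> (1 / 2) ^ J \<longrightarrow>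
     C * s powr (- \<delta>) \<le> real (card {q \<in> pts. r q \<in> {s..2 ^ J * s}})"
    using count_lower_bound by blast
  \<comment> \<open>The successor makes J positive, hence lam < 1; J then satisfies the lower bound
    because it holds from \<open>J\<^sub>0\<close> on.\<close>
  define J where "J = Suc J\<^sub>0"
  define lam :: real where "lam = (1 / 2) ^ J"
  have "lam < 1" unfolding lam_def J_def by (rule power_Suc_less_one) auto
  then have lam: "0 < lam" "lam < 1" by (auto simp: lam_def)
  obtain C\<^sub>1 where C\<^sub>1: "C\<^sub>1 > 0" "\<And>s. 0 < s \<Longrightarrow> s \<le> lam \<Longrightarrow>
      C\<^sub>1 * s powr (- \<delta>) \<le> real (card {q \<in> pts. r q \<in> {s..2 ^ J * s}})"
    using J\<^sub>0[of J] unfolding lam_def J_def by auto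
  obtain C\<^sub>2 where C\<^sub>2: "C\<^sub>2 > 0" "\<And>s. 0 < s \<Longrightarrow> finite {q \<in> pts. r q \<in> {s..2 ^ J * s}} \<and>
      real (card {q \<in> pts. r q \<in> {s..2 ^ J * s}}) \<le> C\<^sub>2 * s powr (- \<delta>)"
    using count_upper_bound[of "2 ^ J"] by auto
  \<comment> \<open>The extra factor lam^(-\<delta>) arises because the band of level n starts at s
    = lam^(n+1), not at lam^n.\<close>
  define k where "k = max 1 (max (1 / C\<^sub>1) (C\<^sub>2 * lam powr (- \<delta>)))"
  have k: "1 \<le> k" "inverse k \<le> C\<^sub>1" "C\<^sub>2 * lam powr (- \<delta>) \<le> k"
  proof -
    have "1 / C\<^sub>1 \<le> k" by (simp add: k_def)
    then have "inverse k \<le> inverse (1 / C\<^sub>1)" using C\<^sub>1(1) by (intro le_imp_inverse_le) auto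
    then show "inverse k \<le> C\<^sub>1" by simp
  qed (auto simp: k_def)
  have "finite (parabolic_points_level x\<^sub>0 \<Gamma> r lam n) \<and>
       inverse k * lam powr (- (real n * \<delta>)) \<le> real (card (parabolic_points_level x\<^sub>0 \<Gamma> r lam n)) \<and>
       real (card (parabolic_points_level x\<^sub>0 \<Gamma> r lam n)) \<le> k * lam powr (- (real n * \<delta>))" for n
  proof -
    define s where "s = lam ^ Suc n"
    \<comment> \<open>The exponent n + 1 also gives s <= lam for every n, so the lower count applies
      already at n = 0.\<close>
    have s: "0 < s" "s \<le> lam" using lam by (auto simp: s_def power_le_one mult_le_cancel_left1)
    have "2 ^ J * lam = 1" by (simp add: lam_def power_mult_distrib[symmetric])
    then have e: "2 ^ J * s = lam ^ n" by (simp add: s_def)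
    have level: "parabolic_points_level x\<^sub>0 \<Gamma> r lam n = {q \<in> pts. r q \<in> {s..2 ^ J * s}}"
      unfolding parabolic_points_level_def e by (auto simp: s_def)
    have "s = lam powr (real n + 1)" using lam by (simp add: s_def powr_add powr_realpow)
    then have sp: "s powr (- \<delta>) = lam powr (- \<delta>) * lam powr (- (real n * \<delta>))"
      by (simp add: powr_powr powr_add[symmetric] algebra_simps)
    have "1 \<le> lam powr (- \<delta>)" using powr_mono'[of "- \<delta>" 0 lam] lam delta_pos by simp
    then have "C\<^sub>1 * (1 * lam powr (- (real n * \<delta>))) \<le> C\<^sub>1 * s powr (- \<delta>)"
      unfolding sp using C\<^sub>1(1) by (intro mult_left_mono mult_right_mono) auto
    moreover have "inverse k * lam powr (- (real n * \<delta>)) \<le> C\<^sub>1 * lam powr (- (real n * \<delta>))"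
      using k by (intro mult_right_mono) auto
    moreover have "C\<^sub>2 * s powr (- \<delta>) \<le> k * lam powr (- (real n * \<delta>))"
      unfolding sp mult.assoc[symmetric] using k by (intro mult_right_mono) auto
    ultimately show ?thesis unfolding level using C\<^sub>1(2)[OF s] C\<^sub>2(2)[OF s(1)] by auto
  qed
  then show ?thesis using lam k(1) by blast
qed

end

theorem proposition6p4:
  fixes x\<^sub>0 :: "'a::heine_borel"
    and \<Gamma> :: "('a \<Rightarrow> 'a) set"
    and a :: nat
    and p :: "nat \<Rightarrow> (nat \<Rightarrow> 'a) set"
    and r :: "(nat \<Rightarrow> 'a) set \<Rightarrow> real"
    and \<mu> :: "(nat \<Rightarrow> 'a) set measure"
    and \<delta> :: real
  assumes "geodesic_space (UNIV :: 'a set)"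
    and "gromov_hyperbolic (UNIV :: 'a set)"
    and "geometrically_finite x\<^sub>0 \<Gamma>"
    and "\<exists>g. parabolic_element x\<^sub>0 \<Gamma> g"
    and "parabolic_representatives x\<^sub>0 \<Gamma> a p"
    and "horoball_decomposition x\<^sub>0 \<Gamma> r"
    and "tempered_parabolic_subgroups x\<^sub>0 \<delta> \<Gamma>"
    and "measure_on_limit_set x\<^sub>0 \<Gamma> \<mu>"
    and "horoball_shadow_lemma x\<^sub>0 \<Gamma> a p r \<mu> \<delta>"
  shows "\<exists>lam k :: real. 0 < lam \<and> lam < 1 \<and> 1 \<le> k \<and>
    (\<forall>n::nat. finite (parabolic_points_level x\<^sub>0 \<Gamma> r lam n) \<and>
       inverse k * lam powr (- (real n * \<delta>)) \<le> real (card (parabolic_points_level x\<^sub>0 \<Gamma> r lam n)) \<and>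
       real (card (parabolic_points_level x\<^sub>0 \<Gamma> r lam n)) \<le> k * lam powr (- (real n * \<delta>)))"
proof -
  obtain D where D: "0 \<le> D" "\<And>w x y z :: 'a. gromov_product w x z \<ge> min (gromov_product w x y) (gromov_product w y z) - D"
    using assms(2) unfolding gromov_hyperbolic_def by auto
  obtain S where S: "S \<subseteq> limit_set x\<^sub>0 \<Gamma>" "card S = 3"
    using assms(3) unfolding geometrically_finite_def by blast
  then obtain \<xi> \<eta> where "\<xi> \<in> S" "\<eta> \<in> S" "\<xi> \<noteq> \<eta>"
    by (metis card_eq_0_iff card_le_Suc0_iff_eq numeral_3_eq_3 Suc_n_not_le_n le_SucI nat.distinct(1))
  then have "\<exists>\<xi>\<in>limit_set x\<^sub>0 \<Gamma>. \<exists>\<eta>\<in>limit_set x\<^sub>0 \<Gamma>. \<xi> \<noteq> \<eta>" using S by blast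
  then interpret horoball_shadow_action x\<^sub>0 D \<Gamma> r a p \<mu> \<delta>
    using assms D by unfold_locales (auto simp: geometrically_finite_def)
  show ?thesis by (rule parabolic_points_level_count)
qed

end
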